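(* Let $d=1$, $p>1$ and $p-1\le q<m$. Then $u_{c,m}$ has the closed form $$u_{c,m}(r)=\left(\frac{m+1}{q+1}\right)^{\frac1{m-q}}\left(1-B^{-1}\Big(\bar Cr;1-\frac1p,\frac{p-1-q}{p(m-q)}\Big)\right)^{\frac1{m-q}},\qquad r\ge0,$$ where $$\bar C=\left(\frac{p}{p-1}\right)^{1/p}(m-q)(m+1)^{\frac{1+q-p}{p(m-q)}}(q+1)^{\frac{p-m-1}{p(m-q)}}.$$ The best constant is $$C_{q,m,p}=\left(\frac{2^p(p-1)^{1-p}\,\eta_1^{\frac{\eta_1}{m-q}}}{(m-q)^{2p-1}\,\eta_2^{\frac{\eta_2}{m-q}}}\,\mathcal{B}\Big(\frac{\eta_2}{p(m-q)},\frac{2p-1}{p}\Big)^p\right)^{-\ell},$$ where $\eta_1=(p-1)(m+1)+p$, $\eta_2=(p-1)(q+1)+p$ and $\ell=\frac{m-q}{(m+1)[(p-1)(q+1)+p]}$. Moreover, there are $r_*>0$ and $C>0$ independent of $m$ such that for every $m>2q+1$ the function $u=u_{c,m}$ satisfies: (1) if $q>p-1$, then $u(r)+r|u'(r)|\le C\,r^{-\frac{p}{q+1-p}}$ for $r\ge2r_*$; (2) if $q=p-1$, then $u(r)\le e^{-Cr}$ for $r\ge2r_*$.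
   Context: $u_{c,m}$ is the unique positive decreasing solution of $$(|u'|^{p-2}u')'+u^m=u^q\quad(0<r<\infty),\qquad u'(0)=0,\quad\lim_{r\to\infty}u(r)=0.$$ $C_{q,m,p}$ is the smallest constant $C$ such that, with $\theta=\frac{p(m-q)}{(m+1)[(p-1)(q+1)+p]}$, $$\|u\|_{L^{m+1}(\mathbb{R})}\le C\,\|u\|_{L^{q+1}(\mathbb{R})}^{1-\theta}\|u'\|_{L^p(\mathbb{R})}^{\theta}\quad\text{for all }u\in L^{q+1}(\mathbb{R})\text{ with }u'\in L^p(\mathbb{R}).$$ $B(x;a,b)=\int_0^xt^{a-1}(1-t)^{b-1}dt$ for $0\le x<1$ and $a>0$ (here $b\le0$ is allowed), $B^{-1}(\,\cdot\,;a,b)$ is the inverse function of $x\mapsto B(x;a,b)$, and $\mathcal{B}(a,b)=\int_0^1t^{a-1}(1-t)^{b-1}dt$ for $a,b>0$. *)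

theory Defs
  imports "HOL-Analysis.Analysis"
begin

text \<open>
  Only the values of \<open>u\<close> on \<open>[0,\<infinity>)\<close> matter; in particular \<open>u'(0) = 0\<close> is a one-sided derivative.
  Where \<open>u'\<close> vanishes, \<open>0 powr (p - 2) = 0\<close> gives \<open>|u'|\<^sup>p\<^sup>-\<^sup>2 u' = 0\<close> also for \<open>p < 2\<close>.
\<close>

definition pos_decr_solution :: "real \<Rightarrow> real \<Rightarrow> real \<Rightarrow> (real \<Rightarrow> real) \<Rightarrow> bool" where
  "pos_decr_solution p q m u \<longleftrightarrow>
     (\<forall>r\<ge>0. 0 < u r) \<and>
     strict_antimono_on {0..} u \<and>
     (\<forall>r>0. u differentiable at r) \<and>
     (\<forall>r>0. \<exists>D. ((\<lambda>s. \<bar>deriv u s\<bar> powr (p - 2) * deriv u s) has_real_derivative D) (at r) \<and>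
                 D + u r powr m = u r powr q) \<and>
     (u has_real_derivative 0) (at 0 within {0..}) \<and>
     (u \<longlongrightarrow> 0) at_top"

definition Lp :: "real \<Rightarrow> (real \<Rightarrow> real) \<Rightarrow> bool" where
  "Lp s f \<longleftrightarrow> f \<in> borel_measurable lebesgue \<and> integrable lebesgue (\<lambda>x. \<bar>f x\<bar> powr s)"

definition Lp_norm :: "real \<Rightarrow> (real \<Rightarrow> real) \<Rightarrow> real" where
  "Lp_norm s f = (LINT x|lebesgue. \<bar>f x\<bar> powr s) powr (1 / s)"

definition locally_integrable :: "(real \<Rightarrow> real) \<Rightarrow> bool" where
  "locally_integrable f \<longleftrightarrow> (\<forall>a b. set_integrable lebesgue {a..b} f)"

definition test_function :: "(real \<Rightarrow> real) \<Rightarrow> bool" where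
  "test_function \<phi> \<longleftrightarrow>
     (\<forall>n x. (deriv ^^ n) \<phi> differentiable at x) \<and> (\<exists>R. \<forall>x. R < \<bar>x\<bar> \<longrightarrow> \<phi> x = 0)"

definition weak_derivative :: "(real \<Rightarrow> real) \<Rightarrow> (real \<Rightarrow> real) \<Rightarrow> bool" where
  "weak_derivative u v \<longleftrightarrow>
     locally_integrable u \<and> locally_integrable v \<and>
     (\<forall>\<phi>. test_function \<phi> \<longrightarrow>
        (LINT x|lebesgue. u x * deriv \<phi> x) = - (LINT x|lebesgue. v x * \<phi> x))"

definition GN_exponent :: "real \<Rightarrow> real \<Rightarrow> real \<Rightarrow> real" where
  "GN_exponent p q m = p * (m - q) / ((m + 1) * ((p - 1) * (q + 1) + p))"

text \<open>
  Membership of \<open>u\<close> in \<open>L\<^sup>m\<^sup>+\<^sup>1\<close> is part of the inequality (a finite right-hand side forces it); it has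
  to be stated because the Bochner integral of a non-integrable function is \<open>0\<close>.
\<close>

definition GN_inequality :: "real \<Rightarrow> real \<Rightarrow> real \<Rightarrow> real \<Rightarrow> bool" where
  "GN_inequality p q m C \<longleftrightarrow>
     (\<forall>u v. Lp (q + 1) u \<and> weak_derivative u v \<and> Lp p v \<longrightarrow>
        Lp (m + 1) u \<and>
        Lp_norm (m + 1) u \<le>
          C * Lp_norm (q + 1) u powr (1 - GN_exponent p q m) * Lp_norm p v powr GN_exponent p q m)"

definition is_GN_best_constant :: "real \<Rightarrow> real \<Rightarrow> real \<Rightarrow> real \<Rightarrow> bool" where
  "is_GN_best_constant p q m C \<longleftrightarrow>
     GN_inequality p q m C \<and> (\<forall>C'. GN_inequality p q m C' \<longrightarrow> C \<le> C')"

text \<open>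
  The incomplete Beta function, for \<open>0 \<le> x < 1\<close>, \<open>a > 0\<close> and arbitrary real \<open>b\<close>.
  The complete one (\<open>a, b > 0\<close>) is \<^const>\<open>Beta\<close>; see \<open>has_integral_Beta_real\<close>.
\<close>

definition inc_Beta :: "real \<Rightarrow> real \<Rightarrow> real \<Rightarrow> real" where
  "inc_Beta x a b = integral {0..x} (\<lambda>t. t powr (a - 1) * (1 - t) powr (b - 1))"

definition inv_inc_Beta :: "real \<Rightarrow> real \<Rightarrow> real \<Rightarrow> real" where
  "inv_inc_Beta y a b = the_inv_into {0..<1} (\<lambda>x. inc_Beta x a b) y"

definition C_bar :: "real \<Rightarrow> real \<Rightarrow> real \<Rightarrow> real" where
  "C_bar p q m =
     (p / (p - 1)) powr (1 / p) * (m - q)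
     * (m + 1) powr ((1 + q - p) / (p * (m - q)))
     * (q + 1) powr ((p - m - 1) / (p * (m - q)))"

definition u_closed :: "real \<Rightarrow> real \<Rightarrow> real \<Rightarrow> real \<Rightarrow> real" where
  "u_closed p q m r =
     ((m + 1) / (q + 1)) powr (1 / (m - q))
     * (1 - inv_inc_Beta (C_bar p q m * r) (1 - 1 / p) ((p - 1 - q) / (p * (m - q))))
         powr (1 / (m - q))"

definition GN_constant_closed :: "real \<Rightarrow> real \<Rightarrow> real \<Rightarrow> real" where
  "GN_constant_closed p q m =
     (let \<eta>1 = (p - 1) * (m + 1) + p;
          \<eta>2 = (p - 1) * (q + 1) + p;
          l = (m - q) / ((m + 1) * ((p - 1) * (q + 1) + p))
      in (2 powr p * (p - 1) powr (1 - p) * \<eta>1 powr (\<eta>1 / (m - q))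
            / ((m - q) powr (2 * p - 1) * \<eta>2 powr (\<eta>2 / (m - q)))
          * Beta (\<eta>2 / (p * (m - q))) ((2 * p - 1) / p) powr p) powr (- l))"

end

theory Submission
  imports Defs
begin

text \<open>
  With \<open>H s = p / (p - 1) * (s\<^sup>q\<^sup>+\<^sup>1 / (q + 1) - s\<^sup>m\<^sup>+\<^sup>1 / (m + 1))\<close>, conservation of energy and \<open>u \<rightarrow> 0\<close> turn the
  equation into \<open>\<bar>u'\<bar>\<^sup>p = H u\<close>, and \<open>u'(0) = 0\<close> forces \<open>u 0\<close> to be the positive zero \<open>A\<close> of \<open>H\<close>. In the variable
  \<open>x = 1 - (u / A)\<^sup>m\<^sup>-\<^sup>q\<close> the equation separates, and its solution is an inverse incomplete Beta function.

  The inequality needs no rearrangement. Scale \<open>u\<close> so that \<open>sup \<bar>u\<bar> = A\<close>, and let \<open>G\<close> be the primitive of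
  \<open>g = H\<^sup>(\<^sup>p\<^sup>-\<^sup>1\<^sup>)\<^sup>/\<^sup>p\<close> with \<open>G 0 = 0\<close>. Following \<open>G \<bar>u\<bar>\<close> from the maximum to both ends, Hoelder's inequality gives
  \<open>2 G A \<le> \<integral> g \<bar>u\<bar> \<bar>u'\<bar> \<le> \<parallel>u'\<parallel>\<^sub>p (\<integral> H \<bar>u\<bar>)\<^sup>(\<^sup>p\<^sup>-\<^sup>1\<^sup>)\<^sup>/\<^sup>p\<close>. The integral of \<open>H \<bar>u\<bar>\<close> is a difference of multiples of
  \<open>\<integral> \<bar>u\<bar>\<^sup>q\<^sup>+\<^sup>1\<close> and \<open>\<integral> \<bar>u\<bar>\<^sup>m\<^sup>+\<^sup>1\<close>, and the weighted mean inequality brings it into product form.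
  Every step is an equality for the even extension of the solution of the equation, and \<open>G A\<close> is a Beta integral.

  For the decay, \<open>x\<close> reaches \<open>1/2\<close> at a time bounded independently of \<open>m\<close>, and from then on \<open>\<bar>u'\<bar>\<close> is
  comparable to \<open>u\<^sup>(\<^sup>q\<^sup>+\<^sup>1\<^sup>)\<^sup>/\<^sup>p\<close> with constants independent of \<open>m\<close>.
\<close>

section \<open>Smooth bump functions\<close>

text \<open>The inequality ranges over weak derivatives, so it is first reduced to indefinite
  integrals (du Bois-Reymond); there an upper bound for increments of \<open>G \<bar>U\<bar>\<close>
  suffices, obtained by bisecting intervals. The normalisation of the supremum confines
  \<open>\<bar>U\<bar>\<close> to the interval where \<open>H\<close> is nonnegative. The variable
  is not dilated: the weights of the mean inequality are chosen so that the exponents of the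
  scale-invariant inequality come out. For a solution, Hoelder is an equality because
  \<open>\<bar>u'\<bar>^p\<close> and \<open>g(u)^(p/(p-1))\<close> both equal \<open>H u\<close>,
  and the mean inequality because its two terms coincide, as the explicit integrals show. The
  hypothesis \<open>p - 1 \<le> q\<close> makes the second Beta parameter nonpositive, so the
  incomplete Beta function tends to infinity at 1 and the solution stays positive for all
  \<open>r\<close>. The bound \<open>m > 2 * q + 1\<close> says \<open>m - q > q + 1\<close>; it
  bounds \<open>C_bar\<close> from below and the second Beta parameter by -1 from below, both
  independently of \<open>m\<close>.\<close>

primrec smooth_upto :: "nat \<Rightarrow> (real \<Rightarrow> real) \<Rightarrow> bool" where
  "smooth_upto 0 f \<longleftrightarrow> (\<forall>x. f differentiable at x)"
| "smooth_upto (Suc n) f \<longleftrightarrow> (\<forall>x. f differentiable at x) \<and> smooth_upto n (deriv f)"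

lemma smooth_upto_funpow: "smooth_upto n f \<Longrightarrow> (deriv ^^ n) f differentiable at x"
  by (induction n arbitrary: f) (auto simp del: funpow.simps simp: funpow_Suc_right funpow_0)

lemma smooth_upto_SucI:
  assumes "\<And>x. (f has_real_derivative f' x) (at x)" "smooth_upto n f'"
  shows "smooth_upto (Suc n) f"
proof -
  have "deriv f = f'"
    using assms(1) by (auto intro!: DERIV_imp_deriv)
  then show ?thesis
    using assms by (auto simp: real_differentiable_def)
qed

lemma smooth_upto_SucD:
  assumes "smooth_upto (Suc n) f"
  shows "(f has_real_derivative deriv f x) (at x)" "smooth_upto n (deriv f)"
  using assms by (auto simp: DERIV_deriv_iff_real_differentiable)

lemma smooth_upto_0D:
  "smooth_upto 0 f \<Longrightarrow> (f has_real_derivative deriv f x) (at x)"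
  by (auto simp: DERIV_deriv_iff_real_differentiable)

lemma smooth_upto_Suc_imp: "smooth_upto (Suc n) f \<Longrightarrow> smooth_upto n f"
  by (induction n arbitrary: f) auto

lemma smooth_upto_add:
  "smooth_upto n f \<Longrightarrow> smooth_upto n g \<Longrightarrow> smooth_upto n (\<lambda>x. f x + g x)"
proof (induction n arbitrary: f g)
  case 0
  then show ?case by auto
next
  case (Suc n)
  show ?case
    by (rule smooth_upto_SucI[OF DERIV_add[OF smooth_upto_SucD(1) smooth_upto_SucD(1)]])
       (use Suc smooth_upto_SucD(2) in blast)+
qed

lemma smooth_upto_mult:
  "smooth_upto n f \<Longrightarrow> smooth_upto n g \<Longrightarrow> smooth_upto n (\<lambda>x. f x * g x)"
proof (induction n arbitrary: f g)
  case 0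
  then show ?case by auto
next
  case (Suc n)
  show ?case
  proof (rule smooth_upto_SucI)
    show "((\<lambda>x. f x * g x) has_real_derivative deriv f x * g x + f x * deriv g x) (at x)" for x
      by (rule DERIV_cong[OF DERIV_mult[OF smooth_upto_SucD(1)[OF Suc.prems(1)]
          smooth_upto_SucD(1)[OF Suc.prems(2)]]]) (simp add: mult.commute)
    show "smooth_upto n (\<lambda>x. deriv f x * g x + f x * deriv g x)"
      using smooth_upto_add Suc.IH[OF smooth_upto_SucD(2)[OF Suc.prems(1)] smooth_upto_Suc_imp[OF Suc.prems(2)]]
        Suc.IH[OF smooth_upto_Suc_imp[OF Suc.prems(1)] smooth_upto_SucD(2)[OF Suc.prems(2)]] by blast
  qed
qed

lemma smooth_upto_const: "smooth_upto n (\<lambda>x. c)"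
  by (induction n arbitrary: c) (auto simp: deriv_const)

lemma smooth_upto_affine:
  "smooth_upto n f \<Longrightarrow> smooth_upto n (\<lambda>x. f (a * x + b))"
proof (induction n arbitrary: f)
  case 0
  then have "((\<lambda>x. f (a * x + b)) has_real_derivative deriv f (a * x + b) * a) (at x)" for x
    by (intro DERIV_chain2[where f = f] smooth_upto_0D) (auto intro!: derivative_eq_intros)
  then show ?case by (auto simp: real_differentiable_def)
next
  case (Suc n)
  show ?case
  proof (rule smooth_upto_SucI)
    show "((\<lambda>x. f (a * x + b)) has_real_derivative deriv f (a * x + b) * a) (at x)" for x
      by (intro DERIV_chain2[where f = f] smooth_upto_SucD(1)[OF Suc.prems])
         (auto intro!: derivative_eq_intros)
    show "smooth_upto n (\<lambda>x. deriv f (a * x + b) * a)"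
      by (rule smooth_upto_mult[OF Suc.IH[OF smooth_upto_SucD(2)[OF Suc.prems]] smooth_upto_const])
  qed
qed

text \<open>The classical \<open>exp (- 1 / x)\<close> divided by \<open>x ^ k\<close>.
  Differentiation maps this family to linear combinations of its members, so smoothness of all of
  them follows by one induction.\<close>

definition flat_exp :: "nat \<Rightarrow> real \<Rightarrow> real" where
  "flat_exp k x = (if x \<le> 0 then 0 else exp (- (1 / x)) / x ^ k)"

lemma flat_exp_tendsto_0: "(flat_exp k \<longlongrightarrow> 0) (at 0)"
proof -
  have "((\<lambda>t::real. t ^ k / exp t) \<longlongrightarrow> 0) at_top"
    by (rule tendsto_power_div_exp_0)
  then have "((\<lambda>x::real. (inverse x) ^ k / exp (inverse x)) \<longlongrightarrow> 0) (at_right 0)"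
    by (rule filterlim_compose[OF _ filterlim_inverse_at_top_right])
  then have "(flat_exp k \<longlongrightarrow> 0) (at_right 0)"
  proof (rule Lim_transform_eventually)
    show "\<forall>\<^sub>F x in at_right 0. inverse x ^ k / exp (inverse x) = flat_exp k x"
      by (rule eventually_mono[OF eventually_at_right_less])
         (simp add: flat_exp_def exp_minus divide_simps)
  qed
  moreover have "(flat_exp k \<longlongrightarrow> 0) (at_left 0)"
  proof (rule Lim_transform_eventually[OF tendsto_const])
    show "\<forall>\<^sub>F x in at_left 0. 0 = flat_exp k x"
      by (rule eventually_mono[OF eventually_at_left_real[of "-1"]]) (simp_all add: flat_exp_def)
  qed
  ultimately show ?thesis
    by (simp add: filterlim_at_split)
qed

lemma flat_exp_deriv:
  "(flat_exp k has_real_derivative flat_exp (k + 2) x + - real k * flat_exp (k + 1) x) (at x)"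
proof -
  consider "x < 0" | "x = 0" | "x > 0" by linarith
  then show ?thesis
  proof cases
    case 1
    have "((\<lambda>x. 0) has_real_derivative 0) (at x)" by simp
    then have "(flat_exp k has_real_derivative 0) (at x)"
      by (rule has_field_derivative_transform_within_open[of _ _ _ "{..<0}"])
         (use 1 in \<open>auto simp: flat_exp_def\<close>)
    with 1 show ?thesis by (simp add: flat_exp_def)
  next
    case 2
    \<comment> \<open>At 0 the difference quotient of \<open>flat_exp k\<close> is
      \<open>flat_exp (k + 1)\<close>, which tends to 0.\<close>
    have "(flat_exp k has_real_derivative 0) (at 0)"
      unfolding has_field_derivative_iff
      by (rule Lim_transform_eventually[OF flat_exp_tendsto_0[of "Suc k"]])
         (auto simp: flat_exp_def eventually_at_filter)
    with 2 show ?thesis by (simp add: flat_exp_def)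
  next
    case 3
    have "((\<lambda>x. exp (- (1 / x)) / x ^ k) has_real_derivative
            flat_exp (k + 2) x + - real k * flat_exp (k + 1) x) (at x)"
    proof -
      have e: "((\<lambda>x. exp (- (1 / x))) has_real_derivative exp (- (1 / x)) / x\<^sup>2) (at x)"
        using 3 by (auto intro!: derivative_eq_intros simp: power2_eq_square)
      have "exp (- (1 / x)) / x\<^sup>2 * x ^ k - exp (- (1 / x)) * (real k * x ^ (k - Suc 0))
          = (flat_exp (k + 2) x + - real k * flat_exp (k + 1) x) * (x ^ k * x ^ k)"
        using 3 by (cases k) (simp_all add: flat_exp_def field_simps power2_eq_square)
      then show ?thesis
        using 3 DERIV_divide[OF e DERIV_pow[of k x UNIV]] by (simp add: divide_simps)
    qed
    then show ?thesis
      by (rule has_field_derivative_transform_within_open[of _ _ _ "{0<..}"])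
         (use 3 in \<open>auto simp: flat_exp_def\<close>)
  qed
qed

lemma smooth_upto_flat_exp: "smooth_upto n (flat_exp k)"
proof (induction n arbitrary: k)
  case 0
  then show ?case using flat_exp_deriv by (auto simp: real_differentiable_def)
next
  case (Suc n)
  show ?case
    by (rule smooth_upto_SucI[OF flat_exp_deriv])
       (intro smooth_upto_add smooth_upto_mult smooth_upto_const Suc)
qed

text \<open>Trades iterates of \<open>deriv\<close> for the recursion \<open>smooth_upto\<close>,
  which peels off the innermost derivative and therefore passes through sums and products by
  induction.\<close>

lemma test_function_iff:
  "test_function f \<longleftrightarrow> (\<forall>n. smooth_upto n f) \<and> (\<exists>R. \<forall>x. R < \<bar>x\<bar> \<longrightarrow> f x = 0)"
proof -
  have "smooth_upto n f" if "\<And>n x. (deriv ^^ n) f differentiable at x" for n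
    using that
  proof (induction n arbitrary: f)
    case 0
    from 0[of 0] show ?case by simp
  next
    case (Suc n)
    have "smooth_upto n (deriv f)"
      by (rule Suc.IH) (use Suc.prems[of "Suc _"] in \<open>simp del: funpow.simps add: funpow_Suc_right\<close>)
    with Suc.prems[of 0] show ?case by simp
  qed
  then show ?thesis
    unfolding test_function_def using smooth_upto_funpow by blast
qed

text \<open>The factor \<open>n\<close> steepens both flanks while the function keeps vanishing
  outside \<open>{a<..<b}\<close>. The bumps stay between 0 and 1 and tend pointwise to the
  indicator function, which is the setting of dominated convergence.\<close>

definition bump :: "real \<Rightarrow> real \<Rightarrow> nat \<Rightarrow> real \<Rightarrow> real" where
  "bump a b n x = flat_exp 0 (real n * x + - real n * a) * flat_exp 0 (- real n * x + real n * b)"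

lemma bump_eq_0: "x \<notin> {a<..<b} \<Longrightarrow> bump a b n x = 0"
proof -
  assume "x \<notin> {a<..<b}"
  then have "x \<le> a \<or> b \<le> x" by auto
  then have "real n * x + - real n * a \<le> 0 \<or> - real n * x + real n * b \<le> 0"
    by (auto intro: mult_left_mono)
  then show ?thesis unfolding bump_def flat_exp_def by auto
qed

lemma test_function_bump: "test_function (bump a b n)"
proof -
  have "smooth_upto k (bump a b n)" for k
    unfolding bump_def by (intro smooth_upto_mult smooth_upto_affine smooth_upto_flat_exp)
  moreover have "bump a b n x = 0" if "\<bar>a\<bar> + \<bar>b\<bar> < \<bar>x\<bar>" for x
    by (rule bump_eq_0) (use that in auto)
  ultimately show ?thesis by (auto simp: test_function_iff)
qed

lemma bump_bounds: "0 \<le> bump a b n x" "bump a b n x \<le> 1"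
  by (auto simp: bump_def flat_exp_def intro!: mult_le_one)

lemma bump_tendsto: "(\<lambda>n. bump a b n x) \<longlonglongrightarrow> indicator {a<..<b} x"
proof (cases "x \<in> {a<..<b}")
  case True
  then have pos: "x - a > 0" "b - x > 0" "a < x" "x < b" by auto
  have lim: "(\<lambda>n. exp (- (inverse (real n) / c))) \<longlonglongrightarrow> exp (- (0 / c))" if "c > 0" for c
    by (intro tendsto_intros lim_inverse_n) (use that in auto)
  have "(\<lambda>n. exp (- (inverse (real n) / (x - a))) * exp (- (inverse (real n) / (b - x)))) \<longlonglongrightarrow> 1"
    using tendsto_mult[OF lim[OF pos(1)] lim[OF pos(2)]] by simp
  then have "(\<lambda>n. bump a b n x) \<longlonglongrightarrow> 1"
  proof (rule Lim_transform_eventually)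
    show "\<forall>\<^sub>F n in sequentially.
      exp (- (inverse (real n) / (x - a))) * exp (- (inverse (real n) / (b - x))) = bump a b n x"
    proof (rule eventually_mono[OF eventually_gt_at_top[of 0]])
      fix n :: nat assume n: "0 < n"
      have "real n * x + - real n * a = real n * (x - a)" "- real n * x + real n * b = real n * (b - x)"
        by (simp_all add: algebra_simps)
      moreover have "real n * (x - a) > 0" "real n * (b - x) > 0" using n pos by auto
      ultimately show "exp (- (inverse (real n) / (x - a))) * exp (- (inverse (real n) / (b - x))) = bump a b n x"
        unfolding bump_def flat_exp_def by (simp add: field_simps)
    qed
  qed
  with True show ?thesis by simp
next
  case False
  then show ?thesis by (simp add: bump_eq_0)
qed

section \<open>Primitives of locally integrable functions\<close>

text \<open>
  An additive interval function dominated by an integral near every point is dominated globally.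
  This stands in for the almost everywhere derivatives of absolutely continuous functions.
\<close>

lemma increment_bound:
  fixes D :: "real \<Rightarrow> real \<Rightarrow> real"
  assumes "a \<le> b"
    and add: "\<And>x y z. x \<le> y \<Longrightarrow> y \<le> z \<Longrightarrow> D x z = D x y + D y z"
    and int: "\<And>x y. h integrable_on {x..y}"
    and local: "\<And>x. \<exists>d>0. \<forall>s t. s \<le> x \<and> x \<le> t \<and> t - s < d \<longrightarrow> \<bar>D s t\<bar> \<le> integral {s..t} h"
  shows "\<bar>D a b\<bar> \<le> integral {a..b} h"
  using \<open>a \<le> b\<close>
proof (rule Bolzano[where P = "\<lambda>s t. \<bar>D s t\<bar> \<le> integral {s..t} h"])
  fix x y z assume *: "\<bar>D x y\<bar> \<le> integral {x..y} h" "\<bar>D y z\<bar> \<le> integral {y..z} h" "x \<le> y" "y \<le> z"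
  then show "\<bar>D x z\<bar> \<le> integral {x..z} h"
    using add[of x y z] Henstock_Kurzweil_Integration.integral_combine[OF *(3,4) int] by linarith
qed (use local in blast)

text \<open>Local absolute continuity in integrated form; it speaks of increments only and never of
  derivatives of \<open>U\<close> at points.\<close>

definition AC_primitive :: "(real \<Rightarrow> real) \<Rightarrow> (real \<Rightarrow> real) \<Rightarrow> bool" where
  "AC_primitive U v \<longleftrightarrow>
     (\<forall>a b. v absolutely_integrable_on {a..b}) \<and> (\<forall>a b. a \<le> b \<longrightarrow> U b - U a = integral {a..b} v)"

lemma AC_primitive_exists:
  assumes v: "\<And>a b. v absolutely_integrable_on {a..b}"
  obtains V where "AC_primitive V v"
proof
  define V where "V x = (if 0 \<le> x then integral {0..x} v else - integral {x..0} v)" for x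
  have int: "v integrable_on {a..b}" for a b
    using v set_lebesgue_integral_eq_integral(1) by blast
  have "V b - V a = integral {a..b} v" if "a \<le> b" for a b
  proof -
    consider "0 \<le> a" | "a < 0" "0 \<le> b" | "b < 0" using that by linarith
    then show ?thesis
    proof cases
      case 1
      then show ?thesis
        using Henstock_Kurzweil_Integration.integral_combine[OF 1 that int] that by (simp add: V_def)
    next
      case 2
      then show ?thesis
        using Henstock_Kurzweil_Integration.integral_combine[OF _ _ int, of a 0 b] by (simp add: V_def)
    next
      case 3
      then show ?thesis
        using Henstock_Kurzweil_Integration.integral_combine[OF that _ int, of 0] that by (simp add: V_def)
    qed
  qed
  then show "AC_primitive V v"
    using v by (simp add: AC_primitive_def)
qed

context
  fixes U v :: "real \<Rightarrow> real"
  assumes AC: "AC_primitive U v"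
begin

lemma AC_primitive_abs_integrable: "v absolutely_integrable_on {a..b}"
  using AC by (simp add: AC_primitive_def)

lemma AC_primitive_integrable: "v integrable_on {a..b}" "(\<lambda>x. \<bar>v x\<bar>) integrable_on {a..b}"
  using AC_primitive_abs_integrable unfolding absolutely_integrable_on_def by auto

lemma AC_primitive_diff: "a \<le> b \<Longrightarrow> U b - U a = integral {a..b} v"
  using AC by (simp add: AC_primitive_def)

lemma AC_primitive_abs_diff:
  assumes "a \<le> b" shows "\<bar>U b - U a\<bar> \<le> integral {a..b} (\<lambda>x. \<bar>v x\<bar>)"
  using Henstock_Kurzweil_Integration.integral_norm_bound_integral[OF AC_primitive_integrable, of a b]
    AC_primitive_diff[OF assms] by simp

lemma AC_primitive_continuous: "continuous_on UNIV U"
proof -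
  have "isCont U x" for x
  proof -
    have "continuous_on {x-1..x+1} (\<lambda>y. U (x-1) + integral {x-1..y} v)"
      by (intro continuous_intros indefinite_integral_continuous_1 AC_primitive_integrable)
    also have "?this \<longleftrightarrow> continuous_on {x-1..x+1} U"
      by (intro continuous_on_cong) (simp_all flip: AC_primitive_diff)
    finally show ?thesis
      by (rule continuous_on_interior) simp
  qed
  then show ?thesis by (simp add: continuous_at_imp_continuous_on)
qed

lemma AC_primitive_mult_integrable:
  assumes "continuous_on UNIV f"
  shows "(\<lambda>x. f x * v x) absolutely_integrable_on {a..b}"
proof (rule absolutely_integrable_bounded_measurable_product_real)
  have "continuous_on {a..b} f" using assms continuous_on_subset by blast
  then show "bounded (f ` {a..b})" "f \<in> borel_measurable (lebesgue_on {a..b})"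
    by (auto intro: compact_imp_bounded compact_continuous_image continuous_imp_measurable_on_sets_lebesgue)
qed (auto intro: AC_primitive_abs_integrable)

text \<open>On a short interval the defect \<open>D s t\<close> is the integral of
  \<open>(U t - U x) * \<phi>' x + (\<phi> s - \<phi> x) * v x\<close>. By continuity of
  \<open>U\<close> and \<open>\<phi>\<close> it is at most \<open>e\<close> times the integral of
  \<open>\<bar>\<phi>'\<bar> + \<bar>v\<bar>\<close>. \<open>increment_bound\<close> makes this
  global, and then \<open>e\<close> tends to 0.\<close>

lemma AC_primitive_parts:
  assumes "\<And>x. (\<phi> has_real_derivative \<phi>' x) (at x)" "continuous_on UNIV \<phi>'" "a \<le> b"
  shows "U b * \<phi> b - U a * \<phi> a = integral {a..b} (\<lambda>x. U x * \<phi>' x + \<phi> x * v x)"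
proof -
  define D where "D s t = U t * \<phi> t - U s * \<phi> s - integral {s..t} (\<lambda>x. U x * \<phi>' x + \<phi> x * v x)" for s t
  have cont_\<phi>: "continuous_on UNIV \<phi>"
    using assms(1) DERIV_isCont continuous_at_imp_continuous_on by blast
  have int\<phi>': "\<phi>' integrable_on {s..t}" "(\<lambda>x. \<bar>\<phi>' x\<bar>) integrable_on {s..t}" for s t
    by (intro integrable_continuous_real continuous_intros continuous_on_subset[OF assms(2)] subset_UNIV)+
  have int1: "(\<lambda>x. U x * \<phi>' x) integrable_on {s..t}" for s t
    by (intro integrable_continuous_real continuous_intros
        continuous_on_subset[OF assms(2)] continuous_on_subset[OF AC_primitive_continuous] subset_UNIV)
  have int2: "(\<lambda>x. \<phi> x * v x) integrable_on {s..t}" for s t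
    using AC_primitive_mult_integrable[OF cont_\<phi>] set_lebesgue_integral_eq_integral(1) by blast
  have D_eq: "D s t = integral {s..t} (\<lambda>x. (U t - U x) * \<phi>' x + (\<phi> s - \<phi> x) * v x)" if "s \<le> t" for s t
  proof -
    have "(\<phi>' has_integral \<phi> t - \<phi> s) {s..t}"
      by (rule fundamental_theorem_of_calculus[OF that])
         (use assms(1) in \<open>auto simp flip: has_real_derivative_iff_has_vector_derivative
           intro: has_field_derivative_at_within\<close>)
    then have "((\<lambda>x. U t * \<phi>' x + \<phi> s * v x - (U x * \<phi>' x + \<phi> x * v x)) has_integral
        U t * (\<phi> t - \<phi> s) + \<phi> s * (U t - U s) - integral {s..t} (\<lambda>x. U x * \<phi>' x + \<phi> x * v x)) {s..t}"
      by (intro has_integral_diff has_integral_add has_integral_mult_right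
          integrable_integral[OF integrable_add[OF int1 int2]])
         (use AC_primitive_diff[OF that] integrable_integral[OF AC_primitive_integrable(1)] in auto)
    moreover have "U t * (\<phi> t - \<phi> s) + \<phi> s * (U t - U s) = U t * \<phi> t - U s * \<phi> s"
      by (simp add: algebra_simps)
    moreover have "(\<lambda>x. U t * \<phi>' x + \<phi> s * v x - (U x * \<phi>' x + \<phi> x * v x))
        = (\<lambda>x. (U t - U x) * \<phi>' x + (\<phi> s - \<phi> x) * v x)"
      by (auto simp: algebra_simps)
    ultimately have "((\<lambda>x. (U t - U x) * \<phi>' x + (\<phi> s - \<phi> x) * v x) has_integral D s t) {s..t}"
      by (simp only: D_def)
    then show ?thesis by (simp add: integral_unique)
  qed
  have "\<bar>D a b\<bar> \<le> e * integral {a..b} (\<lambda>x. \<bar>\<phi>' x\<bar> + \<bar>v x\<bar>)" if e: "e > 0" for e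
  proof -
    have "\<bar>D a b\<bar> \<le> integral {a..b} (\<lambda>x. e * (\<bar>\<phi>' x\<bar> + \<bar>v x\<bar>))"
    proof (rule increment_bound[OF assms(3)])
      fix x y z :: real assume *: "x \<le> y" "y \<le> z"
      have "(\<lambda>x. U x * \<phi>' x + \<phi> x * v x) integrable_on {x..z}"
        by (intro integrable_add int1 int2)
      from Henstock_Kurzweil_Integration.integral_combine[OF * this]
      show "D x z = D x y + D y z" by (simp add: D_def)
    next
      show "(\<lambda>x. e * (\<bar>\<phi>' x\<bar> + \<bar>v x\<bar>)) integrable_on {x..y}" for x y
        by (intro integrable_on_mult_right integrable_add int\<phi>' AC_primitive_integrable)
    next
      fix x
      have "isCont U x" "isCont \<phi> x"
        using AC_primitive_continuous cont_\<phi> by (auto simp: continuous_on_eq_continuous_at)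
      then obtain d1 d2 where d: "d1 > 0" "d2 > 0"
          "\<And>y. \<bar>y - x\<bar> < d1 \<Longrightarrow> \<bar>U y - U x\<bar> < e / 2" "\<And>y. \<bar>y - x\<bar> < d2 \<Longrightarrow> \<bar>\<phi> y - \<phi> x\<bar> < e / 2"
        unfolding continuous_at_eps_delta dist_real_def using e by (metis half_gt_zero)
      have "\<bar>D s t\<bar> \<le> integral {s..t} (\<lambda>x. e * (\<bar>\<phi>' x\<bar> + \<bar>v x\<bar>))"
        if st: "s \<le> x" "x \<le> t" "t - s < min d1 d2" for s t
      proof -
        have "\<bar>(U t - U y) * \<phi>' y + (\<phi> s - \<phi> y) * v y\<bar> \<le> e * (\<bar>\<phi>' y\<bar> + \<bar>v y\<bar>)" if "y \<in> {s..t}" for y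
        proof -
          have "\<bar>U t - U y\<bar> \<le> e" "\<bar>\<phi> s - \<phi> y\<bar> \<le> e"
            using d(3)[of t] d(3)[of y] d(4)[of s] d(4)[of y] st that
            by (smt (verit) atLeastAtMost_iff field_sum_of_halves)+
          then have "\<bar>(U t - U y) * \<phi>' y\<bar> \<le> e * \<bar>\<phi>' y\<bar>" "\<bar>(\<phi> s - \<phi> y) * v y\<bar> \<le> e * \<bar>v y\<bar>"
            by (auto simp: abs_mult intro: mult_right_mono)
          then show ?thesis by (simp add: algebra_simps)
        qed
        moreover have "(\<lambda>y. (U t - U y) * \<phi>' y + (\<phi> s - \<phi> y) * v y) integrable_on {s..t}"
        proof -
          have "(\<lambda>y. U t * \<phi>' y + \<phi> s * v y - (U y * \<phi>' y + \<phi> y * v y)) integrable_on {s..t}"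
            by (intro integrable_diff integrable_add int1 int2 integrable_on_mult_right int\<phi>' AC_primitive_integrable)
          then show ?thesis by (simp add: algebra_simps)
        qed
        moreover have "(\<lambda>x. e * (\<bar>\<phi>' x\<bar> + \<bar>v x\<bar>)) integrable_on {s..t}"
          by (intro integrable_on_mult_right integrable_add int\<phi>' AC_primitive_integrable)
        ultimately have "norm (integral {s..t} (\<lambda>y. (U t - U y) * \<phi>' y + (\<phi> s - \<phi> y) * v y))
            \<le> integral {s..t} (\<lambda>x. e * (\<bar>\<phi>' x\<bar> + \<bar>v x\<bar>))"
          by (intro Henstock_Kurzweil_Integration.integral_norm_bound_integral) auto
        then show ?thesis using D_eq[of s t] st by simp
      qed
      then show "\<exists>d>0. \<forall>s t. s \<le> x \<and> x \<le> t \<and> t - s < d \<longrightarrow>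
          \<bar>D s t\<bar> \<le> integral {s..t} (\<lambda>x. e * (\<bar>\<phi>' x\<bar> + \<bar>v x\<bar>))"
        using d(1,2) by (intro exI[of _ "min d1 d2"]) auto
    qed
    then show ?thesis by simp
  qed
  then have "\<bar>D a b\<bar> \<le> 0"
  proof -
    let ?I = "integral {a..b} (\<lambda>x. \<bar>\<phi>' x\<bar> + \<bar>v x\<bar>)"
    assume *: "\<And>e. e > 0 \<Longrightarrow> \<bar>D a b\<bar> \<le> e * ?I"
    have "((\<lambda>e. e * ?I) \<longlongrightarrow> 0 * ?I) (at_right 0)" by (intro tendsto_intros)
    then have "((\<lambda>e. e * ?I) \<longlongrightarrow> 0) (at_right 0)" by simp
    then show ?thesis
      by (rule tendsto_lowerbound) (auto intro: eventually_mono[OF eventually_at_right_less] *)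
  qed
  then show ?thesis by (simp add: D_def)
qed

text \<open>The half of the chain rule that the variational argument uses. Near a point
  \<open>x\<close> the weight \<open>g\<close> is almost the constant
  \<open>g \<bar>U x\<bar>\<close>, and \<open>G\<close> is Lipschitz there with nearly this
  constant. The local estimate has an error \<open>e\<close> times the integral of
  \<open>\<bar>v\<bar>\<close>, which disappears after globalising.\<close>

lemma AC_primitive_chain_bound:
  assumes G: "\<And>y. 0 \<le> y \<Longrightarrow> (G has_real_derivative g y) (at y within {0..})"
    and g: "continuous_on {0..} g" "\<And>y. 0 \<le> y \<Longrightarrow> 0 \<le> g y" and ab: "a \<le> b"
  shows "\<bar>G (\<bar>U b\<bar>) - G (\<bar>U a\<bar>)\<bar> \<le> integral {a..b} (\<lambda>x. g (\<bar>U x\<bar>) * \<bar>v x\<bar>)"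
proof -
  have cont_gU: "continuous_on UNIV (\<lambda>x. g (\<bar>U x\<bar>))"
    by (rule continuous_on_compose2[OF g(1)]) (auto intro!: continuous_intros AC_primitive_continuous)
  have int_gv: "(\<lambda>x. g (\<bar>U x\<bar>) * \<bar>v x\<bar>) integrable_on {s..t}" for s t
  proof -
    have "(\<lambda>x. norm (g (\<bar>U x\<bar>) * v x)) integrable_on {s..t}"
      using AC_primitive_mult_integrable[OF cont_gU] unfolding absolutely_integrable_on_def by blast
    then show ?thesis using g(2) by (simp add: abs_mult)
  qed
  have bound: "\<bar>G y - G z\<bar> \<le> B * \<bar>y - z\<bar>"
    if "0 \<le> y" "0 \<le> z" and B: "\<And>w. w \<in> {min y z..max y z} \<Longrightarrow> g w \<le> B" for y z B
  proof (rule field_differentiable_bound[where S = "{min y z..max y z}" and f' = g, unfolded real_norm_def])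
    fix w assume w: "w \<in> {min y z..max y z}"
    then show "(G has_real_derivative g w) (at w within {min y z..max y z})"
      using that(1,2) by (intro has_field_derivative_subset[OF G]) auto
    show "\<bar>g w\<bar> \<le> B"
      using w B that(1,2) g(2)[of w] by auto
  qed auto
  have "\<bar>G (\<bar>U b\<bar>) - G (\<bar>U a\<bar>)\<bar> \<le> integral {a..b} (\<lambda>x. g (\<bar>U x\<bar>) * \<bar>v x\<bar>) + e * integral {a..b} (\<lambda>x. \<bar>v x\<bar>)"
    if e: "e > 0" for e
  proof -
    have "\<bar>G (\<bar>U b\<bar>) - G (\<bar>U a\<bar>)\<bar> \<le> integral {a..b} (\<lambda>x. g (\<bar>U x\<bar>) * \<bar>v x\<bar> + e * \<bar>v x\<bar>)"
    proof (rule increment_bound[where D = "\<lambda>s t. G (\<bar>U t\<bar>) - G (\<bar>U s\<bar>)", OF ab])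
      show "(\<lambda>x. g (\<bar>U x\<bar>) * \<bar>v x\<bar> + e * \<bar>v x\<bar>) integrable_on {s..t}" for s t
        by (intro integrable_add int_gv integrable_on_mult_right AC_primitive_integrable)
    next
      fix x
      have "continuous (at \<bar>U x\<bar> within {0..}) g"
        using g(1) by (simp add: continuous_on_eq_continuous_within)
      then obtain \<eta> where \<eta>: "\<eta> > 0" "\<And>y. y \<ge> 0 \<Longrightarrow> \<bar>y - \<bar>U x\<bar>\<bar> < \<eta> \<Longrightarrow> \<bar>g y - g (\<bar>U x\<bar>)\<bar> < e / 2"
        unfolding continuous_within_eps_delta dist_real_def using e by (metis half_gt_zero atLeast_iff)
      have "isCont U x"
        using AC_primitive_continuous by (auto simp: continuous_on_eq_continuous_at)
      then obtain d where d: "d > 0" "\<And>y. \<bar>y - x\<bar> < d \<Longrightarrow> \<bar>U y - U x\<bar> < \<eta>"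
        unfolding continuous_at_eps_delta dist_real_def using \<eta>(1) by metis
      have "\<bar>G (\<bar>U t\<bar>) - G (\<bar>U s\<bar>)\<bar> \<le> integral {s..t} (\<lambda>x. g (\<bar>U x\<bar>) * \<bar>v x\<bar> + e * \<bar>v x\<bar>)"
        if st: "s \<le> x" "x \<le> t" "t - s < d" for s t
      proof -
        have near: "\<bar>\<bar>U y\<bar> - \<bar>U x\<bar>\<bar> < \<eta>" if "y \<in> {s..t}" for y
        proof -
          have "\<bar>y - x\<bar> < d" using st that by (auto simp: abs_less_iff)
          from d(2)[OF this] show ?thesis by linarith
        qed
        \<comment> \<open>Half of the tolerance \<open>e\<close> makes \<open>B\<close> an upper
          bound for \<open>g\<close> between \<open>\<bar>U s\<bar>\<close> and
          \<open>\<bar>U t\<bar>\<close>; the other half gives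
          \<open>B \<le> g \<bar>U y\<bar> + e\<close> for every \<open>y\<close> in the
          interval.\<close>
        define B where "B = g (\<bar>U x\<bar>) + e / 2"
        have "\<bar>G (\<bar>U t\<bar>) - G (\<bar>U s\<bar>)\<bar> \<le> B * \<bar>\<bar>U t\<bar> - \<bar>U s\<bar>\<bar>"
        proof (rule bound)
          fix w assume w: "w \<in> {min \<bar>U t\<bar> \<bar>U s\<bar>..max \<bar>U t\<bar> \<bar>U s\<bar>}"
          then have "0 \<le> w" by auto
          moreover have "\<bar>w - \<bar>U x\<bar>\<bar> < \<eta>"
          proof -
            have "\<bar>\<bar>U t\<bar> - \<bar>U x\<bar>\<bar> < \<eta>" "\<bar>\<bar>U s\<bar> - \<bar>U x\<bar>\<bar> < \<eta>"
              using near[of t] near[of s] st by simp_all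
            with w show ?thesis unfolding atLeastAtMost_iff min_def max_def by argo
          qed
          ultimately show "g w \<le> B"
            using \<eta>(2)[of w] unfolding B_def by linarith
        qed auto
        also have "\<dots> \<le> B * \<bar>U t - U s\<bar>"
          using e g(2)[of "\<bar>U x\<bar>"] by (intro mult_left_mono abs_triangle_ineq3) (auto simp: B_def)
        also have "\<dots> \<le> B * integral {s..t} (\<lambda>x. \<bar>v x\<bar>)"
          using e g(2)[of "\<bar>U x\<bar>"] st by (intro mult_left_mono AC_primitive_abs_diff) (auto simp: B_def)
        also have "\<dots> = integral {s..t} (\<lambda>x. B * \<bar>v x\<bar>)" by simp
        also have "\<dots> \<le> integral {s..t} (\<lambda>x. g (\<bar>U x\<bar>) * \<bar>v x\<bar> + e * \<bar>v x\<bar>)"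
        proof (rule integral_le)
          show "(\<lambda>x. B * \<bar>v x\<bar>) integrable_on {s..t}"
            by (intro integrable_on_mult_right AC_primitive_integrable)
          show "(\<lambda>x. g (\<bar>U x\<bar>) * \<bar>v x\<bar> + e * \<bar>v x\<bar>) integrable_on {s..t}"
            by (intro integrable_add int_gv integrable_on_mult_right AC_primitive_integrable)
          fix y assume y: "y \<in> {s..t}"
          have "B \<le> g (\<bar>U y\<bar>) + e"
            using \<eta>(2)[OF abs_ge_zero near[OF y]] e unfolding B_def by linarith
          then have "B * \<bar>v y\<bar> \<le> (g (\<bar>U y\<bar>) + e) * \<bar>v y\<bar>" by (intro mult_right_mono) auto
          then show "B * \<bar>v y\<bar> \<le> g (\<bar>U y\<bar>) * \<bar>v y\<bar> + e * \<bar>v y\<bar>" by (simp add: algebra_simps)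
        qed
        finally show ?thesis .
      qed
      with d(1) show "\<exists>d>0. \<forall>s t. s \<le> x \<and> x \<le> t \<and> t - s < d \<longrightarrow>
          \<bar>G (\<bar>U t\<bar>) - G (\<bar>U s\<bar>)\<bar> \<le> integral {s..t} (\<lambda>x. g (\<bar>U x\<bar>) * \<bar>v x\<bar> + e * \<bar>v x\<bar>)"
        by blast
    qed auto
    also have "\<dots> = integral {a..b} (\<lambda>x. g (\<bar>U x\<bar>) * \<bar>v x\<bar>) + integral {a..b} (\<lambda>x. e * \<bar>v x\<bar>)"
      by (intro Henstock_Kurzweil_Integration.integral_add int_gv integrable_on_mult_right AC_primitive_integrable)
    finally show ?thesis by simp
  qed
  then show ?thesis
  proof -
    let ?I = "integral {a..b} (\<lambda>x. \<bar>v x\<bar>)" and ?J = "integral {a..b} (\<lambda>x. g (\<bar>U x\<bar>) * \<bar>v x\<bar>)"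
    assume *: "\<And>e. e > 0 \<Longrightarrow> \<bar>G (\<bar>U b\<bar>) - G (\<bar>U a\<bar>)\<bar> \<le> ?J + e * ?I"
    have "((\<lambda>e. ?J + e * ?I) \<longlongrightarrow> ?J + 0 * ?I) (at_right 0)" by (intro tendsto_intros)
    then have "((\<lambda>e. ?J + e * ?I) \<longlongrightarrow> ?J) (at_right 0)" by simp
    then show ?thesis
      by (rule tendsto_lowerbound) (auto intro: eventually_mono[OF eventually_at_right_less] *)
  qed
qed

end

section \<open>Weak derivatives in one dimension\<close>

text \<open>On each \<open>{-n..n}\<close> the positive and the negative part of \<open>w\<close>
  are densities of two finite measures. These agree on all half-lines, hence are equal, and
  densities are unique almost everywhere.\<close>

lemma AE_zero_if_intervals_zero:
  fixes w :: "real \<Rightarrow> real"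
  assumes w: "\<And>a b. w absolutely_integrable_on {a..b}"
    and zero: "\<And>a b. a \<le> b \<Longrightarrow> integral {a..b} w = 0"
  shows "AE x in lebesgue. w x = 0"
proof -
  have "AE x in lebesgue. x \<in> {-real n..real n} \<longrightarrow> w x = 0" for n :: nat
  proof -
    let ?f = "\<lambda>x. indicator {-real n..real n} x *\<^sub>R w x"
    have f: "integrable lebesgue ?f"
      using w unfolding set_integrable_def .
    \<comment> \<open>\<open>w\<close> is only Lebesgue measurable; uniqueness of densities is
      applied over \<open>lborel\<close>, to a Borel version.\<close>
    obtain f' where f'[measurable]: "f' \<in> borel_measurable lborel" and ae: "AE x in lborel. ?f x = f' x"
      using completion_ex_borel_measurable_real[OF borel_measurable_integrable[OF f]] by blast
    have ae': "AE x in lebesgue. ?f x = f' x" using ae by (rule AE_completion)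
    have intf': "integrable lborel f'"
    proof -
      have "integrable lebesgue f'"
        using f ae' by (rule integrable_cong_AE_imp[OF _ measurable_completion[OF f']])
      then show ?thesis by (simp add: integrable_completion)
    qed
    have set0: "(LINT x|lborel. indicator {c<..} x * f' x) = 0" for c
    proof -
      have "(LINT x|lborel. indicator {c<..} x * f' x) = (LINT x|lebesgue. indicator {c<..} x * f' x)"
        by (intro integral_completion[symmetric]) measurable
      also have "\<dots> = (LINT x|lebesgue. indicator {max c (-real n)..real n} x *\<^sub>R w x)"
      proof (rule integral_cong_AE)
        show "(\<lambda>x. indicator {c<..} x * f' x) \<in> borel_measurable lebesgue"
          by (intro measurable_completion) measurable
        show "(\<lambda>x. indicator {max c (-real n)..real n} x *\<^sub>R w x) \<in> borel_measurable lebesgue"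
          using w unfolding set_integrable_def by (rule borel_measurable_integrable)
        \<comment> \<open>The half-line is open and the interval closed, so the two indicators may
          differ at \<open>c\<close>.\<close>
        have "AE x in lebesgue. x \<noteq> c"
          by (rule AE_completion) (rule AE_lborel_singleton)
        with ae' show "AE x in lebesgue. indicator {c<..} x * f' x = indicator {max c (-real n)..real n} x *\<^sub>R w x"
          by eventually_elim (auto simp: indicator_def split: if_splits)
      qed
      also have "\<dots> = (LINT x:{max c (-real n)..real n}|lebesgue. w x)"
        by (simp add: set_lebesgue_integral_def)
      also have "\<dots> = integral {max c (-real n)..real n} w"
        by (rule set_lebesgue_integral_eq_integral(2)[OF w])
      also have "\<dots> = 0"
        using zero[of "max c (-real n)" "real n"] by (cases "max c (-real n) \<le> real n") auto
      finally show ?thesis .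
    qed
    have em: "emeasure (density lborel (\<lambda>x. ennreal (max 0 (s * f' x)))) {c<..} =
        ennreal (LINT x|lborel. indicator {c<..} x * max 0 (s * f' x))" for c s
    proof -
      have "emeasure (density lborel (\<lambda>x. ennreal (max 0 (s * f' x)))) {c<..}
          = (\<integral>\<^sup>+x. ennreal (indicator {c<..} x * max 0 (s * f' x)) \<partial>lborel)"
        by (subst emeasure_density) (auto intro!: nn_integral_cong simp: indicator_def)
      also have "\<dots> = ennreal (LINT x|lborel. indicator {c<..} x * max 0 (s * f' x))"
        using integrable_mult_indicator[of "{c<..}" lborel "\<lambda>x. max 0 (s * f' x)"] intf'
        by (intro nn_integral_eq_integral AE_I2) simp_all
      finally show ?thesis .
    qed
    have "density lborel (\<lambda>x. ennreal (max 0 (1 * f' x))) = density lborel (\<lambda>x. ennreal (max 0 (-1 * f' x)))"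
    proof (rule measure_eqI_lessThan)
      fix c
      have int: "integrable lborel (\<lambda>x. indicator {c<..} x * max 0 (s * f' x))" for s
        using integrable_mult_indicator[of "{c<..}" lborel "\<lambda>x. max 0 (s * f' x)"] intf' by simp
      have "(LINT x|lborel. indicator {c<..} x * max 0 (1 * f' x)) - (LINT x|lborel. indicator {c<..} x * max 0 (-1 * f' x))
          = (LINT x|lborel. indicator {c<..} x * max 0 (1 * f' x) - indicator {c<..} x * max 0 (-1 * f' x))"
        by (intro Bochner_Integration.integral_diff[symmetric] int)
      also have "\<dots> = (LINT x|lborel. indicator {c<..} x * f' x)"
        by (intro Bochner_Integration.integral_cong) (auto simp: indicator_def max_def)
      finally have "(LINT x|lborel. indicator {c<..} x * max 0 (1 * f' x)) = (LINT x|lborel. indicator {c<..} x * max 0 (-1 * f' x))"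
        using set0 by simp
      then show "emeasure (density lborel (\<lambda>x. ennreal (max 0 (1 * f' x)))) {c<..} =
          emeasure (density lborel (\<lambda>x. ennreal (max 0 (-1 * f' x)))) {c<..}"
        unfolding em by simp
      show "emeasure (density lborel (\<lambda>x. ennreal (max 0 (1 * f' x)))) {c<..} < \<infinity>"
        unfolding em by simp
    qed simp_all
    then have "AE x in lborel. ennreal (max 0 (1 * f' x)) = ennreal (max 0 (-1 * f' x))"
      by (subst (asm) sigma_finite_measure.density_unique_iff[OF lborel.sigma_finite_measure_axioms]) auto
    then have "AE x in lebesgue. ennreal (max 0 (1 * f' x)) = ennreal (max 0 (-1 * f' x))"
      by (rule AE_completion)
    with ae' show ?thesis
      by eventually_elim (auto simp: max_def indicator_def split: if_splits)
  qed
  then have "AE x in lebesgue. \<forall>n::nat. x \<in> {-real n..real n} \<longrightarrow> w x = 0"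
    unfolding AE_all_countable by blast
  then show ?thesis
  proof eventually_elim
    case (elim x)
    obtain n where "\<bar>x\<bar> \<le> real n" using real_arch_simple by blast
    with elim show ?case by (auto simp: abs_le_iff)
  qed
qed

lemma bump_integral_tendsto:
  assumes w: "w absolutely_integrable_on {a..b}"
  shows "(\<lambda>n. LINT x|lebesgue. w x * bump a b n x) \<longlonglongrightarrow> integral {a..b} w"
    and "integrable lebesgue (\<lambda>x. w x * bump a b n x)"
proof -
  let ?w = "\<lambda>x. indicator {a..b} x *\<^sub>R w x"
  have int: "integrable lebesgue ?w" using w unfolding set_integrable_def .
  have [measurable]: "bump a b n \<in> borel_measurable lborel" for n
  proof -
    have "smooth_upto 0 (bump a b n)" using test_function_bump test_function_iff by blast
    then have "continuous_on UNIV (bump a b n)"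
      by (auto intro: continuous_at_imp_continuous_on differentiable_imp_continuous_within)
    then show ?thesis by (simp add: borel_measurable_continuous_onI)
  qed
  have meas: "bump a b n \<in> borel_measurable lebesgue" for n
    by (intro measurable_completion) measurable
  have eq: "w x * bump a b n x = ?w x * bump a b n x" for n x
    by (cases "x \<in> {a..b}") (auto simp: bump_eq_0)
  have bound: "norm (?w x * bump a b n x) \<le> norm (?w x)" for x n
    using bump_bounds[of a b n x] by (auto simp: abs_mult intro: mult_left_le)
  have ms: "(\<lambda>x. ?w x * bump a b n x) \<in> borel_measurable lebesgue" for n
    using borel_measurable_integrable[OF int] meas by (rule borel_measurable_times)
  show "integrable lebesgue (\<lambda>x. w x * bump a b n x)"
    unfolding eq by (rule Bochner_Integration.integrable_bound[OF int ms]) (use bound in auto)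
  have ae: "AE x in lebesgue. x \<noteq> a \<and> x \<noteq> b"
    using AE_conjI[OF AE_completion[OF AE_lborel_singleton[of a]] AE_completion[OF AE_lborel_singleton[of b]]] .
  have "(\<lambda>n. LINT x|lebesgue. ?w x * bump a b n x) \<longlonglongrightarrow> (LINT x|lebesgue. ?w x)"
  proof (rule integral_dominated_convergence)
    show "integrable lebesgue (\<lambda>x. norm (?w x))" using int by (rule integrable_norm)
    show "AE x in lebesgue. (\<lambda>n. ?w x * bump a b n x) \<longlonglongrightarrow> ?w x"
      using ae
    proof eventually_elim
      case (elim x)
      have "(\<lambda>n. ?w x * bump a b n x) \<longlonglongrightarrow> ?w x * indicator {a<..<b} x"
        by (intro tendsto_intros bump_tendsto)
      also have "?w x * indicator {a<..<b} x = ?w x" using elim by (auto simp: indicator_def)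
      finally show ?case .
    qed
  qed (use bound ms borel_measurable_integrable[OF int] in auto)
  also have "(LINT x|lebesgue. ?w x) = integral {a..b} w"
    using set_lebesgue_integral_eq_integral(2)[OF w] by (simp add: set_lebesgue_integral_def)
  finally show "(\<lambda>n. LINT x|lebesgue. w x * bump a b n x) \<longlonglongrightarrow> integral {a..b} w"
    unfolding eq .
qed

text \<open>The vanishing integral is what makes the primitive return to 0 to the right of the
  support.\<close>

lemma test_function_primitive:
  assumes \<theta>: "\<And>n. smooth_upto n \<theta>" and supp: "\<And>x. R < \<bar>x\<bar> \<Longrightarrow> \<theta> x = 0"
    and zero: "integral {-R..R} \<theta> = 0" and "0 \<le> R"
  obtains \<phi> where "test_function \<phi>" "deriv \<phi> = \<theta>"
proof
  \<comment> \<open>Starting one unit to the left of the support makes every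
    \<open>x \<ge> -R\<close> an interior point for the fundamental theorem.\<close>
  define \<phi> where "\<phi> x = integral {-R-1..x} \<theta>" for x
  have "\<theta> differentiable at x" for x using \<theta>[of 0] by simp
  then have cont: "continuous_on S \<theta>" for S
    by (intro continuous_at_imp_continuous_on) (auto intro: differentiable_imp_continuous_within)
  have int: "\<theta> integrable_on {a..b}" for a b
    using cont by (rule integrable_continuous_real)
  have \<phi>0: "\<phi> x = 0" if "x \<le> -R" for x
  proof -
    have "(\<theta> has_integral 0) {-R-1..x}"
    proof (rule has_integral_spike_finite[OF _ _ has_integral_0])
      show "finite {-R}" by simp
      show "\<theta> y = 0" if "y \<in> {-R-1..x} - {-R}" for y
        by (rule supp) (use that \<open>x \<le> -R\<close> \<open>0 \<le> R\<close> in auto)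
    qed
    then show ?thesis unfolding \<phi>_def by (rule integral_unique)
  qed
  have deriv: "(\<phi> has_real_derivative \<theta> x) (at x)" for x
  proof (cases "x < -R")
    case True
    have "((\<lambda>x. 0) has_real_derivative 0) (at x)" by simp
    then have "(\<phi> has_real_derivative 0) (at x)"
      by (rule has_field_derivative_transform_within_open[of _ _ _ "{..<-R}"]) (use True \<phi>0 in auto)
    then show ?thesis using supp[of x] True by simp
  next
    case False
    have "(\<phi> has_real_derivative \<theta> x) (at x within {-R-1..x+1})"
      unfolding \<phi>_def by (rule integral_has_real_derivative) (use False cont in auto)
    moreover have "at x within {-R-1..x+1} = at x"
      using False by (intro at_within_interior) auto
    ultimately show ?thesis by simp
  qed
  then show "deriv \<phi> = \<theta>" by (auto intro: DERIV_imp_deriv)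
  have "\<phi> x = 0" if "R < \<bar>x\<bar>" for x
  proof (cases "x < 0")
    case True
    then show ?thesis using that by (intro \<phi>0) auto
  next
    case False
    then have x: "R < x" using that by auto
    have "(\<theta> has_integral 0) {R..x}"
    proof (rule has_integral_spike_finite[OF _ _ has_integral_0])
      show "finite {R}" by simp
      show "\<theta> y = 0" if "y \<in> {R..x} - {R}" for y
        by (rule supp) (use that \<open>0 \<le> R\<close> in auto)
    qed
    then have "integral {R..x} \<theta> = 0" by (rule integral_unique)
    moreover have "integral {-R-1..-R} \<theta> = 0" using \<phi>0[of "-R"] by (simp add: \<phi>_def)
    moreover have "integral {-R-1..-R} \<theta> + integral {-R..x} \<theta> = \<phi> x"
      unfolding \<phi>_def by (rule Henstock_Kurzweil_Integration.integral_combine[OF _ _ int]) (use x \<open>0 \<le> R\<close> in auto)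
    moreover have "integral {-R..R} \<theta> + integral {R..x} \<theta> = integral {-R..x} \<theta>"
      by (rule Henstock_Kurzweil_Integration.integral_combine[OF _ _ int]) (use x \<open>0 \<le> R\<close> in auto)
    ultimately show ?thesis using zero by simp
  qed
  moreover have "smooth_upto n \<phi>" for n
    using smooth_upto_Suc_imp[OF smooth_upto_SucI[OF deriv \<theta>]] .
  ultimately show "test_function \<phi>"
    unfolding test_function_iff by blast
qed

text \<open>
  A combination of two bumps with vanishing integral is the derivative of a test function. As the bumps
  tend to indicator functions, this shows that \<open>w\<close> has the same mean over all intervals.
\<close>

lemma du_Bois_Reymond:
  assumes w: "\<And>a b. w absolutely_integrable_on {a..b}"
    and zero: "\<And>\<phi>. test_function \<phi> \<Longrightarrow> (LINT x|lebesgue. w x * deriv \<phi> x) = 0"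
  obtains c where "AE x in lebesgue. w x = c"
proof -
  have one: "(\<lambda>x. 1::real) absolutely_integrable_on {a..b}" for a b :: real
    by (intro absolutely_integrable_continuous_real continuous_intros)
  \<comment> \<open>Equality of the two means, multiplied out so that intervals of length 0 are
    covered. Comparison with \<open>{0..1}\<close> later identifies the constant.\<close>
  have ratio: "integral {a..b} w * (d - c) = integral {c..d} w * (b - a)" if ab: "a \<le> b" and cd: "c \<le> d" for a b c d
  proof -
    have eq: "(LINT x|lebesgue. w x * bump a b n x) * (LINT x|lebesgue. 1 * bump c d n x) =
        (LINT x|lebesgue. w x * bump c d n x) * (LINT x|lebesgue. 1 * bump a b n x)" for n
    proof -
      let ?I = "LINT x|lebesgue. 1 * bump a b n x" and ?J = "LINT x|lebesgue. 1 * bump c d n x"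
      define \<theta> where "\<theta> x = bump a b n x * ?J + bump c d n x * - ?I" for x
      define R where "R = \<bar>a\<bar> + \<bar>b\<bar> + \<bar>c\<bar> + \<bar>d\<bar>"
      have supp: "\<theta> x = 0" if "R < \<bar>x\<bar>" for x
        using that unfolding \<theta>_def R_def by (subst (1 2) bump_eq_0) auto
      have sm: "smooth_upto k \<theta>" for k
        using test_function_bump unfolding \<theta>_def test_function_iff
        by (intro smooth_upto_add smooth_upto_mult smooth_upto_const) auto
      have int: "integrable lebesgue (\<lambda>x. 1 * bump a b n x)" "integrable lebesgue (\<lambda>x. 1 * bump c d n x)"
        by (intro bump_integral_tendsto(2) one)+
      have "(\<theta> has_integral 0) UNIV"
      proof -
        have "((\<lambda>x. 1 * bump a b n x * ?J + 1 * bump c d n x * - ?I) has_integral ?I * ?J + ?J * - ?I) UNIV"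
          by (intro has_integral_add has_integral_mult_left has_integral_integral_lebesgue int)
        then show ?thesis by (simp add: \<theta>_def[abs_def])
      qed
      also have "\<theta> = (\<lambda>x. if x \<in> {-R..R} then \<theta> x else 0)"
      proof
        show "\<theta> x = (if x \<in> {-R..R} then \<theta> x else 0)" for x
          using supp[of x] by (cases "R < \<bar>x\<bar>") auto
      qed
      finally have "(\<theta> has_integral 0) {-R..R}" by (simp only: has_integral_restrict_UNIV)
      then have "integral {-R..R} \<theta> = 0" by (rule integral_unique)
      then obtain \<phi> where \<phi>: "test_function \<phi>" "deriv \<phi> = \<theta>"
        using test_function_primitive[OF sm supp] by (metis R_def abs_ge_zero add_nonneg_nonneg)
      have "(LINT x|lebesgue. w x * \<theta> x) = 0" using zero[OF \<phi>(1)] by (simp add: \<phi>(2))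
      moreover have "(LINT x|lebesgue. w x * \<theta> x) =
          (LINT x|lebesgue. w x * bump a b n x * ?J + w x * bump c d n x * - ?I)"
        by (intro Bochner_Integration.integral_cong) (auto simp: \<theta>_def algebra_simps)
      moreover have "\<dots> = (LINT x|lebesgue. w x * bump a b n x) * ?J + (LINT x|lebesgue. w x * bump c d n x) * - ?I"
        by (subst Bochner_Integration.integral_add)
           (auto intro!: integrable_mult_left bump_integral_tendsto(2) w)
      ultimately show ?thesis by simp
    qed
    have c1: "integral {a..b} (\<lambda>x. 1::real) = b - a" if "a \<le> b" for a b using that by simp
    have "(\<lambda>n. (LINT x|lebesgue. w x * bump a b n x) * (LINT x|lebesgue. 1 * bump c d n x))
        \<longlonglongrightarrow> integral {a..b} w * integral {c..d} (\<lambda>x. 1)"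
      by (intro tendsto_mult bump_integral_tendsto w one)
    moreover have "(\<lambda>n. (LINT x|lebesgue. w x * bump c d n x) * (LINT x|lebesgue. 1 * bump a b n x))
        \<longlonglongrightarrow> integral {c..d} w * integral {a..b} (\<lambda>x. 1)"
      by (intro tendsto_mult bump_integral_tendsto w one)
    ultimately show ?thesis
      unfolding eq c1[OF ab] c1[OF cd] by (rule LIMSEQ_unique)
  qed
  define c where "c = integral {0..1} w"
  have int: "w integrable_on {a..b}" for a b
    using w set_lebesgue_integral_eq_integral(1) by blast
  have "AE x in lebesgue. w x - c = 0"
  proof (rule AE_zero_if_intervals_zero)
    show "(\<lambda>x. w x - c) absolutely_integrable_on {a..b}" for a b
      by (intro set_integral_diff w absolutely_integrable_continuous_real continuous_intros)
    show "integral {a..b} (\<lambda>x. w x - c) = 0" if "a \<le> b" for a b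
      using ratio[OF that, of 0 1] that
      by (subst Henstock_Kurzweil_Integration.integral_diff) (auto simp: int c_def mult.commute)
  qed
  then show ?thesis using that[of c] by simp
qed

lemma test_function_smooth:
  assumes "test_function \<phi>"
  shows "(\<phi> has_real_derivative deriv \<phi> x) (at x)"
    and "continuous_on UNIV (deriv \<phi>)" and "continuous_on UNIV \<phi>"
proof -
  have sm: "smooth_upto n \<phi>" for n using assms by (simp add: test_function_iff)
  show D: "(\<phi> has_real_derivative deriv \<phi> x) (at x)" for x
    using smooth_upto_0D[OF sm] .
  then show "continuous_on UNIV \<phi>"
    using DERIV_isCont continuous_at_imp_continuous_on by blast
  have "deriv \<phi> differentiable at x" for x using sm[of "Suc 0"] by simp
  then show "continuous_on UNIV (deriv \<phi>)"
    by (intro continuous_at_imp_continuous_on) (auto intro: differentiable_imp_continuous_within)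
qed

lemma test_function_support:
  assumes "test_function \<phi>"
  shows "\<exists>K\<ge>0. \<forall>x. K \<le> \<bar>x\<bar> \<longrightarrow> \<phi> x = 0 \<and> deriv \<phi> x = 0"
proof -
  obtain R where R: "\<And>x. R < \<bar>x\<bar> \<Longrightarrow> \<phi> x = 0"
    using assms unfolding test_function_def by blast
  have "deriv \<phi> x = 0" if "R < \<bar>x\<bar>" for x
  proof -
    have "((\<lambda>x. 0) has_real_derivative 0) (at x)" by simp
    then have "(\<phi> has_real_derivative 0) (at x)"
      by (rule has_field_derivative_transform_within_open[of _ _ _ "{x. R < \<bar>x\<bar>}"])
         (use that R in \<open>auto intro!: open_Collect_less continuous_intros\<close>)
    then show ?thesis by (rule DERIV_imp_deriv)
  qed
  \<comment> \<open>The extra 1 turns the strict bound into a nonstrict one, so that the boundary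
    terms at \<open>-K\<close> and \<open>K\<close> vanish in the integration by parts.\<close>
  with R show ?thesis by (intro exI[of _ "\<bar>R\<bar> + 1"]) auto
qed

lemma integrable_mult_compact_support:
  assumes w: "\<And>a b. w absolutely_integrable_on {a..b}"
    and f: "continuous_on UNIV (f :: real \<Rightarrow> real)" "\<And>x. K \<le> \<bar>x\<bar> \<Longrightarrow> f x = 0"
  shows "integrable lebesgue (\<lambda>x. w x * f x)"
    and "(LINT x|lebesgue. w x * f x) = integral {-K..K} (\<lambda>x. w x * f x)"
proof -
  obtain W where W: "AC_primitive W w" using AC_primitive_exists[OF w] .
  have abs: "(\<lambda>x. w x * f x) absolutely_integrable_on {-K..K}"
    using AC_primitive_mult_integrable[OF W f(1)] by (simp add: mult.commute)
  have eq: "indicator {-K..K} x *\<^sub>R (w x * f x) = w x * f x" for x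
    using f(2)[of x] by (cases "K \<le> \<bar>x\<bar>") (auto simp: indicator_def not_le abs_less_iff)
  show "integrable lebesgue (\<lambda>x. w x * f x)"
    using abs unfolding set_integrable_def eq .
  show "(LINT x|lebesgue. w x * f x) = integral {-K..K} (\<lambda>x. w x * f x)"
    using set_lebesgue_integral_eq_integral(2)[OF abs] unfolding set_lebesgue_integral_def eq .
qed

lemma AC_primitive_weak_derivative:
  assumes AC: "AC_primitive U v"
  shows "weak_derivative U v"
  unfolding weak_derivative_def locally_integrable_def
proof (intro conjI allI impI)
  show U: "U absolutely_integrable_on {a..b}" for a b
    by (intro absolutely_integrable_continuous_real continuous_on_subset[OF AC_primitive_continuous[OF AC]]) auto
  show v: "v absolutely_integrable_on {a..b}" for a b
    by (rule AC_primitive_abs_integrable[OF AC])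
  fix \<phi> assume \<phi>: "test_function \<phi>"
  obtain K where K: "K \<ge> 0" "\<And>x. K \<le> \<bar>x\<bar> \<Longrightarrow> \<phi> x = 0" "\<And>x. K \<le> \<bar>x\<bar> \<Longrightarrow> deriv \<phi> x = 0"
    using test_function_support[OF \<phi>] by blast
  note smooth = test_function_smooth[OF \<phi>]
  have i1: "(\<lambda>x. U x * deriv \<phi> x) integrable_on {-K..K}"
    using AC_primitive_exists[OF U] AC_primitive_mult_integrable[OF _ smooth(2)] set_lebesgue_integral_eq_integral(1)
    by (metis (no_types, lifting) integrable_eq mult.commute)
  have i2: "(\<lambda>x. \<phi> x * v x) integrable_on {-K..K}"
    using AC_primitive_mult_integrable[OF AC smooth(3)] set_lebesgue_integral_eq_integral(1) by blast
  have "integral {-K..K} (\<lambda>x. U x * deriv \<phi> x + \<phi> x * v x) = U K * \<phi> K - U (-K) * \<phi> (-K)"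
    by (rule AC_primitive_parts[OF AC smooth(1,2), symmetric]) (use K in simp)
  also have "\<dots> = 0" using K(1) K(2)[of K] K(2)[of "-K"] by simp
  finally have "integral {-K..K} (\<lambda>x. U x * deriv \<phi> x) = - integral {-K..K} (\<lambda>x. v x * \<phi> x)"
    using i1 i2 by (simp add: Henstock_Kurzweil_Integration.integral_add mult.commute)
  then show "(LINT x|lebesgue. U x * deriv \<phi> x) = - (LINT x|lebesgue. v x * \<phi> x)"
    using integrable_mult_compact_support(2)[OF U smooth(2) K(3)]
      integrable_mult_compact_support(2)[OF v smooth(3) K(2)] by simp
qed

text \<open>\<open>u\<close> and any primitive \<open>V\<close> of \<open>v\<close> have the same
  weak derivative. By \<open>du_Bois_Reymond\<close> their difference is constant almost everywhere,
  and adding the constant to \<open>V\<close> gives the continuous representative of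
  \<open>u\<close>.\<close>

lemma weak_derivative_AC_primitive:
  assumes "weak_derivative u v"
  obtains U where "AC_primitive U v" "AE x in lebesgue. u x = U x"
proof -
  have u: "u absolutely_integrable_on {a..b}" and v: "v absolutely_integrable_on {a..b}" for a b
    using assms by (auto simp: weak_derivative_def locally_integrable_def)
  obtain V where V: "AC_primitive V v" using AC_primitive_exists[OF v] .
  have V_weak: "weak_derivative V v" by (rule AC_primitive_weak_derivative[OF V])
  then have V_int: "V absolutely_integrable_on {a..b}" for a b
    by (auto simp: weak_derivative_def locally_integrable_def)
  have uV: "(\<lambda>x. u x - V x) absolutely_integrable_on {a..b}" for a b
    by (intro set_integral_diff u V_int)
  obtain c where c: "AE x in lebesgue. u x - V x = c"
  proof (rule du_Bois_Reymond[OF uV])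
    fix \<phi> assume \<phi>: "test_function \<phi>"
    obtain K where K: "\<And>x. K \<le> \<bar>x\<bar> \<Longrightarrow> deriv \<phi> x = 0"
      using test_function_support[OF \<phi>] by blast
    note int = integrable_mult_compact_support(1)[OF _ test_function_smooth(2)[OF \<phi>] K]
    have "(LINT x|lebesgue. (u x - V x) * deriv \<phi> x)
        = (LINT x|lebesgue. u x * deriv \<phi> x) - (LINT x|lebesgue. V x * deriv \<phi> x)"
      by (simp add: left_diff_distrib Bochner_Integration.integral_diff[OF int[OF u] int[OF V_int]])
    then show "(LINT x|lebesgue. (u x - V x) * deriv \<phi> x) = 0"
      using assms V_weak \<phi> by (simp add: weak_derivative_def)
  qed
  show ?thesis
  proof (rule that[of "\<lambda>x. V x + c"])
    show "AC_primitive (\<lambda>x. V x + c) v" using V by (simp add: AC_primitive_def)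
    show "AE x in lebesgue. u x = V x + c" using c by eventually_elim simp
  qed
qed

section \<open>Hoelder bound for the weighted variation\<close>

text \<open>Integrability of the product is part of the claim: without it the bound would be empty,
  as the Bochner integral of a non-integrable function is 0.\<close>

lemma Holder_integral:
  fixes f g :: "'a \<Rightarrow> real"
  assumes pq: "p > 1" "q > 1" "1 / p + 1 / q = 1"
    and nonneg: "\<And>x. 0 \<le> f x" "\<And>x. 0 \<le> g x"
    and meas [measurable]: "f \<in> borel_measurable M" "g \<in> borel_measurable M"
    and int: "integrable M (\<lambda>x. f x powr p)" "integrable M (\<lambda>x. g x powr q)"
  shows "integrable M (\<lambda>x. f x * g x)"
    and "(LINT x|M. f x * g x) \<le> (LINT x|M. f x powr p) powr (1 / p) * (LINT x|M. g x powr q) powr (1 / q)"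
proof -
  have young: "f x * g x \<le> f x powr p / p + g x powr q / q" for x
    using Youngs_inequality[OF pq nonneg] .
  show int_fg: "integrable M (\<lambda>x. f x * g x)"
  proof (rule Bochner_Integration.integrable_bound)
    show "integrable M (\<lambda>x. f x powr p / p + g x powr q / q)" using int by simp
    show "AE x in M. norm (f x * g x) \<le> norm (f x powr p / p + g x powr q / q)"
      using young nonneg by (intro AE_I2) (smt (verit) mult_nonneg_nonneg real_norm_def)
  qed measurable
  define P where "P = (LINT x|M. f x powr p)"
  define Q where "Q = (LINT x|M. g x powr q)"
  have PQ: "0 \<le> P" "0 \<le> Q" by (auto simp: P_def Q_def)
  show "(LINT x|M. f x * g x) \<le> (LINT x|M. f x powr p) powr (1 / p) * (LINT x|M. g x powr q) powr (1 / q)"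
  proof (cases "P = 0 \<or> Q = 0")
    \<comment> \<open>The factors cannot be normalised here, but one of them vanishes almost
      everywhere.\<close>
    case True
    then have "AE x in M. f x * g x = 0"
    proof
      assume "P = 0"
      then have "AE x in M. f x powr p = 0"
        unfolding P_def using int(1) by (subst (asm) integral_nonneg_eq_0_iff_AE) auto
      then show ?thesis by eventually_elim simp
    next
      assume "Q = 0"
      then have "AE x in M. g x powr q = 0"
        unfolding Q_def using int(2) by (subst (asm) integral_nonneg_eq_0_iff_AE) auto
      then show ?thesis by eventually_elim simp
    qed
    then have "(LINT x|M. f x * g x) = 0"
      by (intro integral_eq_zero_AE)
    then show ?thesis by simp
  next
    case False
    with PQ have pos: "P > 0" "Q > 0" by auto
    define a where "a = P powr (1 / p)"
    define b where "b = Q powr (1 / q)"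
    have ab: "a > 0" "b > 0" "a powr p = P" "b powr q = Q"
      using pos pq by (auto simp: a_def b_def powr_powr)
    have "(LINT x|M. f x * g x) / (a * b) = (LINT x|M. (f x / a) * (g x / b))" by simp
    also have "\<dots> \<le> (LINT x|M. (f x powr p / P) / p + (g x powr q / Q) / q)"
    proof (rule integral_mono)
      show "integrable M (\<lambda>x. (f x / a) * (g x / b))" using int_fg by simp
      show "integrable M (\<lambda>x. (f x powr p / P) / p + (g x powr q / Q) / q)" using int by simp
      show "(f x / a) * (g x / b) \<le> (f x powr p / P) / p + (g x powr q / Q) / q" for x
        using Youngs_inequality[OF pq, of "f x / a" "g x / b"] nonneg ab by (simp add: powr_divide)
    qed
    also have "\<dots> = 1 / p + 1 / q"
      using int pos unfolding P_def Q_def by (subst Bochner_Integration.integral_add) auto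
    finally have "(LINT x|M. f x * g x) \<le> a * b" using ab pq(3) by (simp add: divide_simps)
    then show ?thesis by (simp add: a_def b_def P_def Q_def)
  qed
qed

text \<open>A substitute for decay at infinity: if \<open>f\<close> were at least
  \<open>\<epsilon>\<close> on an interval longer than its integral divided by
  \<open>\<epsilon>\<close>, the integral would be too large.\<close>

lemma integrable_small_value:
  fixes f :: "real \<Rightarrow> real"
  assumes f: "integrable lebesgue f" and nonneg: "\<And>x. 0 \<le> f x" and "0 < (\<epsilon>::real)"
  shows "\<exists>y\<ge>x. f y < \<epsilon>" "\<exists>y\<le>x. f y < \<epsilon>"
proof -
  have *: "\<exists>y\<in>{a..a + real n}. f y < \<epsilon>" if n: "(LINT x|lebesgue. f x) / \<epsilon> < real n" for n :: nat and a
  proof (rule ccontr)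
    assume "\<not> ?thesis"
    then have ge: "\<epsilon> \<le> f y" if "y \<in> {a..a + real n}" for y using that by (auto simp: not_less)
    have "\<epsilon> * real n = (LINT y|lebesgue. \<epsilon> * indicator {a..a + real n} y)"
      by (simp add: measure_def)
    also have "\<dots> \<le> (LINT y|lebesgue. f y)"
    proof (rule integral_mono[OF _ f])
      show "integrable lebesgue (\<lambda>y. \<epsilon> * indicator {a..a + real n} y)"
        by (intro integrable_mult_right integrable_real_indicator) (auto simp: emeasure_lborel_Icc_eq)
      show "\<epsilon> * indicator {a..a + real n} y \<le> f y" for y
        using ge[of y] nonneg[of y] by (auto simp: indicator_def)
    qed
    finally show False using n \<open>0 < \<epsilon>\<close> by (simp add: divide_simps mult.commute split: if_splits)
  qed
  obtain n where n: "(LINT x|lebesgue. f x) / \<epsilon> < real n" using reals_Archimedean2 by blast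
  show "\<exists>y\<ge>x. f y < \<epsilon>" using *[OF n, of x] by auto
  show "\<exists>y\<le>x. f y < \<epsilon>" using *[OF n, of "x - real n"] by auto
qed

text \<open>The ends of the two paths from \<open>x\<close> are points
  \<open>z \<le> x \<le> y\<close> at which \<open>G \<bar>U\<bar>\<close> is below
  \<open>e\<close>. The bounds over the adjacent intervals \<open>{z..x}\<close> and
  \<open>{x..y}\<close> add up to at most one integral over the line, whence the factor 2.\<close>

lemma AC_primitive_two_sided_bound:
  assumes AC: "AC_primitive U v"
    and G: "\<And>y. 0 \<le> y \<Longrightarrow> (G has_real_derivative g y) (at y within {0..})" "G 0 = 0"
    and g: "continuous_on {0..} g" "\<And>y. 0 \<le> y \<Longrightarrow> 0 \<le> g y"
    and U: "integrable lebesgue (\<lambda>x. \<bar>U x\<bar> powr s)" "s > 0"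
    and int: "integrable lebesgue (\<lambda>x. g (\<bar>U x\<bar>) * \<bar>v x\<bar>)"
  shows "2 * G (\<bar>U x\<bar>) \<le> (LINT x|lebesgue. g (\<bar>U x\<bar>) * \<bar>v x\<bar>)"
proof -
  let ?h = "\<lambda>x. g (\<bar>U x\<bar>) * \<bar>v x\<bar>"
  have "2 * G (\<bar>U x\<bar>) \<le> (LINT x|lebesgue. ?h x) + 2 * e" if "e > 0" for e
  proof -
    have "continuous (at 0 within {0..}) G"
      using G(1)[of 0] DERIV_continuous by blast
    then obtain d where d: "d > 0" "\<And>y. 0 \<le> y \<Longrightarrow> y < d \<Longrightarrow> \<bar>G y\<bar> < e"
      unfolding continuous_within_eps_delta dist_real_def using \<open>e > 0\<close> G(2) by (force simp: Ball_def)
    define W where "W t = G (\<bar>U t\<bar>)" for t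
    have small: "W y < e" if "\<bar>U y\<bar> powr s < d powr s" for y
    proof -
      have "\<bar>U y\<bar> < d"
        using that powr_mono2[of s d "\<bar>U y\<bar>"] U(2) d(1) by (cases "\<bar>U y\<bar> < d") auto
      then show ?thesis using d(2)[of "\<bar>U y\<bar>"] by (simp add: W_def)
    qed
    have "d powr s > 0" using d(1) by simp
    obtain y where y: "y \<ge> x" "W y < e"
      using integrable_small_value(1)[OF U(1) powr_ge_zero \<open>d powr s > 0\<close>] small by blast
    obtain z where z: "z \<le> x" "W z < e"
      using integrable_small_value(2)[OF U(1) powr_ge_zero \<open>d powr s > 0\<close>] small by blast
    have set_int: "?h absolutely_integrable_on {z..y}"
      using integrable_mult_indicator[OF _ int, of "{z..y}"] by (simp add: set_integrable_def)
    have "W y - W x \<ge> - integral {x..y} ?h" "W x - W z \<le> integral {z..x} ?h"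
      using AC_primitive_chain_bound[OF AC G(1) g z(1)] AC_primitive_chain_bound[OF AC G(1) g y(1)]
      by (simp_all add: W_def abs_le_iff)
    then have "2 * W x \<le> 2 * e + (integral {z..x} ?h + integral {x..y} ?h)"
      using y z by argo
    also have "integral {z..x} ?h + integral {x..y} ?h = integral {z..y} ?h"
      using set_lebesgue_integral_eq_integral(1)[OF set_int] y z
      by (intro Henstock_Kurzweil_Integration.integral_combine)
    also have "\<dots> = (LINT t:{z..y}|lebesgue. ?h t)"
      by (rule set_lebesgue_integral_eq_integral(2)[OF set_int, symmetric])
    also have "\<dots> \<le> (LINT t|lebesgue. ?h t)"
      unfolding set_lebesgue_integral_def
    proof (rule integral_mono[OF _ int])
      show "integrable lebesgue (\<lambda>t. indicator {z..y} t *\<^sub>R ?h t)"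
        using set_int by (simp add: set_integrable_def)
      show "indicator {z..y} t *\<^sub>R ?h t \<le> ?h t" for t
        using g(2)[of "\<bar>U t\<bar>"] by (auto simp: indicator_def)
    qed
    finally show ?thesis by (simp add: W_def)
  qed
  note bound = this
  show ?thesis
  proof (rule field_le_epsilon)
    fix e :: real assume "0 < e"
    then show "2 * G (\<bar>U x\<bar>) \<le> (LINT x|lebesgue. ?h x) + e" using bound[of "e / 2"] by simp
  qed
qed

lemma primitive_on_nonneg:
  assumes "continuous_on {0..} (g :: real \<Rightarrow> real)" "0 \<le> y"
  shows "((\<lambda>y. integral {0..y} g) has_real_derivative g y) (at y within {0..})"
proof -
  have "((\<lambda>y. integral {0..y} g) has_real_derivative g y) (at y within {0..y+1})"
    by (rule integral_has_real_derivative) (use assms in \<open>auto intro: continuous_on_subset\<close>)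
  moreover have "at y within {0..y+1} = at y within {0..}"
    by (rule at_within_nhd[of y "{..<y+1}"]) auto
  ultimately show ?thesis by simp
qed

lemma Lp_cong_AE:
  assumes "AE x in lebesgue. u x = U x" "U \<in> borel_measurable lebesgue"
  shows "Lp s u \<longleftrightarrow> Lp s U" "Lp_norm s u = Lp_norm s U"
proof -
  have sym: "AE x in lebesgue. U x = u x" using assms(1) by eventually_elim simp
  have u: "u \<in> borel_measurable lebesgue"
    using assms(2) sym by (rule borel_measurable_AE)
  have ae: "AE x in lebesgue. \<bar>u x\<bar> powr s = \<bar>U x\<bar> powr s"
    using assms(1) by eventually_elim simp
  have meas: "(\<lambda>x. \<bar>f x\<bar> powr s) \<in> borel_measurable lebesgue" if "f \<in> borel_measurable lebesgue" for f :: "real \<Rightarrow> real"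
    using that by measurable
  show "Lp s u \<longleftrightarrow> Lp s U"
    using integrable_cong_AE[OF meas[OF u] meas[OF assms(2)] ae] u assms(2) by (simp add: Lp_def)
  show "Lp_norm s u = Lp_norm s U"
    using integral_cong_AE[OF meas[OF u] meas[OF assms(2)] ae] by (simp add: Lp_norm_def)
qed

lemma Lp_norm_mult: "s > 0 \<Longrightarrow> Lp_norm s (\<lambda>x. c * f x) = \<bar>c\<bar> * Lp_norm s f"
  by (simp add: Lp_norm_def abs_mult powr_mult powr_powr)

lemma Lp_mult: "Lp s f \<Longrightarrow> Lp s (\<lambda>x. c * f x)"
  by (auto simp: Lp_def abs_mult powr_mult)

lemma AC_primitive_mult:
  assumes "AC_primitive U v" shows "AC_primitive (\<lambda>x. c * U x) (\<lambda>x. c * v x)"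
proof -
  have "(\<lambda>x. c * v x) absolutely_integrable_on {a..b}" for a b
    using AC_primitive_abs_integrable[OF assms] by (intro set_integrable_mult_right) auto
  moreover have "c * U b - c * U a = integral {a..b} (\<lambda>x. c * v x)" if "a \<le> b" for a b
    using AC_primitive_diff[OF assms that] by (simp flip: right_diff_distrib)
  ultimately show ?thesis by (simp add: AC_primitive_def)
qed

section \<open>Parameters, the weight \<open>G\<close>, and the base \<open>X\<close> of the closed
  formula for the constant\<close>

locale GN_params =
  fixes p q m :: real
  assumes p: "p > 1" and pq: "p - 1 \<le> q" and qm: "q < m"
begin

lemma params_pos: "0 < q" "0 < m" "0 < p" "0 < p - 1" "0 < m - q" "0 < q + 1" "0 < m + 1"
  using p pq qm by auto

definition "\<eta>1 = (p - 1) * (m + 1) + p"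
definition "\<eta>2 = (p - 1) * (q + 1) + p"

lemma eta_pos: "0 < \<eta>1" "0 < \<eta>2"
  using params_pos by (auto simp: \<eta>1_def \<eta>2_def intro!: add_pos_pos)

text \<open>Conservation of energy for the ground state \<open>u\<close> reads \<open>\<bar>u'\<bar>\<^sup>p = H u\<close>, and \<open>A\<close> is its maximum.\<close>

definition H :: "real \<Rightarrow> real" where
  "H s = p / (p - 1) * (s powr (q + 1) / (q + 1) - s powr (m + 1) / (m + 1))"

definition A :: real where
  "A = ((m + 1) / (q + 1)) powr (1 / (m - q))"

text \<open>\<open>H\<close> is negative beyond \<open>A\<close>; cutting it off at 0 keeps
  \<open>g\<close> continuous and nonnegative on the whole half-line, as
  \<open>AC_primitive_chain_bound\<close> requires.\<close>

definition g :: "real \<Rightarrow> real" where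
  "g s = max 0 (H s) powr ((p - 1) / p)"

definition G :: "real \<Rightarrow> real" where
  "G y = integral {0..y} g"

lemma A_pos: "A > 0"
  using params_pos by (simp add: A_def)

lemma A_powr: "A powr (m - q) = (m + 1) / (q + 1)"
  using params_pos by (simp add: A_def powr_powr)

text \<open>The last factor carries the sign of \<open>H\<close> and is the variable
  \<open>x\<close> in which the equation separates.\<close>

lemma H_eq:
  assumes "0 \<le> s"
  shows "H s = p / ((p - 1) * (q + 1)) * s powr (q + 1) * (1 - (s / A) powr (m - q))"
proof -
  have "s powr (m + 1) = s powr (q + 1) * s powr (m - q)"
    by (simp add: algebra_simps flip: powr_add)
  moreover have "(s / A) powr (m - q) = s powr (m - q) * (q + 1) / (m + 1)"
    using assms A_pos by (simp add: powr_divide A_powr)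
  ultimately show ?thesis
    using params_pos unfolding H_def by (simp add: divide_simps) (simp add: algebra_simps)
qed

lemma powr_ratio_le_1: "0 \<le> s \<Longrightarrow> s \<le> A \<Longrightarrow> (s / A) powr (m - q) \<le> 1"
  using params_pos A_pos powr_mono2[of "m - q" "s / A" 1] by auto

lemma powr_ratio_less_1: "0 \<le> s \<Longrightarrow> s < A \<Longrightarrow> (s / A) powr (m - q) < 1"
  using params_pos A_pos powr_less_mono2[of "m - q" "s / A" 1] by auto

lemma H_nonneg: "0 \<le> s \<Longrightarrow> s \<le> A \<Longrightarrow> 0 \<le> H s"
  using params_pos powr_ratio_le_1 by (simp add: H_eq)

lemma H_pos: "0 < s \<Longrightarrow> s < A \<Longrightarrow> 0 < H s"
  using params_pos powr_ratio_less_1[of s] by (simp add: H_eq)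

lemma H_neg: assumes "A < s" shows "H s < 0"
proof -
  have "1 < (s / A) powr (m - q)"
    using params_pos A_pos assms powr_less_mono2[of "m - q" 1 "s / A"] by auto
  moreover have "0 < p / ((p - 1) * (q + 1)) * s powr (q + 1)"
    using params_pos A_pos assms by simp
  moreover have "0 \<le> s" using A_pos assms by simp
  ultimately show ?thesis
    by (simp only: H_eq) (intro mult_pos_neg; simp)
qed

lemma H_A: "H A = 0"
  using A_pos by (simp add: H_eq)

lemma H_0: "H 0 = 0"
  by (simp add: H_def)

lemma continuous_on_H: "continuous_on {0..} H"
proof -
  have "continuous_on {0..} (\<lambda>s::real. s powr a)" if "a > 0" for a
    by (rule continuous_on_powr') (use that in \<open>auto intro!: continuous_intros\<close>)
  then show ?thesis
    unfolding H_def[abs_def] using params_pos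
    by (intro continuous_on_mult continuous_on_diff continuous_on_divide continuous_on_const) auto
qed

lemma continuous_on_g: "continuous_on {0..} g"
proof -
  have "(p - 1) / p > 0" using p by simp
  then show ?thesis
    unfolding g_def[abs_def]
    by (intro continuous_on_powr' continuous_on_max continuous_on_const continuous_on_H ballI conjI impI) auto
qed

lemma g_nonneg: "0 \<le> g s"
  by (simp add: g_def)

lemma G_deriv: "0 \<le> y \<Longrightarrow> (G has_real_derivative g y) (at y within {0..})"
  unfolding G_def[abs_def] using primitive_on_nonneg[OF continuous_on_g] .

lemma continuous_on_G: "continuous_on {0..} G"
  using DERIV_continuous[OF G_deriv] unfolding continuous_on_eq_continuous_within by auto

lemma G_0: "G 0 = 0"
  by (simp add: G_def)

text \<open>The substitution \<open>y = (s / A) powr (m - q)\<close> turns the integral of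
  \<open>g\<close> over \<open>{0..A}\<close> into a Beta integral. The power
  \<open>\<eta>2 / p\<close> of \<open>A\<close> is \<open>(q + 1) * (p - 1) / p\<close> from the
  weight plus 1 from the differential.\<close>

lemma G_A: "G A = (p / ((p - 1) * (q + 1))) powr ((p - 1) / p) * A powr (\<eta>2 / p) / (m - q)
    * Beta (\<eta>2 / (p * (m - q))) ((2 * p - 1) / p)"
proof -
  define a where "a = \<eta>2 / (p * (m - q))"
  define b where "b = (2 * p - 1) / p"
  define c where "c = (p / ((p - 1) * (q + 1))) powr ((p - 1) / p) * A powr (\<eta>2 / p) / (m - q)"
  have ab: "a > 0" "b > 0" using params_pos eta_pos by (auto simp: a_def b_def)
  define s where "s y = A * y powr (1 / (m - q))" for y
  have s_range: "0 \<le> s y" for y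
    using A_pos by (simp add: s_def)
  have "((\<lambda>y. c * (y powr (a - 1) * (1 - y) powr (b - 1))) has_integral G (s 1) - G (s 0)) {0..1}"
  \<comment> \<open>For \<open>m - q > 1\<close> the substitution \<open>s\<close> is not
    differentiable at 0, so derivatives are taken in the open interval only.\<close>
  proof (rule fundamental_theorem_of_calculus_interior)
    show "continuous_on {0..1} (\<lambda>y. G (s y))"
      by (rule continuous_on_compose2[OF continuous_on_G])
         (use params_pos s_range in \<open>auto simp: s_def intro!: continuous_intros continuous_on_powr'\<close>)
  next
    fix y :: real assume y: "y \<in> {0<..<1}"
    have "(s has_real_derivative A * (1 / (m - q) * y powr (1 / (m - q) - 1))) (at y)"
      unfolding s_def[abs_def] using y by (intro DERIV_cmult has_real_derivative_powr) auto
    moreover have "(G has_real_derivative g (s y)) (at (s y))"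
      using G_deriv[OF s_range, of y] y A_pos at_within_interior[of "s y" "{0..}"] by (simp add: s_def)
    ultimately have "((\<lambda>y. G (s y)) has_real_derivative g (s y) * (A * (1 / (m - q) * y powr (1 / (m - q) - 1)))) (at y)"
      using DERIV_chain2 by blast
    also have "g (s y) * (A * (1 / (m - q) * y powr (1 / (m - q) - 1))) = c * (y powr (a - 1) * (1 - y) powr (b - 1))"
    proof -
      have "(s y / A) powr (m - q) = y"
        using y A_pos params_pos by (simp add: s_def powr_powr)
      then have "H (s y) = p / ((p - 1) * (q + 1)) * (s y) powr (q + 1) * (1 - y)"
        by (simp add: H_eq s_range)
      moreover from this have "0 \<le> H (s y)" using y params_pos by simp
      moreover define c0 where "c0 = p / ((p - 1) * (q + 1))"
      moreover have "0 < c0" using params_pos by (simp add: c0_def)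
      ultimately have "g (s y) = c0 powr ((p - 1) / p)
          * (s y powr (q + 1)) powr ((p - 1) / p) * (1 - y) powr ((p - 1) / p)"
        using y by (simp add: g_def powr_mult del: times_divide_eq_left)
      then have "g (s y) = (p / ((p - 1) * (q + 1))) powr ((p - 1) / p)
          * (s y powr (q + 1)) powr ((p - 1) / p) * (1 - y) powr ((p - 1) / p)"
        by (simp add: c0_def)
      also have "(s y powr (q + 1)) powr ((p - 1) / p)
          = A powr ((q + 1) * (p - 1) / p) * y powr ((q + 1) * (p - 1) / (p * (m - q)))"
        using y A_pos by (simp add: s_def powr_mult powr_powr mult_ac)
      finally have "g (s y) * (A * (1 / (m - q) * y powr (1 / (m - q) - 1))) =
          (p / ((p - 1) * (q + 1))) powr ((p - 1) / p) * (A powr ((q + 1) * (p - 1) / p) * A powr 1) / (m - q)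
          * ((y powr ((q + 1) * (p - 1) / (p * (m - q))) * y powr (1 / (m - q) - 1)) * (1 - y) powr ((p - 1) / p))"
        using A_pos by (simp add: mult_ac)
      also have "A powr ((q + 1) * (p - 1) / p) * A powr 1 = A powr (\<eta>2 / p)"
        using params_pos by (subst powr_add[symmetric], intro arg_cong2[where f = "(powr)"])
          (auto simp: \<eta>2_def divide_simps algebra_simps)
      also have "y powr ((q + 1) * (p - 1) / (p * (m - q))) * y powr (1 / (m - q) - 1) = y powr (a - 1)"
      proof -
        have "a = (q + 1) * (p - 1) / (p * (m - q)) + p / (p * (m - q))"
          by (simp add: a_def \<eta>2_def add_divide_distrib mult.commute)
        also have "p / (p * (m - q)) = 1 / (m - q)" using params_pos by simp
        finally show ?thesis by (subst powr_add[symmetric]) (simp add: add_diff_eq)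
      qed
      also have "(p - 1) / p = b - 1" using params_pos by (simp add: b_def divide_simps)
      finally show ?thesis by (simp add: c_def \<open>(p - 1) / p = b - 1\<close> mult_ac)
    qed
    finally show "((\<lambda>y. G (s y)) has_vector_derivative c * (y powr (a - 1) * (1 - y) powr (b - 1))) (at y)"
      by (simp add: has_real_derivative_iff_has_vector_derivative)
  qed simp
  moreover have "((\<lambda>y. c * (y powr (a - 1) * (1 - y) powr (b - 1))) has_integral c * Beta a b) {0..1}"
    by (intro has_integral_mult_right has_integral_Beta_real ab)
  ultimately have "G (s 1) - G (s 0) = c * Beta a b" by (rule has_integral_unique)
  then show ?thesis by (simp add: s_def G_0 a_def b_def c_def)
qed

lemma Beta_pos: "Beta (\<eta>2 / (p * (m - q))) ((2 * p - 1) / p) > 0"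
  using params_pos eta_pos p unfolding Beta_def
  by (intro divide_pos_pos mult_pos_pos Gamma_real_pos add_pos_pos) auto

lemma G_A_pos: "G A > 0"
  using params_pos A_pos Beta_pos unfolding G_A by (intro divide_pos_pos mult_pos_pos) auto

definition T :: real where "T = 2 * G A"

text \<open>
  For the ground state \<open>u\<close> the integrals of \<open>\<bar>u'\<bar>\<^sup>p\<close>, \<open>u\<^sup>q\<^sup>+\<^sup>1\<close> and \<open>u\<^sup>m\<^sup>+\<^sup>1\<close> are \<open>T\<close>, \<open>Q_ratio * T\<close> and
  \<open>Q_ratio / R_ratio * T\<close>, and \<open>X\<close> is the base of the power in the formula for the best constant.
\<close>

definition Q_ratio :: real where "Q_ratio = (q + 1) * \<eta>1 / (p * (m - q))"
definition R_ratio :: real where "R_ratio = (q + 1) * \<eta>1 / ((m + 1) * \<eta>2)"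

lemma ratio_pos: "Q_ratio > 0" "R_ratio > 0"
  using params_pos eta_pos by (simp_all add: Q_ratio_def R_ratio_def)

definition X :: real where
  "X = T powr p * Q_ratio powr (p - 1) * R_ratio powr (\<eta>2 / (m - q))"

lemma T_pos: "T > 0"
  using G_A_pos by (simp add: T_def)

lemma X_pos: "X > 0"
  using ratio_pos T_pos by (simp add: X_def)

text \<open>With \<open>P\<close>, \<open>Q\<close>, \<open>R\<close> the integrals of
  \<open>\<bar>u'\<bar>^p\<close>, \<open>\<bar>u\<bar>^(q+1)\<close>,
  \<open>\<bar>u\<bar>^(m+1)\<close>, the inequality raised to the power \<open>m + 1\<close> reads
  \<open>R * X^\<beta> \<le> Q^(1+\<gamma>) * P^\<beta>\<close>.\<close>

definition \<beta> :: real where "\<beta> = (m - q) / \<eta>2"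
definition \<gamma> :: real where "\<gamma> = (p - 1) * \<beta>"

lemma beta_pos: "\<beta> > 0" "\<gamma> > 0"
  using params_pos eta_pos by (auto simp: \<beta>_def \<gamma>_def)

lemma X_powr_beta: "X powr \<beta> = T powr (p * \<beta>) * Q_ratio powr \<gamma> * R_ratio"
proof -
  have "\<eta>2 / (m - q) * \<beta> = 1" using params_pos eta_pos by (simp add: \<beta>_def)
  then have "(R_ratio powr (\<eta>2 / (m - q))) powr \<beta> = R_ratio"
    using ratio_pos by (subst powr_powr) (simp del: times_divide_eq_left)
  then show ?thesis
    unfolding X_def by (simp only: powr_mult powr_powr[of T] powr_powr[of Q_ratio] \<gamma>_def)
qed

text \<open>All quantities are positive, so it is enough to compare the logarithms of
  \<open>X\<close> and of the base \<open>Y\<close> of the stated formula; the outer exponent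
  \<open>l\<close> equals \<open>\<beta> / (m + 1)\<close>.\<close>

lemma GN_constant_closed_eq: "GN_constant_closed p q m = X powr (- (\<beta> / (m + 1)))"
proof -
  define B where "B = Beta (\<eta>2 / (p * (m - q))) ((2 * p - 1) / p)"
  have B: "B > 0"
    using Beta_pos by (simp add: B_def)
  define Y where "Y = 2 powr p * (p - 1) powr (1 - p) * \<eta>1 powr (\<eta>1 / (m - q))
            / ((m - q) powr (2 * p - 1) * \<eta>2 powr (\<eta>2 / (m - q))) * B powr p"
  have Y: "Y > 0" using B params_pos eta_pos by (simp add: Y_def)
  have T: "T = 2 * ((p / ((p - 1) * (q + 1))) powr ((p - 1) / p) * A powr (\<eta>2 / p) / (m - q) * B)"
    by (simp add: T_def G_A B_def)
  have lnA: "ln A = (ln (m + 1) - ln (q + 1)) / (m - q)"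
    using params_pos by (simp add: A_def ln_powr ln_div)
  have lnT: "ln T = ln 2 + (p - 1) / p * (ln p - ln (p - 1) - ln (q + 1))
      + \<eta>2 / p * ((ln (m + 1) - ln (q + 1)) / (m - q)) - ln (m - q) + ln B"
    unfolding T using params_pos A_pos B by (simp add: ln_mult ln_div ln_powr lnA)
  have "ln X = p * ln T + (p - 1) * (ln (q + 1) + ln \<eta>1 - (ln p + ln (m - q)))
      + \<eta>2 / (m - q) * (ln (q + 1) + ln \<eta>1 - (ln (m + 1) + ln \<eta>2))"
    unfolding X_def Q_ratio_def R_ratio_def
    using params_pos eta_pos T_pos by (simp add: ln_mult ln_div ln_powr)
  moreover have "ln Y = p * ln 2 + (1 - p) * ln (p - 1) + \<eta>1 / (m - q) * ln \<eta>1
      - ((2 * p - 1) * ln (m - q) + \<eta>2 / (m - q) * ln \<eta>2) + p * ln B"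
    unfolding Y_def using params_pos eta_pos B by (simp add: ln_mult ln_div ln_powr)
  \<comment> \<open>This relation merges the powers of \<open>\<eta>1\<close> coming from
    \<open>Q_ratio\<close> and from \<open>R_ratio\<close>.\<close>
  moreover have "\<eta>1 / (m - q) = \<eta>2 / (m - q) + (p - 1)"
    using params_pos by (simp add: \<eta>1_def \<eta>2_def divide_simps) (simp add: algebra_simps)
  moreover have "p * ln T = p * ln 2 + (p - 1) * (ln p - ln (p - 1) - ln (q + 1))
      + \<eta>2 / (m - q) * (ln (m + 1) - ln (q + 1)) - p * ln (m - q) + p * ln B"
  proof -
    have "p * (c + (p - 1) / p * a + \<eta>2 / p * (z / (m - q)) - d + e)
        = p * c + (p - 1) * a + \<eta>2 / (m - q) * z - p * d + p * e" for a c d e z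
      using params_pos by (simp add: field_simps)
    then show ?thesis unfolding lnT .
  qed
  ultimately have "ln X = ln Y" by (simp add: algebra_simps)
  then have "X = Y" using X_pos Y by simp
  moreover have "GN_constant_closed p q m = Y powr (- (\<beta> / (m + 1)))"
    by (simp add: GN_constant_closed_def Y_def B_def \<eta>1_def \<eta>2_def \<beta>_def Let_def mult.commute)
  ultimately show ?thesis by simp
qed

end

section \<open>The Gagliardo--Nirenberg inequality\<close>

lemma continuous_measurable_lebesgue:
  "continuous_on UNIV (f :: real \<Rightarrow> real) \<Longrightarrow> f \<in> borel_measurable lebesgue"
  by (intro measurable_completion) (simp add: borel_measurable_continuous_onI)

context GN_params
begin

lemma conj_exponent: "p / (p - 1) > 1" "1 / p + 1 / (p / (p - 1)) = 1"
  using p by (auto simp: divide_simps)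

text \<open>A finite supremum is what makes the later rescaling to height \<open>A\<close> possible.
  It comes from the same two-sided bound with a pure power as weight; the exponent \<open>a\<close>
  is chosen so that Hoelder turns the weight into \<open>\<bar>U\<bar>^(q+1)\<close>.\<close>

lemma AC_primitive_bounded:
  assumes AC: "AC_primitive U v" and U: "Lp (q + 1) U" and v: "Lp p v"
  shows "\<exists>B. \<forall>x. \<bar>U x\<bar> \<le> B"
proof -
  define a where "a = (q + 1) * (p - 1) / p"
  have a: "a > 0" using params_pos by (simp add: a_def)
  define g0 where "g0 y = y powr a" for y :: real
  define G0 where "G0 y = integral {0..y} g0" for y
  have g0: "continuous_on {0..} g0"
    unfolding g0_def by (rule continuous_on_powr') (use a in \<open>auto intro!: continuous_intros\<close>)
  have G0: "G0 y = y powr (a + 1) / (a + 1)" if "0 \<le> y" for y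
    unfolding G0_def g0_def using has_integral_powr_from_0[of a y] a that by (intro integral_unique) auto
  have meas: "(\<lambda>x. g0 (\<bar>U x\<bar>)) \<in> borel_measurable lebesgue"
    by (intro continuous_measurable_lebesgue continuous_on_compose2[OF g0])
       (auto intro!: continuous_intros AC_primitive_continuous[OF AC])
  have pow: "g0 (\<bar>U x\<bar>) powr (p / (p - 1)) = \<bar>U x\<bar> powr (q + 1)" for x
    using params_pos by (simp add: g0_def powr_powr a_def)
  have g0_nonneg: "0 \<le> g0 y" for y by (simp add: g0_def)
  have meas_v: "(\<lambda>x. \<bar>v x\<bar>) \<in> borel_measurable lebesgue"
    by (intro borel_measurable_abs) (use v in \<open>simp add: Lp_def\<close>)
  have "integrable lebesgue (\<lambda>x. \<bar>v x\<bar> * g0 (\<bar>U x\<bar>))"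
    by (rule Holder_integral(1)[OF p conj_exponent abs_ge_zero g0_nonneg meas_v meas, unfolded pow])
       (use U v in \<open>simp_all add: Lp_def\<close>)
  then have int: "integrable lebesgue (\<lambda>x. g0 (\<bar>U x\<bar>) * \<bar>v x\<bar>)" by (simp add: mult.commute)
  define I where "I = (LINT x|lebesgue. g0 (\<bar>U x\<bar>) * \<bar>v x\<bar>)"
  have "\<bar>U x\<bar> \<le> (I * (a + 1) / 2) powr (1 / (a + 1))" for x
  proof -
    have "2 * G0 (\<bar>U x\<bar>) \<le> I"
      unfolding I_def
    proof (rule AC_primitive_two_sided_bound[OF AC _ _ g0 _ _ _ int])
      show "(G0 has_real_derivative g0 y) (at y within {0..})" if "0 \<le> y" for y
        unfolding G0_def[abs_def] using primitive_on_nonneg[OF g0 that] .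
      show "integrable lebesgue (\<lambda>x. \<bar>U x\<bar> powr (q + 1))" using U by (simp add: Lp_def)
    qed (use params_pos in \<open>auto simp: G0_def g0_def\<close>)
    then have "\<bar>U x\<bar> powr (a + 1) \<le> I * (a + 1) / 2"
      using a by (simp add: G0 field_simps)
    then have "(\<bar>U x\<bar> powr (a + 1)) powr (1 / (a + 1)) \<le> (I * (a + 1) / 2) powr (1 / (a + 1))"
      using a by (intro powr_mono2) auto
    then show ?thesis using a by (simp add: powr_powr)
  qed
  then show ?thesis by blast
qed

text \<open>The core of the inequality, for functions of supremum \<open>A\<close>. Since
  \<open>\<bar>U\<bar> \<le> A\<close>, the Hoelder dual power of \<open>g \<bar>U\<bar>\<close> is
  exactly \<open>H \<bar>U\<bar>\<close>, and its integral \<open>Z\<close> is linear in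
  \<open>Q\<close> and \<open>R\<close>.\<close>

lemma GN_normalized:
  assumes AC: "AC_primitive U v" and U: "Lp (q + 1) U" and v: "Lp p v"
    and le: "\<And>x. \<bar>U x\<bar> \<le> A" and sup: "\<And>y. y < A \<Longrightarrow> \<exists>x. y < \<bar>U x\<bar>"
  shows "Lp (m + 1) U"
    and "(LINT x|lebesgue. \<bar>U x\<bar> powr (m + 1)) * X powr \<beta>
      \<le> (LINT x|lebesgue. \<bar>U x\<bar> powr (q + 1)) powr (1 + \<gamma>) * (LINT x|lebesgue. \<bar>v x\<bar> powr p) powr \<beta>"
proof -
  define P where "P = (LINT x|lebesgue. \<bar>v x\<bar> powr p)"
  define Q where "Q = (LINT x|lebesgue. \<bar>U x\<bar> powr (q + 1))"
  define R where "R = (LINT x|lebesgue. \<bar>U x\<bar> powr (m + 1))"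
  define Z where "Z = p / (p - 1) * (Q / (q + 1) - R / (m + 1))"
  have contU: "continuous_on UNIV (\<lambda>x. \<bar>U x\<bar>)"
    by (intro continuous_intros AC_primitive_continuous[OF AC])
  have measU: "U \<in> borel_measurable lebesgue"
    by (intro continuous_measurable_lebesgue AC_primitive_continuous[OF AC])
  have intQ: "integrable lebesgue (\<lambda>x. \<bar>U x\<bar> powr (q + 1))" and intP: "integrable lebesgue (\<lambda>x. \<bar>v x\<bar> powr p)"
    using U v by (auto simp: Lp_def)
  have intR: "integrable lebesgue (\<lambda>x. \<bar>U x\<bar> powr (m + 1))"
  proof (rule Bochner_Integration.integrable_bound)
    show "integrable lebesgue (\<lambda>x. A powr (m - q) * \<bar>U x\<bar> powr (q + 1))"
      using intQ by simp
    show "(\<lambda>x. \<bar>U x\<bar> powr (m + 1)) \<in> borel_measurable lebesgue"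
      using measU by measurable
    have "\<bar>U x\<bar> powr (m - q) * \<bar>U x\<bar> powr (q + 1) \<le> A powr (m - q) * \<bar>U x\<bar> powr (q + 1)" for x
      using le[of x] params_pos by (intro mult_right_mono powr_mono2) auto
    moreover have "\<bar>U x\<bar> powr (m - q) * \<bar>U x\<bar> powr (q + 1) = \<bar>U x\<bar> powr (m + 1)" for x
      by (simp add: algebra_simps flip: powr_add)
    ultimately show "AE x in lebesgue. norm (\<bar>U x\<bar> powr (m + 1)) \<le> norm (A powr (m - q) * \<bar>U x\<bar> powr (q + 1))"
      by simp
  qed
  then show "Lp (m + 1) U" using measU by (simp add: Lp_def)
  have gH: "g (\<bar>U x\<bar>) powr (p / (p - 1)) = H (\<bar>U x\<bar>)" for x
    using params_pos H_nonneg[OF abs_ge_zero le] by (simp add: g_def powr_powr)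
  have intH: "integrable lebesgue (\<lambda>x. H (\<bar>U x\<bar>))"
    unfolding H_def using intQ intR by simp
  have Z_eq: "(LINT x|lebesgue. H (\<bar>U x\<bar>)) = Z"
    unfolding H_def Z_def Q_def R_def using intQ intR by simp
  have Z0: "Z \<ge> 0"
    unfolding Z_eq[symmetric] by (intro integral_nonneg_AE AE_I2 H_nonneg le) auto
  have P0: "P \<ge> 0" and Q0: "Q \<ge> 0" and R0: "R \<ge> 0" by (auto simp: P_def Q_def R_def)
  have meas_g: "(\<lambda>x. g (\<bar>U x\<bar>)) \<in> borel_measurable lebesgue"
    by (intro continuous_measurable_lebesgue continuous_on_compose2[OF continuous_on_g contU]) auto
  have meas_v: "(\<lambda>x. \<bar>v x\<bar>) \<in> borel_measurable lebesgue"
    by (intro borel_measurable_abs) (use v in \<open>simp add: Lp_def\<close>)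
  have int_gv: "integrable lebesgue (\<lambda>x. g (\<bar>U x\<bar>) * \<bar>v x\<bar>)"
    and I_le: "(LINT x|lebesgue. g (\<bar>U x\<bar>) * \<bar>v x\<bar>) \<le> P powr (1 / p) * Z powr ((p - 1) / p)"
    using Holder_integral[OF p conj_exponent _ _ meas_v meas_g, unfolded gH, OF _ _ intP intH] g_nonneg
    by (auto simp: P_def Z_eq mult.commute)
  \<comment> \<open>The supremum need not be attained, so the bound is proved for every height below
    \<open>A\<close> and passed to the limit.\<close>
  have "2 * G y \<le> P powr (1 / p) * Z powr ((p - 1) / p)" if "0 \<le> y" "y < A" for y
  proof -
    obtain x where x: "y < \<bar>U x\<bar>" using sup[OF \<open>y < A\<close>] by blast
    have int_g: "g integrable_on {a..b}" if "0 \<le> a" for a b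
      by (rule integrable_continuous_real[OF continuous_on_subset[OF continuous_on_g]]) (use that in auto)
    have "G y \<le> G (\<bar>U x\<bar>)"
      unfolding G_def by (rule integral_subset_le) (use x that in \<open>auto intro: int_g g_nonneg\<close>)
    moreover have "2 * G (\<bar>U x\<bar>) \<le> (LINT x|lebesgue. g (\<bar>U x\<bar>) * \<bar>v x\<bar>)"
      using params_pos
      by (intro AC_primitive_two_sided_bound[OF AC G_deriv G_0 continuous_on_g g_nonneg intQ _ int_gv]) auto
    ultimately show ?thesis using I_le by linarith
  qed
  moreover have "((\<lambda>y. 2 * G y) \<longlongrightarrow> T) (at_left A)"
  proof -
    have "continuous (at A within {0..}) G"
      using DERIV_continuous[OF G_deriv] A_pos by simp
    moreover have "at A within {0..} = at A" using A_pos by (intro at_within_interior) auto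
    ultimately have "(G \<longlongrightarrow> G A) (at_left A)"
      by (auto simp: continuous_within intro: tendsto_within_subset)
    then show ?thesis unfolding T_def by (intro tendsto_intros)
  qed
  moreover have "eventually (\<lambda>y. 0 \<le> y \<and> y < A) (at_left A)"
    using eventually_at_left_real[OF A_pos] by eventually_elim auto
  ultimately have "T \<le> P powr (1 / p) * Z powr ((p - 1) / p)"
    by (intro tendsto_upperbound) (auto elim: eventually_mono)
  then have "T powr (p * \<beta>) \<le> (P powr (1 / p) * Z powr ((p - 1) / p)) powr (p * \<beta>)"
    using T_pos params_pos beta_pos by (intro powr_mono2) auto
  also have "\<dots> = P powr \<beta> * Z powr \<gamma>"
    using params_pos P0 Z0 by (simp add: powr_mult powr_powr \<gamma>_def)
  finally have T_le: "T powr (p * \<beta>) \<le> P powr \<beta> * Z powr \<gamma>" .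
  \<comment> \<open>The weights sum to 1 and satisfy \<open>w2 / w1 = \<gamma>\<close>, so the power
    \<open>1 / w1\<close> of the mean inequality has the exponents 1, \<open>\<gamma>\<close> and
    \<open>1 + \<gamma>\<close>.\<close>
  define w1 where "w1 = \<eta>2 / \<eta>1"
  define w2 where "w2 = (p - 1) * (m - q) / \<eta>1"
  have w: "w1 > 0" "w2 > 0" using params_pos eta_pos by (auto simp: w1_def w2_def)
  have "\<eta>2 + (p - 1) * (m - q) = \<eta>1" by (simp add: \<eta>1_def \<eta>2_def algebra_simps)
  then have w_sum: "w1 + w2 = 1" using eta_pos by (simp add: w1_def w2_def flip: add_divide_distrib)
  have w_\<gamma>: "w2 / w1 = \<gamma>" "1 / w1 = 1 + \<gamma>"
  proof -
    show "w2 / w1 = \<gamma>" using eta_pos by (simp add: w1_def w2_def \<gamma>_def \<beta>_def)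
    then show "1 / w1 = 1 + \<gamma>" using w_sum w by (simp add: field_simps)
  qed
  \<comment> \<open>\<open>Q\<close> is split into \<open>\<rho>\<close>, a multiple of
    \<open>R\<close>, and \<open>Q - \<rho>\<close>, a multiple of \<open>Z\<close>. Divided by the
    weights, the parts are \<open>R_ratio * R\<close> and \<open>Z * Q_ratio\<close>; this is where
    the two ratios come from.\<close>
  define \<rho> where "\<rho> = (q + 1) * R / (m + 1)"
  have Za: "Z * Q_ratio = (Q - \<rho>) / w2"
  proof -
    have "Z * Q_ratio = (p / (p - 1) * Q_ratio / (q + 1)) * (Q - \<rho>)"
      using params_pos by (simp add: Z_def \<rho>_def divide_simps)
    also have "p / (p - 1) * Q_ratio / (q + 1) = 1 / w2"
      using params_pos eta_pos by (simp add: Q_ratio_def w2_def)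
    finally show ?thesis by simp
  qed
  have bR: "R_ratio * R = \<rho> / w1"
    by (simp add: R_ratio_def \<rho>_def w1_def)
  have Q\<rho>: "Q - \<rho> \<ge> 0"
    using Za Z0 ratio_pos w by (metis mult_nonneg_nonneg less_imp_le zero_le_divide_iff not_le)
  have key: "R_ratio * R * (Z * Q_ratio) powr \<gamma> \<le> Q powr (1 + \<gamma>)"
  proof (cases "R = 0 \<or> Z = 0")
    case True
    then show ?thesis using beta_pos by auto
  next
    case False
    then have pos: "\<rho> / w1 > 0" "(Q - \<rho>) / w2 > 0"
      using R0 Z0 ratio_pos bR[symmetric] Za[symmetric] by auto
    have "(\<rho> / w1) powr w1 * ((Q - \<rho>) / w2) powr w2 \<le> w1 * (\<rho> / w1) + w2 * ((Q - \<rho>) / w2)"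
      using w by (intro Youngs_inequality_0 w_sum pos) auto
    also have "\<dots> = Q" using w by simp
    finally have "((\<rho> / w1) powr w1 * ((Q - \<rho>) / w2) powr w2) powr (1 / w1) \<le> Q powr (1 / w1)"
      using w by (intro powr_mono2) auto
    also have "((\<rho> / w1) powr w1 * ((Q - \<rho>) / w2) powr w2) powr (1 / w1) = \<rho> / w1 * ((Q - \<rho>) / w2) powr \<gamma>"
    proof -
      have "(y1 powr w1 * y2 powr w2) powr (1 / w1) = y1 * y2 powr \<gamma>" if "y1 > 0" "y2 > 0" for y1 y2 :: real
        using that w w_\<gamma>(1) by (simp add: powr_mult powr_powr)
      then show ?thesis using pos by blast
    qed
    finally show ?thesis unfolding bR Za w_\<gamma>(2) .
  qed
  have "R * X powr \<beta> = T powr (p * \<beta>) * (Q_ratio powr \<gamma> * R_ratio * R)"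
    by (simp add: X_powr_beta)
  also have "\<dots> \<le> (P powr \<beta> * Z powr \<gamma>) * (Q_ratio powr \<gamma> * R_ratio * R)"
    using T_le ratio_pos R0 by (intro mult_right_mono) auto
  also have "\<dots> = P powr \<beta> * (R_ratio * R * (Z * Q_ratio) powr \<gamma>)"
    using Z0 ratio_pos by (simp add: powr_mult)
  also have "\<dots> \<le> P powr \<beta> * Q powr (1 + \<gamma>)"
    by (intro mult_left_mono key) auto
  finally show "R * X powr \<beta> \<le> Q powr (1 + \<gamma>) * P powr \<beta>" by (simp add: mult.commute)
qed

lemma GN_exponent_eq: "GN_exponent p q m = p * \<beta> / (m + 1)"
  by (simp add: GN_exponent_def \<beta>_def \<eta>2_def mult.commute)

text \<open>Equivalent to \<open>m + 1 = p * \<beta> + (q + 1) * (1 + \<gamma>)\<close>, the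
  equality of degrees when \<open>u\<close> is multiplied by a constant.\<close>

lemma one_minus_GN_exponent: "(1 - GN_exponent p q m) / (q + 1) = (1 + \<gamma>) / (m + 1)"
proof -
  have "\<beta> * ((p - 1) * (q + 1) + p) = m - q"
    using eta_pos by (simp add: \<beta>_def flip: \<eta>2_def)
  then have "(m + 1) - p * \<beta> = (q + 1) * (1 + \<gamma>)"
    by (simp add: \<gamma>_def algebra_simps)
  then have "1 - GN_exponent p q m = (q + 1) * (1 + \<gamma>) / (m + 1)"
    using params_pos by (simp add: GN_exponent_eq diff_divide_eq_iff)
  then show ?thesis using params_pos by simp
qed

lemma Lp_norm_powr_exponents:
  "Lp_norm (q + 1) U powr (1 - GN_exponent p q m) = (LINT x|lebesgue. \<bar>U x\<bar> powr (q + 1)) powr ((1 + \<gamma>) / (m + 1))"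
  "Lp_norm p v powr GN_exponent p q m = (LINT x|lebesgue. \<bar>v x\<bar> powr p) powr (\<beta> / (m + 1))"
  using params_pos unfolding Lp_norm_def powr_powr one_minus_GN_exponent[symmetric]
  by (simp_all add: GN_exponent_eq)

text \<open>Both sides are homogeneous of degree 1, so the factor \<open>c = A / M\<close> that
  brings the supremum \<open>M\<close> to \<open>A\<close> cancels.\<close>

lemma GN_AC:
  assumes AC: "AC_primitive U v" and U: "Lp (q + 1) U" and v: "Lp p v"
  shows "Lp (m + 1) U"
    and "Lp_norm (m + 1) U \<le> X powr (- (\<beta> / (m + 1))) *
        Lp_norm (q + 1) U powr (1 - GN_exponent p q m) * Lp_norm p v powr GN_exponent p q m"
proof -
  define C where "C = X powr (- (\<beta> / (m + 1)))"
  define \<theta> where "\<theta> = GN_exponent p q m"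
  have "Lp (m + 1) U \<and> Lp_norm (m + 1) U \<le> C * Lp_norm (q + 1) U powr (1 - \<theta>) * Lp_norm p v powr \<theta>"
  proof (cases "\<forall>x. U x = 0")
    case True
    then have "U = (\<lambda>x. 0)" by auto
    then show ?thesis by (auto simp: Lp_def Lp_norm_def C_def)
  next
    case False
    then obtain x0 where x0: "U x0 \<noteq> 0" by blast
    obtain B where B: "\<And>x. \<bar>U x\<bar> \<le> B" using AC_primitive_bounded[OF assms] by blast
    define M where "M = (SUP x. \<bar>U x\<bar>)"
    have bdd: "bdd_above (range (\<lambda>x. \<bar>U x\<bar>))" using B unfolding bdd_above_def by blast
    have M_ge: "\<bar>U x\<bar> \<le> M" for x
      unfolding M_def by (rule cSUP_upper[OF _ bdd]) simp
    have M: "M > 0" using x0 M_ge[of x0] by linarith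
    define c where "c = A / M"
    have c: "c > 0" using M A_pos by (simp add: c_def)
    note AC' = AC_primitive_mult[OF AC, of c] and U' = Lp_mult[OF U, of c] and v' = Lp_mult[OF v, of c]
    have le: "\<bar>c * U x\<bar> \<le> A" for x
      using M_ge[of x] M A_pos by (simp add: c_def abs_mult divide_simps mult_left_mono)
    have sup: "\<exists>x. y < \<bar>c * U x\<bar>" if "y < A" for y
    proof -
      have "y / c < M" using that c M A_pos by (simp add: c_def field_simps)
      then obtain x where "y / c < \<bar>U x\<bar>"
        unfolding M_def using less_cSUP_iff[OF _ bdd] by auto
      then show ?thesis using c by (auto simp: abs_mult field_simps)
    qed
    note norm = GN_normalized[OF AC' U' v' le sup]
    define P where "P = (LINT x|lebesgue. \<bar>c * v x\<bar> powr p)"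
    define Q where "Q = (LINT x|lebesgue. \<bar>c * U x\<bar> powr (q + 1))"
    define R where "R = (LINT x|lebesgue. \<bar>c * U x\<bar> powr (m + 1))"
    have "R \<le> Q powr (1 + \<gamma>) * P powr \<beta> * X powr (- \<beta>)"
      using norm(2) X_pos unfolding P_def Q_def R_def by (simp add: powr_minus field_simps)
    then have "R powr (1 / (m + 1)) \<le> (Q powr (1 + \<gamma>) * P powr \<beta> * X powr (- \<beta>)) powr (1 / (m + 1))"
      using params_pos by (intro powr_mono2) (auto simp: R_def)
    also have "\<dots> = C * Q powr ((1 + \<gamma>) / (m + 1)) * P powr (\<beta> / (m + 1))"
      by (simp add: powr_mult powr_powr C_def)
    finally have "Lp_norm (m + 1) (\<lambda>x. c * U x) \<le>
        C * Lp_norm (q + 1) (\<lambda>x. c * U x) powr (1 - \<theta>) * Lp_norm p (\<lambda>x. c * v x) powr \<theta>"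
      unfolding \<theta>_def Lp_norm_powr_exponents P_def Q_def R_def by (simp add: Lp_norm_def)
    then have "c * Lp_norm (m + 1) U \<le>
        C * (c * Lp_norm (q + 1) U) powr (1 - \<theta>) * (c * Lp_norm p v) powr \<theta>"
      using c params_pos by (simp add: Lp_norm_mult)
    also have "\<dots> = c powr (1 - \<theta>) * c powr \<theta> * (C * Lp_norm (q + 1) U powr (1 - \<theta>) * Lp_norm p v powr \<theta>)"
      using c by (simp add: powr_mult Lp_norm_def)
    also have "c powr (1 - \<theta>) * c powr \<theta> = c" using c by (simp flip: powr_add)
    finally have "Lp_norm (m + 1) U \<le> C * Lp_norm (q + 1) U powr (1 - \<theta>) * Lp_norm p v powr \<theta>"
      using c by simp
    moreover have "Lp (m + 1) U" using Lp_mult[OF norm(1), of "1 / c"] c by simp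
    ultimately show ?thesis by blast
  qed
  then show "Lp (m + 1) U" and "Lp_norm (m + 1) U \<le> X powr (- (\<beta> / (m + 1))) *
        Lp_norm (q + 1) U powr (1 - GN_exponent p q m) * Lp_norm p v powr GN_exponent p q m"
    by (auto simp: C_def \<theta>_def)
qed

lemma GN_inequality_closed: "GN_inequality p q m (GN_constant_closed p q m)"
  unfolding GN_inequality_def GN_constant_closed_eq
proof (intro allI impI, elim conjE)
  fix u v assume *: "Lp (q + 1) u" "weak_derivative u v" "Lp p v"
  obtain U where U: "AC_primitive U v" "AE x in lebesgue. u x = U x"
    using weak_derivative_AC_primitive[OF *(2)] .
  have meas: "U \<in> borel_measurable lebesgue"
    by (intro continuous_measurable_lebesgue AC_primitive_continuous[OF U(1)])
  note cong = Lp_cong_AE[OF U(2) meas]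
  show "Lp (m + 1) u \<and> Lp_norm (m + 1) u \<le> X powr (- (\<beta> / (m + 1))) *
      Lp_norm (q + 1) u powr (1 - GN_exponent p q m) * Lp_norm p v powr GN_exponent p q m"
    using GN_AC[OF U(1) _ *(3)] *(1) unfolding cong by blast
qed

end

section \<open>Energy of the solutions\<close>

text \<open>Serves to differentiate the energy also at points where \<open>u'\<close> might vanish;
  \<open>s > 1\<close> makes 0 harmless.\<close>

lemma has_real_derivative_abs_powr:
  assumes "s > 1"
  shows "((\<lambda>x::real. \<bar>x\<bar> powr s) has_real_derivative s * \<bar>x\<bar> powr (s - 1) * sgn x) (at x)"
proof -
  consider "x > 0" | "x < 0" | "x = 0" by linarith
  then show ?thesis
  proof cases
    case 1
    have "((\<lambda>x. x powr s) has_real_derivative s * \<bar>x\<bar> powr (s - 1) * sgn x) (at x)"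
      using has_real_derivative_powr[OF 1, of s] 1 by simp
    then show ?thesis
      by (rule has_field_derivative_transform_within_open[of _ _ _ "{0<..}"]) (use 1 in auto)
  next
    case 2
    have "((\<lambda>x. (- x) powr s) has_real_derivative s * (- x) powr (s - 1) * (-1)) (at x)"
      using 2 by (intro DERIV_chain2[where f = "\<lambda>x. x powr s"] has_real_derivative_powr) (auto intro!: derivative_eq_intros)
    then have "((\<lambda>x. (- x) powr s) has_real_derivative s * \<bar>x\<bar> powr (s - 1) * sgn x) (at x)"
      using 2 by simp
    then show ?thesis
      by (rule has_field_derivative_transform_within_open[of _ _ _ "{..<0}"]) (use 2 in auto)
  next
    case 3
    have "((\<lambda>h::real. \<bar>h\<bar> powr (s - 1)) \<longlongrightarrow> 0) (at 0)"
    proof -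
      have "((\<lambda>h::real. \<bar>h\<bar> powr (s - 1)) \<longlongrightarrow> \<bar>0\<bar> powr (s - 1)) (at 0)"
        using assms by (intro tendsto_powr' tendsto_intros) auto
      then show ?thesis by simp
    qed
    then have "((\<lambda>h::real. norm (\<bar>h\<bar> powr s / h)) \<longlongrightarrow> 0) (at 0)"
    proof (rule Lim_transform_eventually)
      have "\<bar>h\<bar> powr (s - 1) = norm (\<bar>h\<bar> powr s / h)" if "h \<noteq> 0" for h :: real
        using that powr_diff[of "\<bar>h\<bar>" s 1] by (simp add: abs_divide)
      then show "\<forall>\<^sub>F h in at 0. \<bar>h\<bar> powr (s - 1) = norm (\<bar>h\<bar> powr s / h)"
        by (auto simp: eventually_at_filter)
    qed
    then have "((\<lambda>h::real. \<bar>h\<bar> powr s / h) \<longlongrightarrow> 0) (at 0)" by (rule tendsto_norm_zero_cancel)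
    then show ?thesis using 3 by (simp add: has_field_derivative_iff)
  qed
qed

text \<open>L'Hospital's rule for the difference quotient. It yields both the initial height of an
  arbitrary solution and the zero slope of the closed form.\<close>

lemma has_derivative_at_endpoint:
  fixes f :: "real \<Rightarrow> real"
  assumes "continuous_on {0..} f" "\<And>r. r > 0 \<Longrightarrow> (f has_real_derivative f' r) (at r)" "(f' \<longlongrightarrow> L) (at_right 0)"
  shows "(f has_real_derivative L) (at 0 within {0..})"
proof -
  have pos: "\<forall>\<^sub>F x in at_right 0. 0 < (x::real)" by (rule eventually_at_right_less)
  have "continuous (at 0 within {0..}) f"
    using assms(1) by (simp add: continuous_on_eq_continuous_within)
  then have "(f \<longlongrightarrow> f 0) (at_right 0)" by (simp add: continuous_within at_within_Ici_at_right)
  then have 0: "((\<lambda>r. f r - f 0) \<longlongrightarrow> 0) (at_right 0)" by (auto intro!: tendsto_eq_intros)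
  have "((\<lambda>r. (f r - f 0) / r) \<longlongrightarrow> L) (at_right 0)"
  proof (rule lhopital_right_0[OF 0, where f' = f' and g' = "\<lambda>_. 1"])
    show "\<forall>\<^sub>F x in at_right 0. ((\<lambda>r. f r - f 0) has_real_derivative f' x) (at x)"
      using pos by eventually_elim (auto intro!: derivative_eq_intros assms(2))
  qed (use pos assms(3) in \<open>auto elim: eventually_mono intro!: tendsto_eq_intros\<close>)
  then show ?thesis by (simp add: has_field_derivative_iff at_within_Ici_at_right)
qed

context GN_params
begin

lemma has_derivative_H: "s > 0 \<Longrightarrow> (H has_real_derivative p / (p - 1) * (s powr q - s powr m)) (at s)"
  unfolding H_def[abs_def] using params_pos
  by (auto intro!: derivative_eq_intros simp: divide_simps) (simp add: algebra_simps)

definition speed :: "real \<Rightarrow> real" where "speed s = H s powr (1 / p)"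

lemma speed_A: "speed A = 0"
  by (simp add: speed_def H_A)

lemma speed_pos: "0 < s \<Longrightarrow> s < A \<Longrightarrow> 0 < speed s"
  using H_pos[of s] by (simp add: speed_def)

lemma continuous_on_speed: "continuous_on {0..A} speed"
  unfolding speed_def
  by (rule continuous_on_powr')
     (use params_pos H_nonneg in \<open>auto intro!: continuous_intros continuous_on_subset[OF continuous_on_H]\<close>)

section \<open>First integral of the equation for an arbitrary solution\<close>

context
  fixes u :: "real \<Rightarrow> real"
  assumes sol: "pos_decr_solution p q m u"
begin

lemma sol_pos: "r \<ge> 0 \<Longrightarrow> u r > 0"
  using sol by (simp add: pos_decr_solution_def)

lemma sol_less: "0 \<le> r \<Longrightarrow> r < s \<Longrightarrow> u s < u r"
  using sol by (auto simp: pos_decr_solution_def monotone_on_def)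

lemma sol_lim: "(u \<longlongrightarrow> 0) at_top"
  using sol by (simp add: pos_decr_solution_def)

lemma sol_deriv: "r > 0 \<Longrightarrow> (u has_real_derivative deriv u r) (at r)"
  using sol by (simp add: pos_decr_solution_def DERIV_deriv_iff_real_differentiable)

lemma sol_deriv_0: "(u has_real_derivative 0) (at 0 within {0..})"
  using sol by (simp add: pos_decr_solution_def)

lemma sol_continuous: "continuous_on {0..} u"
  unfolding continuous_on_eq_continuous_within
proof
  fix r :: real assume "r \<in> {0..}"
  then consider "r = 0" | "r > 0" by force
  then show "continuous (at r within {0..}) u"
  proof cases
    case 1
    then show ?thesis using DERIV_continuous[OF sol_deriv_0] by simp
  next
    case 2
    then show ?thesis using DERIV_isCont[OF sol_deriv[OF 2]] continuous_at_imp_continuous_at_within by blast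
  qed
qed

lemma sol_deriv_nonpos: assumes "r > 0" shows "deriv u r \<le> 0"
proof (rule ccontr)
  assume "\<not> ?thesis"
  then obtain d where d: "d > 0" "\<And>h. 0 < h \<Longrightarrow> h < d \<Longrightarrow> u r < u (r + h)"
    using DERIV_pos_inc_right[OF sol_deriv[OF assms]] by auto
  show False using d(2)[of "d / 2"] sol_less[of r "r + d / 2"] d(1) assms by force
qed

text \<open>The equation gives differentiability of the flux
  \<open>w = \<bar>u'\<bar>^(p-1)\<close>, not of \<open>u'\<close>. Therefore
  \<open>\<bar>u'\<bar>^p\<close> is written as \<open>\<bar>w\<bar>\<close> to the power
  \<open>p / (p - 1)\<close>, and the two derivatives cancel.\<close>

lemma sol_energy_constant:
  "\<exists>c. \<forall>r>0. \<bar>deriv u r\<bar> powr p = c + H (u r)"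
proof -
  define w where "w r = \<bar>deriv u r\<bar> powr (p - 1)" for r
  define s where "s = p / (p - 1)"
  have s: "s > 1" using p by (simp add: s_def)
  have w_deriv: "(w has_real_derivative u r powr m - u r powr q) (at r)" if "r > 0" for r
  proof -
    obtain D where D: "((\<lambda>s. \<bar>deriv u s\<bar> powr (p - 2) * deriv u s) has_real_derivative D) (at r)"
      "D + u r powr m = u r powr q"
      using sol \<open>r > 0\<close> by (auto simp: pos_decr_solution_def)
    have "((\<lambda>s. - (\<bar>deriv u s\<bar> powr (p - 2) * deriv u s)) has_real_derivative - D) (at r)"
      by (rule DERIV_minus[OF D(1)])
    then have "(w has_real_derivative - D) (at r)"
    proof (rule has_field_derivative_transform_within_open[of _ _ _ "{0<..}"])
      fix x :: real assume "x \<in> {0<..}"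
      then have "- deriv u x = \<bar>deriv u x\<bar>" using sol_deriv_nonpos[of x] by simp
      \<comment> \<open>Where \<open>u'\<close> vanishes both sides are 0, because
        \<open>0 powr s = 0\<close> for negative exponents too.\<close>
      moreover have "\<bar>deriv u x\<bar> powr (p - 2) * \<bar>deriv u x\<bar> = \<bar>deriv u x\<bar> powr (p - 1)"
        using powr_add[of "\<bar>deriv u x\<bar>" "p - 2" 1] by (cases "deriv u x = 0") auto
      ultimately show "- (\<bar>deriv u x\<bar> powr (p - 2) * deriv u x) = w x"
        by (metis w_def mult_minus_right)
    qed (use that in auto)
    moreover have "- D = u r powr m - u r powr q" using D(2) by simp
    ultimately show ?thesis by simp
  qed
  have w_s: "\<bar>w r\<bar> powr s = \<bar>deriv u r\<bar> powr p" for r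
    using params_pos by (simp add: w_def powr_powr s_def)
  have "\<exists>c. \<forall>r\<in>{0<..}. \<bar>w r\<bar> powr s - H (u r) = c"
  proof (rule has_field_derivative_zero_constant)
    fix r :: real assume "r \<in> {0<..}"
    then have r: "r > 0" by simp
    have "((\<lambda>r. \<bar>w r\<bar> powr s) has_real_derivative s * \<bar>w r\<bar> powr (s - 1) * sgn (w r) * (u r powr m - u r powr q)) (at r)"
      by (rule DERIV_chain2[OF has_real_derivative_abs_powr[OF s] w_deriv[OF r]])
    moreover have "((\<lambda>r. H (u r)) has_real_derivative s * (u r powr q - u r powr m) * deriv u r) (at r)"
      unfolding s_def by (rule DERIV_chain2[OF has_derivative_H sol_deriv[OF r]]) (use sol_pos r in auto)
    ultimately have "((\<lambda>r. \<bar>w r\<bar> powr s - H (u r)) has_real_derivative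
        s * \<bar>w r\<bar> powr (s - 1) * sgn (w r) * (u r powr m - u r powr q) - s * (u r powr q - u r powr m) * deriv u r) (at r)"
      by (rule DERIV_diff)
    also have "\<bar>w r\<bar> powr (s - 1) * sgn (w r) = - deriv u r"
    proof -
      have "s - 1 = 1 / (p - 1)" using p by (simp add: s_def divide_simps)
      then have "\<bar>w r\<bar> powr (s - 1) = \<bar>deriv u r\<bar>" using params_pos by (simp add: w_def powr_powr)
      moreover have "sgn (w r) = (if deriv u r = 0 then 0 else 1)" by (simp add: w_def)
      ultimately show ?thesis using sol_deriv_nonpos[OF r] by simp
    qed
    then have "s * \<bar>w r\<bar> powr (s - 1) * sgn (w r) * (u r powr m - u r powr q) - s * (u r powr q - u r powr m) * deriv u r = 0"
      by (simp add: algebra_simps)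
    finally show "((\<lambda>r. \<bar>w r\<bar> powr s - H (u r)) has_real_derivative 0) (at r within {0<..})"
      by (rule has_field_derivative_at_within)
  qed simp
  then obtain c where "\<And>r. r > 0 \<Longrightarrow> \<bar>w r\<bar> powr s - H (u r) = c" by auto
  then have "\<bar>deriv u r\<bar> powr p = c + H (u r)" if "r > 0" for r
    using that by (fastforce simp: w_s)
  then show ?thesis by blast
qed

text \<open>The energy vanishes: otherwise \<open>u'\<close> would stay away from \<open>0\<close> at infinity and \<open>u\<close> would become negative.\<close>

lemma sol_energy: assumes "r > 0" shows "\<bar>deriv u r\<bar> powr p = H (u r)"
proof -
  obtain c where c: "\<And>r. r > 0 \<Longrightarrow> \<bar>deriv u r\<bar> powr p = c + H (u r)"
    using sol_energy_constant by blast
  have H_lim: "((\<lambda>r. H (u r)) \<longlongrightarrow> 0) at_top"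
  proof -
    have "(H \<longlongrightarrow> H 0) (at 0 within {0..})"
      using continuous_on_H by (auto simp: continuous_on)
    moreover have "filterlim u (at 0 within {0..}) at_top"
      unfolding filterlim_at using sol_lim sol_pos
      by (auto intro!: eventually_mono[OF eventually_ge_at_top[of 0]] simp: less_imp_le less_imp_neq[symmetric])
    ultimately show ?thesis using H_0 filterlim_compose by fastforce
  qed
  have "((\<lambda>r. c + H (u r)) \<longlongrightarrow> c + 0) at_top" by (intro tendsto_intros H_lim)
  then have lim: "((\<lambda>r. c + H (u r)) \<longlongrightarrow> c) at_top" by simp
  have "0 \<le> c"
    by (rule tendsto_lowerbound[OF lim])
       (auto intro!: eventually_mono[OF eventually_gt_at_top[of 0]] simp flip: c)
  moreover have "\<not> 0 < c"
  proof
    assume "0 < c"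
    then have "\<forall>\<^sub>F r in at_top. c / 2 < c + H (u r)" using lim by (intro order_tendstoD(1)) auto
    then obtain r0 where r0: "\<And>r. r \<ge> r0 \<Longrightarrow> c / 2 < c + H (u r)"
      unfolding eventually_at_top_linorder by blast
    define k where "k = (c / 2) powr (1 / p)"
    have k: "k > 0" using \<open>0 < c\<close> by (simp add: k_def)
    define r1 where "r1 = max r0 1"
    have le: "deriv u r \<le> - k" if "r \<ge> r1" for r
    proof -
      have "c / 2 \<le> \<bar>deriv u r\<bar> powr p" using r0[of r] c[of r] that by (simp add: r1_def)
      then have "k \<le> (\<bar>deriv u r\<bar> powr p) powr (1 / p)"
        unfolding k_def using \<open>0 < c\<close> params_pos by (intro powr_mono2) auto
      then show ?thesis using sol_deriv_nonpos[of r] that params_pos by (simp add: powr_powr r1_def)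
    qed
    \<comment> \<open>With slope at most \<open>- k\<close>, a time \<open>u r1 / k\<close> suffices
      to reach 0; the extra 1 makes the value negative.\<close>
    define t where "t = u r1 / k + 1"
    have "t > 0" using sol_pos[of r1] k by (simp add: t_def r1_def add_pos_pos)
    then obtain z where z: "r1 < z" "z < r1 + t" "u (r1 + t) - u r1 = t * deriv u z"
      using MVT2[of r1 "r1 + t" u "deriv u"] sol_deriv by (auto simp: r1_def)
    have "t * deriv u z \<le> t * - k" using le[of z] z \<open>t > 0\<close> by (intro mult_left_mono) auto
    then have "u (r1 + t) \<le> u r1 - t * k" using z by simp
    also have "\<dots> < 0" using k by (simp add: t_def field_simps)
    finally show False using sol_pos[of "r1 + t"] \<open>t > 0\<close> by (simp add: r1_def)
  qed
  ultimately show ?thesis using c[OF assms] by simp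
qed

lemma sol_le_A: assumes "r \<ge> 0" shows "u r \<le> A"
proof -
  have le: "u r \<le> A" if "r > 0" for r
    using sol_energy[OF that] H_neg[of "u r"] by (metis not_le powr_ge_zero)
  show ?thesis
  proof (cases "r = 0")
    case True
    have "continuous (at 0 within {0..}) u"
      using sol_continuous by (simp add: continuous_on_eq_continuous_within)
    then have "(u \<longlongrightarrow> u 0) (at_right 0)" by (simp add: continuous_within at_within_Ici_at_right)
    then have "u 0 \<le> A"
      by (rule tendsto_upperbound) (auto intro: eventually_mono[OF eventually_at_right_less] le)
    with True show ?thesis by simp
  qed (use assms le in auto)
qed

lemma sol_less_A: "r > 0 \<Longrightarrow> u r < A"
  using sol_less[of 0 r] sol_le_A[of 0] by simp

lemma deriv_sol: assumes "r > 0" shows "deriv u r = - speed (u r)"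
proof -
  have "speed (u r) = \<bar>deriv u r\<bar>"
    unfolding speed_def sol_energy[OF assms, symmetric] using params_pos by (simp add: powr_powr)
  then show ?thesis using sol_deriv_nonpos[OF assms] by simp
qed

text \<open>The one-sided slope at 0 is the limit of \<open>u' = - speed u\<close>; for an initial
  value below \<open>A\<close> it would be negative.\<close>

lemma sol_0: "u 0 = A"
proof (rule ccontr)
  assume "u 0 \<noteq> A"
  then have less: "u 0 < A" using sol_le_A[of 0] by simp
  have "continuous_on {0..} (\<lambda>r. - speed (u r))"
    by (intro continuous_intros continuous_on_compose2[OF continuous_on_speed sol_continuous])
       (auto intro: sol_le_A less_imp_le[OF sol_pos])
  then have "continuous (at 0 within {0..}) (\<lambda>r. - speed (u r))"
    by (simp add: continuous_on_eq_continuous_within)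
  then have "((\<lambda>r. - speed (u r)) \<longlongrightarrow> - speed (u 0)) (at_right 0)"
    by (simp add: continuous_within at_within_Ici_at_right)
  then have "(u has_real_derivative - speed (u 0)) (at 0 within {0..})"
    by (intro has_derivative_at_endpoint[where f' = "\<lambda>r. - speed (u r)"] sol_continuous)
       (use sol_deriv deriv_sol in auto)
  then have "- speed (u 0) = 0"
    using sol_deriv_0 by (rule has_field_derivative_unique) (auto simp: at_within_Ici_at_right)
  then show False using speed_pos[OF sol_pos less] by simp
qed

end

end

section \<open>The closed form of the solutions\<close>

lemma inc_Beta_integrable:
  assumes "a > 0" "x < 1"
  shows "(\<lambda>t. t powr (a - 1) * (1 - t) powr (b - 1)) integrable_on {0..x::real}"
proof (cases "0 \<le> x")
  case True
  have "(\<lambda>t. (1 - t) powr (b - 1) * t powr (a - 1)) absolutely_integrable_on {0..x}"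
  proof (rule absolutely_integrable_bounded_measurable_product_real)
    have "continuous_on {0..x} (\<lambda>t. (1 - t) powr (b - 1))"
      using assms by (intro continuous_intros) auto
    then show "bounded ((\<lambda>t. (1 - t) powr (b - 1)) ` {0..x})"
      "(\<lambda>t. (1 - t) powr (b - 1)) \<in> borel_measurable (lebesgue_on {0..x})"
      by (auto intro: compact_imp_bounded compact_continuous_image continuous_imp_measurable_on_sets_lebesgue)
    show "(\<lambda>t. t powr (a - 1)) absolutely_integrable_on {0..x}"
      using assms True by (intro nonnegative_absolutely_integrable_1 integrable_on_powr_from_0) auto
  qed auto
  then show ?thesis
    using set_lebesgue_integral_eq_integral(1) by (auto simp: mult.commute)
qed auto

lemma inc_Beta_0: "inc_Beta 0 a b = 0"
  by (simp add: inc_Beta_def)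

lemma inc_Beta_deriv:
  assumes "a > 0" "0 < x" "x < 1"
  shows "((\<lambda>x. inc_Beta x a b) has_real_derivative x powr (a - 1) * (1 - x) powr (b - 1)) (at x)"
proof -
  define c where "c = (x + 1) / 2"
  have c: "x < c" "c < 1" using assms by (auto simp: c_def)
  have "continuous_on {0<..<1} (\<lambda>t. t powr (a - 1) * (1 - t) powr (b - 1))"
    by (intro continuous_intros) auto
  then have cont: "isCont (\<lambda>t. t powr (a - 1) * (1 - t) powr (b - 1)) x"
    using assms by (simp add: continuous_on_eq_continuous_at)
  have "((\<lambda>x. inc_Beta x a b) has_vector_derivative x powr (a - 1) * (1 - x) powr (b - 1)) (at x within {0..c} - {})"
    unfolding inc_Beta_def
    by (rule integral_has_vector_derivative_continuous_at[OF inc_Beta_integrable])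
       (use assms c continuous_at_imp_continuous_at_within[OF cont] in auto)
  moreover have "at x within {0..c} - {} = at x"
    using assms c by (intro at_within_interior) auto
  ultimately show ?thesis by (simp add: has_real_derivative_iff_has_vector_derivative)
qed

lemma inc_Beta_continuous: "a > 0 \<Longrightarrow> continuous_on {0..<1} (\<lambda>x. inc_Beta x a b)"
  unfolding continuous_on_eq_continuous_within
proof
  fix x :: real assume a: "a > 0" and x: "x \<in> {0..<1}"
  define c where "c = (x + 1) / 2"
  have c: "x < c" "c < 1" using x by (auto simp: c_def)
  have "continuous_on {0..c} (\<lambda>x. inc_Beta x a b)"
    unfolding inc_Beta_def by (rule indefinite_integral_continuous_1[OF inc_Beta_integrable[OF a c(2)]])
  then have "continuous (at x within {0..c}) (\<lambda>x. inc_Beta x a b)"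
    using x c by (auto simp: continuous_on_eq_continuous_within)
  moreover have "at x within {0..c} = at x within {0..<1}"
    by (rule at_within_nhd[of x "{..<c}"]) (use c in auto)
  ultimately show "continuous (at x within {0..<1}) (\<lambda>x. inc_Beta x a b)" by simp
qed

lemma inc_Beta_strict_mono:
  assumes "a > 0" "0 \<le> x" "x < y" "y < 1"
  shows "inc_Beta x a b < inc_Beta y a b"
proof (rule DERIV_pos_imp_increasing_open[OF assms(3)])
  fix z assume "x < z" "z < y"
  then show "\<exists>d. ((\<lambda>x. inc_Beta x a b) has_real_derivative d) (at z) \<and> 0 < d"
    using assms by (intro exI[of _ "z powr (a - 1) * (1 - z) powr (b - 1)"] conjI inc_Beta_deriv) auto
next
  show "continuous_on {x..y} (\<lambda>x. inc_Beta x a b)"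
    by (rule continuous_on_subset[OF inc_Beta_continuous]) (use assms in auto)
qed

lemma inc_Beta_inj: "a > 0 \<Longrightarrow> inj_on (\<lambda>x. inc_Beta x a b) {0..<1}"
proof (rule inj_onI)
  fix x y assume "a > 0" "x \<in> {0..<1}" "y \<in> {0..<1}" "inc_Beta x a b = inc_Beta y a b"
  then show "x = y"
    using inc_Beta_strict_mono[of a x y b] inc_Beta_strict_mono[of a y x b]
    by (cases x y rule: linorder_cases) auto
qed

text \<open>For \<open>b \<le> 0\<close> the integrand dominates \<open>1 / (1 - t)\<close>. The
  resulting divergence at 1 makes the inverse defined on all of
  \<open>[0, \<infinity>)\<close>.\<close>

lemma inc_Beta_ge_log:
  assumes "0 < a" "a \<le> 1" "b \<le> 0" "0 \<le> x" "x < 1"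
  shows "- ln (1 - x) \<le> inc_Beta x a b"
proof -
  define D where "D x = inc_Beta x a b + ln (1 - x)" for x
  have "D 0 \<le> D x"
  proof (rule DERIV_nonneg_imp_increasing_open[OF assms(4)])
    fix z assume z: "0 < z" "z < x"
    have "(D has_real_derivative z powr (a - 1) * (1 - z) powr (b - 1) - 1 / (1 - z)) (at z)"
      unfolding D_def[abs_def] using z assms
      by (auto intro!: derivative_eq_intros inc_Beta_deriv)
    moreover have "1 / (1 - z) \<le> z powr (a - 1) * (1 - z) powr (b - 1)"
    proof -
      have "1 \<le> z powr (a - 1)" using z assms powr_mono2'[of "a - 1" z 1] by simp
      moreover have "(1 - z) powr (-1) \<le> (1 - z) powr (b - 1)"
        using z assms by (intro powr_mono') auto
      ultimately have "1 * (1 - z) powr (-1) \<le> z powr (a - 1) * (1 - z) powr (b - 1)"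
        by (intro mult_mono) auto
      then show ?thesis using z assms by (simp add: powr_minus_divide)
    qed
    ultimately show "\<exists>d. (D has_real_derivative d) (at z) \<and> 0 \<le> d" by (intro exI conjI) auto
  next
    have "continuous_on {0..x} (\<lambda>x. inc_Beta x a b)"
      by (rule continuous_on_subset[OF inc_Beta_continuous]) (use assms in auto)
    then show "continuous_on {0..x} D"
      unfolding D_def using assms by (intro continuous_intros) auto
  qed
  then show ?thesis by (simp add: D_def inc_Beta_0)
qed

lemma inc_Beta_surj:
  assumes "0 < a" "a \<le> 1" "b \<le> 0" "0 \<le> y"
  obtains x where "0 \<le> x" "x < 1" "inc_Beta x a b = y"
proof -
  \<comment> \<open>The point at which the logarithmic lower bound equals \<open>y\<close>.\<close>
  define c where "c = 1 - exp (- y)"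
  have c: "0 \<le> c" "c < 1" using assms by (auto simp: c_def)
  have "y \<le> inc_Beta c a b" using inc_Beta_ge_log[OF assms(1-3) c] by (simp add: c_def)
  moreover have "continuous_on {0..c} (\<lambda>x. inc_Beta x a b)"
    by (rule continuous_on_subset[OF inc_Beta_continuous]) (use assms c in auto)
  ultimately obtain x where "0 \<le> x" "x \<le> c" "inc_Beta x a b = y"
    using IVT'[of "\<lambda>x. inc_Beta x a b" 0 y c] assms c by (auto simp: inc_Beta_0)
  then show ?thesis using that c by simp
qed

section \<open>Separation of variables and uniqueness of the solution\<close>

context GN_params
begin

definition ba :: real where "ba = 1 - 1 / p"
definition bb :: real where "bb = (p - 1 - q) / (p * (m - q))"
definition Cbar :: real where "Cbar = C_bar p q m"

lemma ba_bb: "0 < ba" "ba \<le> 1" "bb \<le> 0"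
  using params_pos pq by (auto simp: ba_def bb_def divide_le_0_iff)

lemma C_bar_pos: "Cbar > 0"
  using params_pos by (simp add: Cbar_def C_bar_def)

text \<open>The separated equation: along \<open>u' = - speed u\<close> the variable
  \<open>x\<close> moves at rate \<open>(m - q) * (1 - x) / s * speed s\<close>, and the Beta weight
  turns this into a constant. Existence and uniqueness both rest on it. Logarithms are compared, as
  all factors are positive.\<close>

lemma speed_identity:
  assumes x: "0 < x" "x < 1" and s: "s = A * (1 - x) powr (1 / (m - q))"
  shows "(m - q) * (1 - x) / s * speed s * (x powr (ba - 1) * (1 - x) powr (bb - 1)) = Cbar"
proof -
  have s0: "s > 0" using x A_pos s by simp
  have sA: "(s / A) powr (m - q) = 1 - x" using x A_pos params_pos by (simp add: s powr_powr)
  define c where "c = p / ((p - 1) * (q + 1))"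
  have c: "c > 0" using params_pos by (simp add: c_def)
  have Hs: "H s = c * s powr (q + 1) * x"
    using s0 by (simp add: H_eq sA c_def)
  have lnA: "ln A = (ln (m + 1) - ln (q + 1)) / (m - q)"
    using params_pos by (simp add: A_def ln_powr ln_div)
  have ln_s: "ln s = ln A + ln (1 - x) / (m - q)"
    using x A_pos by (simp add: s ln_mult ln_powr)
  have ln_c: "ln c = ln p - (ln (p - 1) + ln (q + 1))"
    using params_pos by (simp add: c_def ln_div ln_mult)
  have speed: "ln (speed s) = 1 / p * (ln c + (q + 1) * ln s + ln x)" "speed s > 0"
    using c s0 x by (simp_all add: speed_def Hs ln_mult ln_powr)
  define L where "L = (m - q) * (1 - x) / s * speed s * (x powr (ba - 1) * (1 - x) powr (bb - 1))"
  have L: "L > 0" using x s0 speed(2) params_pos by (simp add: L_def)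
  have "ln L = ln (m - q) + ln (1 - x) - ln s + ln (speed s) + ((ba - 1) * ln x + (bb - 1) * ln (1 - x))"
    unfolding L_def using x s0 speed(2) params_pos by (simp add: ln_mult ln_div ln_powr)
  \<comment> \<open>The coefficient of \<open>ln x\<close> is \<open>1 / p\<close> from the speed
    plus \<open>ba - 1\<close>, which is 0; that of \<open>ln (1 - x)\<close> cancels after
    inserting \<open>ln s\<close>.\<close>
  also have "\<dots> = ln (m - q) + ((q + 1) / p - 1) * ln s + bb * ln (1 - x) + 1 / p * ln c"
    unfolding speed(1) using params_pos by (simp add: ba_def field_simps)
  also have "\<dots> = ln (m - q) + ((q + 1) / p - 1) * ln A + 1 / p * ln c"
  proof -
    have "((q + 1) / p - 1) / (m - q) = - bb"
      using params_pos by (simp add: bb_def field_simps)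
    then have "((q + 1) / p - 1) * (ln (1 - x) / (m - q)) = - bb * ln (1 - x)"
      by (metis (no_types, lifting) times_divide_eq_left times_divide_eq_right)
    then show ?thesis unfolding ln_s by (simp add: distrib_left)
  qed
  also have "\<dots> = ln Cbar"
  proof -
    define e1 where "e1 = (1 + q - p) / (p * (m - q))"
    define e2 where "e2 = (p - m - 1) / (p * (m - q))"
    have "ln Cbar = 1 / p * (ln p - ln (p - 1)) + ln (m - q) + e1 * ln (m + 1) + e2 * ln (q + 1)"
      unfolding Cbar_def C_bar_def e1_def e2_def using params_pos by (simp add: ln_mult ln_div ln_powr)
    moreover have "((q + 1) / p - 1) * ln A = e1 * (ln (m + 1) - ln (q + 1))"
    proof -
      have "e1 = ((q + 1) / p - 1) / (m - q)"
        using params_pos by (simp add: e1_def field_simps)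
      then show ?thesis by (simp add: lnA)
    qed
    moreover have "e2 = - e1 - 1 / p"
    proof -
      have "1 / p = (m - q) / (p * (m - q))" using params_pos by simp
      then have "e2 + e1 + 1 / p = (p - m - 1 + (1 + q - p) + (m - q)) / (p * (m - q))"
        by (simp only: e1_def e2_def add_divide_distrib)
      then show ?thesis by simp
    qed
    ultimately show ?thesis unfolding ln_c by (simp add: algebra_simps)
  qed
  finally have "ln L = ln Cbar" .
  then show ?thesis using L C_bar_pos by (simp add: L_def)
qed

lemma u_closed_eq: "u_closed p q m r = A * (1 - inv_inc_Beta (Cbar * r) ba bb) powr (1 / (m - q))"
  by (simp add: u_closed_def A_def Cbar_def ba_def bb_def)

text \<open>The constant \<open>A\<close> also satisfies \<open>u' = - speed u\<close>, so this
  first-order equation alone does not determine \<open>u\<close>. Strict decrease puts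
  \<open>u\<close> below \<open>A\<close> for \<open>r > 0\<close>; there the equation can be
  separated, and continuity at 0 fixes the constant of integration.\<close>

lemma inc_Beta_sol:
  assumes sol: "pos_decr_solution p q m u" and "r \<ge> 0"
  shows "inc_Beta (1 - (u r / A) powr (m - q)) ba bb = Cbar * r"
proof (cases "r = 0")
  case True
  then show ?thesis using sol_0[OF sol] A_pos by (simp add: inc_Beta_0)
next
  case False
  then have r: "r > 0" using assms by simp
  define x where "x r = 1 - (u r / A) powr (m - q)" for r
  have x_range: "x r \<in> {0..<1}" if "r \<ge> 0" for r
    using powr_ratio_le_1[of "u r"] sol_pos[OF sol that] sol_le_A[OF sol that] A_pos by (simp add: x_def)
  have "inc_Beta (x r) ba bb - Cbar * r = inc_Beta (x 0) ba bb - Cbar * 0"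
  proof (rule DERIV_isconst2[of 0 r "\<lambda>r. inc_Beta (x r) ba bb - Cbar * r" r])
    have "continuous_on {0..} x"
    proof -
      have "u r \<noteq> 0" if "r \<ge> 0" for r using sol_pos[OF sol that] by simp
      then show ?thesis
        unfolding x_def using A_pos by (intro continuous_intros sol_continuous[OF sol]) auto
    qed
    then have "continuous_on {0..r} x" by (rule continuous_on_subset) auto
    then have "continuous_on {0..r} (\<lambda>r. inc_Beta (x r) ba bb)"
      by (rule continuous_on_compose2[OF inc_Beta_continuous[OF ba_bb(1)]]) (use x_range in force)
    then show "continuous_on {0..r} (\<lambda>r. inc_Beta (x r) ba bb - Cbar * r)"
      by (intro continuous_on_diff continuous_on_mult continuous_on_const continuous_on_id)
  next
    fix t assume t: "0 < t" "t < r"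
    have u: "0 < u t" "u t < A" using sol_pos[OF sol] sol_less_A[OF sol] t by auto
    have x1: "1 - x t = (u t / A) powr (m - q)" by (simp add: x_def)
    have xt: "0 < x t" "x t < 1" using powr_ratio_less_1[of "u t"] u A_pos by (auto simp: x_def)
    have "((\<lambda>r. (u r / A) powr (m - q)) has_real_derivative (m - q) * (u t / A) powr (m - q - 1) * (- speed (u t) / A)) (at t)"
      using sol_deriv[OF sol t(1)] u A_pos unfolding deriv_sol[OF sol t(1)]
      by (intro DERIV_chain2[where f = "\<lambda>x. x powr (m - q)"] has_real_derivative_powr DERIV_cdivide) auto
    then have "(x has_real_derivative - ((m - q) * (u t / A) powr (m - q - 1) * (- speed (u t) / A))) (at t)"
      unfolding x_def[abs_def] by (rule DERIV_cong[OF DERIV_diff[OF DERIV_const]]) simp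
    also have "- ((m - q) * (u t / A) powr (m - q - 1) * (- speed (u t) / A)) = (m - q) * (1 - x t) / u t * speed (u t)"
      using u A_pos unfolding x1 by (simp add: powr_diff)
    finally have "((\<lambda>r. inc_Beta (x r) ba bb) has_real_derivative
        (x t powr (ba - 1) * (1 - x t) powr (bb - 1)) * ((m - q) * (1 - x t) / u t * speed (u t))) (at t)"
      by (rule DERIV_chain2[where f = "\<lambda>x. inc_Beta x ba bb" and g = x, OF inc_Beta_deriv[OF ba_bb(1) xt]])
    also have "(x t powr (ba - 1) * (1 - x t) powr (bb - 1)) * ((m - q) * (1 - x t) / u t * speed (u t)) = Cbar"
    proof -
      have "u t = A * (1 - x t) powr (1 / (m - q))"
        unfolding x1 using u A_pos params_pos by (simp add: powr_powr)
      from speed_identity[OF xt this] show ?thesis by (simp add: mult_ac)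
    qed
    finally show "((\<lambda>r. inc_Beta (x r) ba bb - Cbar * r) has_real_derivative 0) (at t)"
      by (rule DERIV_cong[OF DERIV_diff[OF _ DERIV_cmult_Id]]) simp
  qed (use r in auto)
  then show ?thesis using sol_0[OF sol] A_pos by (simp add: x_def inc_Beta_0)
qed

lemma sol_eq_u_closed:
  assumes sol: "pos_decr_solution p q m u" and "r \<ge> 0"
  shows "u r = u_closed p q m r"
proof -
  define x where "x = 1 - (u r / A) powr (m - q)"
  have u: "0 < u r" "u r \<le> A" using sol_pos[OF sol] sol_le_A[OF sol] assms by auto
  have "x \<in> {0..<1}"
    using powr_ratio_le_1[of "u r"] u A_pos by (simp add: x_def)
  then have "inv_inc_Beta (Cbar * r) ba bb = x"
    unfolding inv_inc_Beta_def inc_Beta_sol[OF assms, symmetric] x_def[symmetric]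
    by (rule the_inv_into_f_f[OF inc_Beta_inj[OF ba_bb(1)]])
  then have "u_closed p q m r = A * ((u r / A) powr (m - q)) powr (1 / (m - q))"
    by (simp add: u_closed_eq x_def)
  then show ?thesis using u A_pos params_pos by (simp add: powr_powr)
qed

section \<open>Existence: the closed form solves the equation\<close>

definition profile :: "real \<Rightarrow> real" where "profile r = inv_inc_Beta (Cbar * r) ba bb"

lemma profile: assumes "r \<ge> 0" shows "0 \<le> profile r" "profile r < 1" "inc_Beta (profile r) ba bb = Cbar * r"
proof -
  obtain x where x: "0 \<le> x" "x < 1" "inc_Beta x ba bb = Cbar * r"
    using inc_Beta_surj[OF ba_bb, of "Cbar * r"] C_bar_pos assms by auto
  have "profile r = x"
    unfolding profile_def inv_inc_Beta_def x(3)[symmetric]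
    by (rule the_inv_into_f_f[OF inc_Beta_inj[OF ba_bb(1)]]) (use x in auto)
  with x show "0 \<le> profile r" "profile r < 1" "inc_Beta (profile r) ba bb = Cbar * r" by auto
qed

lemma profile_eqI: "0 \<le> x \<Longrightarrow> x < 1 \<Longrightarrow> profile (inc_Beta x ba bb / Cbar) = x"
  unfolding profile_def inv_inc_Beta_def using C_bar_pos
  by (simp add: the_inv_into_f_f[OF inc_Beta_inj[OF ba_bb(1)]])

lemma profile_0: "profile 0 = 0"
  using profile_eqI[of 0] by (simp add: inc_Beta_0)

lemma profile_strict_mono: assumes "0 \<le> r" "r < s" shows "profile r < profile s"
proof (rule ccontr)
  assume "\<not> ?thesis"
  then have "inc_Beta (profile s) ba bb \<le> inc_Beta (profile r) ba bb"
    using inc_Beta_strict_mono[OF ba_bb(1), of "profile s" "profile r" bb] profile[of r] profile[of s] assms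
    by (cases "profile s = profile r") auto
  then show False using profile(3)[of r] profile(3)[of s] assms C_bar_pos by simp
qed

lemma profile_pos: "r > 0 \<Longrightarrow> profile r > 0"
  using profile_strict_mono[of 0 r] by (simp add: profile_0)

lemma profile_deriv:
  assumes "r > 0"
  shows "(profile has_real_derivative Cbar / (profile r powr (ba - 1) * (1 - profile r) powr (bb - 1))) (at r)"
proof -
  define x where "x = profile r"
  have x: "0 < x" "x < 1" using profile[of r] profile_pos[OF assms] assms by (auto simp: x_def)
  define F where "F x = inc_Beta x ba bb / Cbar" for x
  have F_x: "F x = r" using profile(3)[of r] assms C_bar_pos by (simp add: F_def x_def)
  have F_deriv: "(F has_real_derivative z powr (ba - 1) * (1 - z) powr (bb - 1) / Cbar) (at z)" if "0 < z" "z < 1" for z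
    unfolding F_def[abs_def] by (intro DERIV_cdivide inc_Beta_deriv ba_bb that)
  define d where "d = min x (1 - x) / 2"
  have d: "d > 0" "d < x" "d < 1 - x" using x by (auto simp: d_def min_def)
  have "isCont profile (F x)"
  proof (rule isCont_inverse_function[where f = F and g = profile and x = x, OF d(1)])
    fix z assume "\<bar>z - x\<bar> \<le> d"
    then have z: "0 < z" "z < 1" using d by (auto simp: abs_le_iff)
    then show "profile (F z) = z" unfolding F_def by (intro profile_eqI) auto
    show "isCont F z" using DERIV_isCont[OF F_deriv[OF z]] .
  qed
  then have "isCont profile r" by (simp add: F_x)
  then have "(profile has_real_derivative inverse (x powr (ba - 1) * (1 - x) powr (bb - 1) / Cbar)) (at r)"
    using F_deriv[OF x] x C_bar_pos assms unfolding x_def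
    by (intro DERIV_inverse_function[where f = F and a = 0 and b = "r + 1"])
       (auto simp: F_def profile(3))
  then show ?thesis by (simp add: x_def)
qed

lemma profile_continuous: "continuous_on {0..} profile"
  unfolding continuous_on_eq_continuous_within
proof
  fix r :: real assume "r \<in> {0..}"
  then consider "r > 0" | "r = 0" by force
  then show "continuous (at r within {0..}) profile"
  proof cases
    case 1
    then show ?thesis using DERIV_isCont[OF profile_deriv[OF 1]] continuous_at_imp_continuous_at_within by blast
  next
    case 2
    \<comment> \<open>The value 0 lies at the end of \<open>[0, 1)\<close>, where the inverse
      function rule used in \<open>profile_deriv\<close> gives nothing; monotonicity replaces
      it.\<close>
    have "continuous (at 0 within {0..}) profile"
      unfolding continuous_within_eps_delta
    proof (intro allI impI)
      fix e :: real assume "e > 0"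
      define c where "c = min e (1/2)"
      have c: "0 < c" "c < 1" "c \<le> e" using \<open>e > 0\<close> by (auto simp: c_def)
      define d where "d = inc_Beta c ba bb / Cbar"
      have d: "d > 0"
        using inc_Beta_strict_mono[OF ba_bb(1), of 0 c bb] c C_bar_pos by (simp add: d_def inc_Beta_0)
      have "dist (profile y) (profile 0) < e" if "y \<in> {0..}" "dist y 0 < d" for y
      proof -
        have "profile y < profile d" using that by (intro profile_strict_mono) auto
        also have "profile d = c" unfolding d_def by (rule profile_eqI) (use c in auto)
        finally show ?thesis using profile(1)[of y] that c by (simp add: profile_0)
      qed
      with d show "\<exists>d>0. \<forall>y\<in>{0..}. dist y 0 < d \<longrightarrow> dist (profile y) (profile 0) < e" by blast
    qed
    with 2 show ?thesis by simp
  qed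
qed

lemma profile_lim: "(profile \<longlongrightarrow> 1) at_top"
proof (rule order_tendstoI)
  fix c :: real assume "c < 1"
  define c' where "c' = max c 0"
  have c': "0 \<le> c'" "c' < 1" "c \<le> c'" using \<open>c < 1\<close> by (auto simp: c'_def)
  define R where "R = inc_Beta c' ba bb / Cbar"
  have R: "R \<ge> 0"
    using inc_Beta_strict_mono[OF ba_bb(1), of 0 c' bb] c' C_bar_pos
    by (cases "c' = 0") (auto simp: R_def inc_Beta_0)
  have "profile R = c'" unfolding R_def by (rule profile_eqI) (use c' in auto)
  then have "c < profile r" if "r > R" for r using profile_strict_mono[OF R that] c' by simp
  then show "\<forall>\<^sub>F r in at_top. c < profile r" by (intro eventually_mono[OF eventually_gt_at_top[of R]])
next
  fix c :: real assume "1 < c"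
  then show "\<forall>\<^sub>F r in at_top. profile r < c"
    using profile(2) by (intro eventually_mono[OF eventually_ge_at_top[of 0]]) force
qed

lemma u_closed_profile: "u_closed p q m r = A * (1 - profile r) powr (1 / (m - q))"
  by (simp add: u_closed_eq profile_def)

lemma u_closed_bounds:
  assumes "r \<ge> 0" shows "0 < u_closed p q m r" "u_closed p q m r \<le> A"
  using profile[OF assms] A_pos params_pos powr_le1[of "1 / (m - q)" "1 - profile r"]
  by (auto simp: u_closed_profile)

lemma u_closed_deriv:
  assumes r: "r > 0"
  shows "(u_closed p q m has_real_derivative - speed (u_closed p q m r)) (at r)"
proof -
  define x where "x = profile r"
  have x: "0 < x" "x < 1" using profile[of r] profile_pos[OF r] r by (auto simp: x_def)
  define s where "s = u_closed p q m r"
  have s: "s = A * (1 - x) powr (1 / (m - q))" by (simp add: s_def u_closed_profile x_def)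
  have s0: "s > 0" using u_closed_bounds[of r] r by (simp add: s_def)
  define D where "D = Cbar / (x powr (ba - 1) * (1 - x) powr (bb - 1))"
  have D: "D = (m - q) * (1 - x) / s * speed s"
    unfolding D_def speed_identity[OF x s, symmetric] using x by simp
  have "((\<lambda>r. 1 - profile r) has_real_derivative - D) (at r)"
    by (rule DERIV_cong[OF DERIV_diff[OF DERIV_const profile_deriv[OF r]]]) (simp add: D_def x_def)
  then have "((\<lambda>r. A * (1 - profile r) powr (1 / (m - q))) has_real_derivative
      A * (1 / (m - q) * (1 - x) powr (1 / (m - q) - 1) * - D)) (at r)"
    using x unfolding x_def
    by (intro DERIV_cmult DERIV_chain2[where f = "\<lambda>x. x powr (1 / (m - q))"] has_real_derivative_powr) auto
  also have "A * (1 / (m - q) * (1 - x) powr (1 / (m - q) - 1) * - D) = - (s / ((m - q) * (1 - x)) * D)"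
    using x by (simp add: s powr_diff)
  also have "\<dots> = - speed s"
    using x s0 params_pos by (simp add: D)
  finally show ?thesis by (simp add: s_def u_closed_profile[abs_def])
qed

text \<open>Recovers the second-order equation from the first-order one: after the chain rule the
  powers of \<open>H u\<close> have exponents summing to 0.\<close>

lemma flux_deriv:
  assumes u: "0 < u r" "u r < A" and du: "(u has_real_derivative - speed (u r)) (at r)"
  shows "((\<lambda>r. H (u r) powr ((p - 1) / p)) has_real_derivative u r powr m - u r powr q) (at r)"
proof -
  define h where "h = H (u r)"
  have h: "h > 0" using H_pos[OF u] by (simp add: h_def)
  have "((\<lambda>r. H (u r)) has_real_derivative p / (p - 1) * (u r powr q - u r powr m) * - speed (u r)) (at r)"
    by (rule DERIV_chain2[OF has_derivative_H[OF u(1)] du])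
  then have "((\<lambda>r. H (u r) powr ((p - 1) / p)) has_real_derivative
      (p - 1) / p * h powr ((p - 1) / p - 1) * (p / (p - 1) * (u r powr q - u r powr m) * - speed (u r))) (at r)"
    using h unfolding h_def
    by (intro DERIV_chain2[where f = "\<lambda>x. x powr ((p - 1) / p)"] has_real_derivative_powr)
  also have "(p - 1) / p * h powr ((p - 1) / p - 1) * (p / (p - 1) * (u r powr q - u r powr m) * - speed (u r))
      = (h powr ((p - 1) / p - 1) * h powr (1 / p)) * (u r powr m - u r powr q)"
  proof -
    have "c * y * (d * (a - b) * - z) = (c * d) * ((y * z) * (b - a))" for a b c d y z :: real
      by (simp add: algebra_simps)
    moreover have "(p - 1) / p * (p / (p - 1)) = 1" using params_pos by simp
    ultimately show ?thesis by (simp only: speed_def h_def mult_1)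
  qed
  also have "h powr ((p - 1) / p - 1) * h powr (1 / p) = 1"
  proof -
    have "(p - 1) / p - 1 + 1 / p = 0" using params_pos by (simp add: field_simps)
    then show ?thesis using h by (simp flip: powr_add)
  qed
  finally show ?thesis by simp
qed

lemma u_closed_solution: "pos_decr_solution p q m (u_closed p q m)"
proof -
  define u where "u = u_closed p q m"
  note bounds = u_closed_bounds[folded u_def]
  have less: "u s < u r" if "0 \<le> r" "r < s" for r s
  proof -
    have "(1 - profile s) powr (1 / (m - q)) < (1 - profile r) powr (1 / (m - q))"
      using that profile[of s] profile_strict_mono[OF that] params_pos by (intro powr_less_mono2) auto
    then show ?thesis using A_pos by (simp add: u_def u_closed_profile)
  qed
  have u0: "u 0 = A" by (simp add: u_def u_closed_profile profile_0)
  have du: "(u has_real_derivative - speed (u r)) (at r)" if "r > 0" for r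
    unfolding u_def by (rule u_closed_deriv[OF that])
  have u_cont: "continuous_on {0..} u"
  proof -
    have "1 - profile r \<noteq> 0" if "r \<ge> 0" for r using profile(2)[OF that] by simp
    then show ?thesis
      unfolding u_def u_closed_profile by (intro continuous_intros profile_continuous) auto
  qed
  have ode: "\<exists>D. ((\<lambda>s. \<bar>deriv u s\<bar> powr (p - 2) * deriv u s) has_real_derivative D) (at r) \<and>
      D + u r powr m = u r powr q" if r: "r > 0" for r
  proof (intro exI conjI)
    have "0 < u r" "u r < A" using bounds[of r] less[of 0 r] u0 r by auto
    \<comment> \<open>Since \<open>u' < 0\<close> for \<open>r > 0\<close>, the flux of the equation
      is minus this power of \<open>H u\<close>.\<close>
    then have D: "((\<lambda>r. - (H (u r) powr ((p - 1) / p))) has_real_derivative u r powr q - u r powr m) (at r)"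
      using DERIV_minus[OF flux_deriv[OF _ _ du[OF r]]] by simp
    show "((\<lambda>s. \<bar>deriv u s\<bar> powr (p - 2) * deriv u s) has_real_derivative u r powr q - u r powr m) (at r)"
    proof (rule has_field_derivative_transform_within_open[OF D, of "{0<..}"])
      fix t :: real assume "t \<in> {0<..}"
      then have t: "t > 0" by simp
      have ut: "0 < u t" "u t < A" using bounds[of t] less[of 0 t] u0 t by auto
      have sp: "speed (u t) > 0" using speed_pos[OF ut] .
      have "deriv u t = - speed (u t)" using DERIV_imp_deriv[OF du[OF t]] .
      then have "\<bar>deriv u t\<bar> powr (p - 2) * deriv u t = - (speed (u t) powr (p - 2) * speed (u t) powr 1)"
        using sp by simp
      also have "\<dots> = - (speed (u t) powr (p - 1))" by (simp only: powr_add[symmetric]) simp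
      also have "\<dots> = - (H (u t) powr ((p - 1) / p))"
        by (simp add: speed_def powr_powr)
      finally show "- (H (u t) powr ((p - 1) / p)) = \<bar>deriv u t\<bar> powr (p - 2) * deriv u t" by simp
    qed (use r in auto)
  qed simp
  have "(u has_real_derivative 0) (at 0 within {0..})"
  proof -
    have "continuous_on {0..} (\<lambda>r. - speed (u r))"
      by (intro continuous_intros continuous_on_compose2[OF continuous_on_speed u_cont])
         (auto intro: bounds(2) less_imp_le[OF bounds(1)])
    then have "continuous (at 0 within {0..}) (\<lambda>r. - speed (u r))"
      by (simp add: continuous_on_eq_continuous_within)
    then have "((\<lambda>r. - speed (u r)) \<longlongrightarrow> 0) (at_right 0)"
      by (simp add: continuous_within at_within_Ici_at_right u0 speed_A)
    then show ?thesis by (intro has_derivative_at_endpoint[OF u_cont du]) auto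
  qed
  moreover have "(u \<longlongrightarrow> 0) at_top"
  proof -
    have "((\<lambda>r. A * (1 - profile r) powr (1 / (m - q))) \<longlongrightarrow> A * (1 - 1) powr (1 / (m - q))) at_top"
      using params_pos profile(2)
      by (intro tendsto_intros tendsto_powr' profile_lim disjI2 conjI)
         (auto intro!: eventually_mono[OF eventually_ge_at_top[of 0]] simp: less_imp_le)
    then show ?thesis using params_pos by (simp add: u_def u_closed_profile[abs_def])
  qed
  moreover have "strict_antimono_on {0..} u"
    using less by (auto simp: monotone_on_def)
  moreover have "\<forall>r>0. u differentiable at r"
    using du by (auto simp: real_differentiable_def)
  ultimately show ?thesis
    using bounds ode unfolding pos_decr_solution_def u_def[symmetric] by blast
qed

end

section \<open>Optimality of the constant\<close>

text \<open>For a nonnegative function the limits of a primitive give integrability together with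
  the value, so no decay of the solution has to be estimated.\<close>

lemma integral_even_FTC:
  fixes f F :: "real \<Rightarrow> real"
  assumes F: "\<And>r. r > 0 \<Longrightarrow> (F has_real_derivative f r) (at r)"
    and cont: "continuous_on {0..} f" and nonneg: "\<And>x. 0 \<le> f x" and even: "\<And>x. f (- x) = f x"
    and lim0: "(F \<longlongrightarrow> L0) (at_right 0)" and lim1: "(F \<longlongrightarrow> L1) at_top"
  shows "integrable lebesgue f" "(LINT x|lebesgue. f x) = 2 * (L1 - L0)"
proof -
  have isCont: "isCont f x" if "x > 0" for x
    using cont continuous_on_interior[of "{0..}" f x] that by simp
  have l0: "((F \<circ> real_of_ereal) \<longlongrightarrow> L0) (at_right 0)"
    using lim0 by (simp add: zero_ereal_def ereal_tendsto_simps)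
  have l1: "((F \<circ> real_of_ereal) \<longlongrightarrow> L1) (at_left \<infinity>)"
    using lim1 by (simp add: ereal_tendsto_simps)
  have int: "set_integrable lborel {0<..} f" "(LBINT x:{0<..}. f x) = L1 - L0"
    using interval_integral_FTC_nonneg[OF _ _ _ _ l0 l1, of f] F isCont nonneg
    by (auto simp: zero_ereal_def einterval_eq_Ici interval_integral_to_infinity_eq)
  then have "has_bochner_integral lborel (\<lambda>x. indicator {0<..} x *\<^sub>R f x) (L1 - L0)"
    by (simp add: set_integrable_def set_lebesgue_integral_def has_bochner_integral_iff)
  then have "has_bochner_integral lborel (\<lambda>x. indicator {0..} x *\<^sub>R f x) (L1 - L0)"
    by (rule has_bochner_integral_discrete_difference[where X = "{0}", THEN iffD1, rotated 4])
       (auto split: split_indicator)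
  then have *: "has_bochner_integral lborel f (2 * (L1 - L0))"
    using has_bochner_integral_even_function[of f "L1 - L0", OF _ even] by (simp only: real_scaleR_def)
  then have meas: "f \<in> borel_measurable lborel" by (rule borel_measurable_has_bochner_integral)
  show "integrable lebesgue f" "(LINT x|lebesgue. f x) = 2 * (L1 - L0)"
    using * meas by (simp_all add: integrable_completion integral_completion has_bochner_integral_iff)
qed

context GN_params
begin

section \<open>Integrals of the even extension of a solution\<close>

context
  fixes u :: "real \<Rightarrow> real"
  assumes sol: "pos_decr_solution p q m u"
begin

lemma ground_range: "0 < u \<bar>x\<bar>" "u \<bar>x\<bar> \<le> A"
  using sol_pos[OF sol] sol_le_A[OF sol] by auto

lemma ground_continuous: "continuous_on UNIV (\<lambda>x. u \<bar>x\<bar>)"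
  by (rule continuous_on_compose2[OF sol_continuous[OF sol]]) (auto intro!: continuous_intros)

lemma ground_AC_primitive: "AC_primitive (\<lambda>x. u \<bar>x\<bar>) (\<lambda>x. - sgn x * speed (u \<bar>x\<bar>))"
proof -
  let ?V = "\<lambda>x. - sgn x * speed (u \<bar>x\<bar>)"
  have deriv: "((\<lambda>x. u \<bar>x\<bar>) has_real_derivative ?V x) (at x)" if "x \<noteq> 0" for x
  proof -
    have "(u has_real_derivative - speed (u \<bar>x\<bar>)) (at \<bar>x\<bar>)"
      using sol_deriv[OF sol, of "\<bar>x\<bar>"] deriv_sol[OF sol, of "\<bar>x\<bar>"] that by simp
    moreover have "((\<lambda>x. \<bar>x\<bar>) has_real_derivative sgn x) (at x)"
    proof (cases "x > 0")
      case True
      show ?thesis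
        by (rule has_field_derivative_transform_within_open[OF _ open_greaterThan[of 0]])
           (use True in \<open>auto intro!: derivative_eq_intros\<close>)
    next
      case False
      show ?thesis
        by (rule has_field_derivative_transform_within_open[OF _ open_lessThan[of 0], where f = "\<lambda>x. - x"])
           (use False that in \<open>auto intro!: derivative_eq_intros\<close>)
    qed
    ultimately have "((\<lambda>x. u \<bar>x\<bar>) has_real_derivative - speed (u \<bar>x\<bar>) * sgn x) (at x)"
      by (rule DERIV_chain2)
    then show ?thesis by (simp add: mult.commute)
  qed
  have int: "(?V has_integral (u \<bar>b\<bar> - u \<bar>a\<bar>)) {a..b}" if "a \<le> b" for a b
    by (rule fundamental_theorem_of_calculus_interior_strong[OF _ that, of "{0}"])
       (use deriv in \<open>auto simp: has_real_derivative_iff_has_vector_derivative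
          intro: continuous_on_subset[OF ground_continuous]\<close>)
  have norm_int: "(\<lambda>x. speed (u \<bar>x\<bar>)) integrable_on {a..b}" for a b
    by (intro integrable_continuous_real continuous_on_compose2[OF continuous_on_speed]
        continuous_on_subset[OF ground_continuous])
       (auto intro: ground_range(2) less_imp_le[OF ground_range(1)])
  \<comment> \<open>At 0 both sides vanish: \<open>sgn 0 = 0\<close>, and \<open>u 0 = A\<close> is
    a zero of \<open>speed\<close>.\<close>
  have norm_eq: "norm (?V x) = speed (u \<bar>x\<bar>)" for x
    by (cases "x = 0") (auto simp: abs_mult speed_def sol_0[OF sol] H_A)
  have "?V absolutely_integrable_on {a..b}" for a b
  proof (cases "a \<le> b")
    case True
    show ?thesis
      by (rule absolutely_integrable_onI) (use int[OF True] norm_int norm_eq in auto)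
  qed (auto simp: set_integrable_def)
  then show ?thesis
    unfolding AC_primitive_def by (blast intro: integral_unique[OF int, symmetric])
qed

lemma ground_deriv:
  assumes "r > 0"
  shows "(u has_real_derivative - speed (u r)) (at r)" "0 < u r" "u r < A"
  using sol_deriv[OF sol assms] deriv_sol[OF sol assms] sol_pos[OF sol, of r] sol_less_A[OF sol assms] assms
  by auto

text \<open>The equality case of Hoelder: \<open>g\<close> and \<open>speed\<close> are
  complementary powers of \<open>H\<close>, and their product is \<open>H\<close>.\<close>

lemma ground_G_deriv:
  assumes r: "r > 0"
  shows "((\<lambda>r. G (u r)) has_real_derivative - H (u r)) (at r)"
proof -
  have "at (u r) within {0..} = at (u r)"
    using ground_deriv[OF r] by (intro at_within_interior) auto
  then have "(G has_real_derivative g (u r)) (at (u r))"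
    using G_deriv[of "u r"] ground_deriv[OF r] by simp
  then have "((\<lambda>r. G (u r)) has_real_derivative g (u r) * - speed (u r)) (at r)"
    using ground_deriv(1)[OF r] by (rule DERIV_chain2)
  also have "g (u r) * - speed (u r) = - H (u r)"
  proof -
    have h: "H (u r) > 0" using H_pos ground_deriv[OF r] by blast
    have "(p - 1) / p + 1 / p = 1" using params_pos by (simp add: field_simps)
    then have "H (u r) powr ((p - 1) / p) * H (u r) powr (1 / p) = H (u r)"
      using h by (simp flip: powr_add)
    then show ?thesis using h by (simp add: g_def speed_def)
  qed
  finally show ?thesis .
qed

text \<open>The equation multiplied by \<open>u\<close>. The function \<open>u * g u\<close>
  vanishes at 0 and at infinity, so integration says that the integral of \<open>u^(m+1)\<close> is
  that of \<open>u^(q+1)\<close> plus that of \<open>\<bar>u'\<bar>^p\<close>.\<close>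

lemma ground_flux_deriv:
  assumes r: "r > 0"
  shows "((\<lambda>r. u r * g (u r)) has_real_derivative u r powr (m + 1) - u r powr (q + 1) - H (u r)) (at r)"
proof -
  have g_eq: "g (u t) = H (u t) powr ((p - 1) / p)" if "t > 0" for t
    using H_pos[of "u t"] ground_deriv[OF that] by (simp add: g_def)
  have "((\<lambda>r. u r * H (u r) powr ((p - 1) / p)) has_real_derivative
      - speed (u r) * H (u r) powr ((p - 1) / p) + (u r powr m - u r powr q) * u r) (at r)"
    using ground_deriv[OF r] by (intro DERIV_mult flux_deriv)
  also have "speed (u r) * H (u r) powr ((p - 1) / p) = H (u r)"
  proof -
    have h: "H (u r) > 0" using H_pos ground_deriv[OF r] by blast
    have "1 / p + (p - 1) / p = 1" using params_pos by (simp add: field_simps)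
    then show ?thesis using h by (simp add: speed_def flip: powr_add)
  qed
  then have "- speed (u r) * H (u r) powr ((p - 1) / p) = - H (u r)" by simp
  also have "(u r powr m - u r powr q) * u r = u r powr (m + 1) - u r powr (q + 1)"
    using ground_deriv[OF r] by (simp add: powr_add algebra_simps)
  finally have "((\<lambda>r. u r * H (u r) powr ((p - 1) / p)) has_real_derivative
      u r powr (m + 1) - u r powr (q + 1) - H (u r)) (at r)" by (simp add: algebra_simps)
  then show ?thesis
    by (rule has_field_derivative_transform_within_open[of _ _ _ "{0<..}"]) (use r in \<open>auto simp: g_eq\<close>)
qed

lemma ground_limits:
  assumes "continuous_on {0..A} f"
  shows "((\<lambda>r. f (u r)) \<longlongrightarrow> f A) (at_right 0)" "((\<lambda>r. f (u r)) \<longlongrightarrow> f 0) at_top"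
proof -
  have "continuous_on {0..} (\<lambda>r. f (u r))"
    by (rule continuous_on_compose2[OF assms sol_continuous[OF sol]])
       (auto intro: sol_le_A[OF sol] less_imp_le[OF sol_pos[OF sol]])
  then have "continuous (at 0 within {0..}) (\<lambda>r. f (u r))"
    by (simp add: continuous_on_eq_continuous_within)
  then show "((\<lambda>r. f (u r)) \<longlongrightarrow> f A) (at_right 0)"
    by (simp add: continuous_within at_within_Ici_at_right sol_0[OF sol])
  have "(f \<longlongrightarrow> f 0) (at 0 within {0..A})"
    using assms A_pos by (auto simp: continuous_on)
  moreover have "filterlim u (at 0 within {0..A}) at_top"
    unfolding filterlim_at
  proof
    show "\<forall>\<^sub>F r in at_top. u r \<in> {0..A} \<and> u r \<noteq> 0"
      using eventually_gt_at_top[of 0] by eventually_elim (use ground_deriv in force)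
  qed (rule sol_lim[OF sol])
  ultimately show "((\<lambda>r. f (u r)) \<longlongrightarrow> f 0) at_top" by (rule filterlim_compose)
qed

text \<open>The definition of \<open>H\<close> and the derivative of \<open>u * g u\<close> are two
  linear relations for \<open>u^(q+1)\<close> and \<open>u^(m+1)\<close>. Solving them gives
  explicit primitives in terms of \<open>G u\<close> and \<open>u * g u\<close>, of which only
  \<open>G A\<close> survives at the limits.\<close>

lemma ground_integrals:
  shows "integrable lebesgue (\<lambda>x. H (u \<bar>x\<bar>))" "(LINT x|lebesgue. H (u \<bar>x\<bar>)) = T"
    and "integrable lebesgue (\<lambda>x. u \<bar>x\<bar> powr (q + 1))" "(LINT x|lebesgue. u \<bar>x\<bar> powr (q + 1)) = Q_ratio * T"
    and "integrable lebesgue (\<lambda>x. u \<bar>x\<bar> powr (m + 1))" "(LINT x|lebesgue. u \<bar>x\<bar> powr (m + 1)) = (1 + Q_ratio) * T"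
proof -
  have cont_G: "continuous_on {0..A} G" by (rule continuous_on_subset[OF continuous_on_G]) auto
  have cont_g: "continuous_on {0..A} g" by (rule continuous_on_subset[OF continuous_on_g]) auto
  have cont_u: "continuous_on {0..} (\<lambda>r. u \<bar>r\<bar>)" by (rule continuous_on_subset[OF ground_continuous]) auto
  have gA: "g A = 0" by (simp add: g_def H_A)
  have cont_pow: "continuous_on {0..} (\<lambda>r. u \<bar>r\<bar> powr s)" for s
  proof -
    have "u \<bar>r\<bar> \<noteq> 0" for r using ground_range(1)[of r] by simp
    then show ?thesis by (intro continuous_intros cont_u) blast
  qed
  have cont_H: "continuous_on {0..} (\<lambda>r. H (u \<bar>r\<bar>))"
    by (rule continuous_on_compose2[OF continuous_on_H cont_u]) (auto intro: less_imp_le[OF sol_pos[OF sol]])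
  have H0: "0 \<le> H (u \<bar>x\<bar>)" for x
    using H_nonneg less_imp_le[OF ground_range(1)] ground_range(2) by blast
  show "integrable lebesgue (\<lambda>x. H (u \<bar>x\<bar>))" "(LINT x|lebesgue. H (u \<bar>x\<bar>)) = T"
  proof -
    have D: "((\<lambda>r. - G (u r)) has_real_derivative H (u \<bar>r\<bar>)) (at r)" if "r > 0" for r
      using DERIV_minus[OF ground_G_deriv[OF that]] that by simp
    have L: "((\<lambda>r. - G (u r)) \<longlongrightarrow> - G A) (at_right 0)" "((\<lambda>r. - G (u r)) \<longlongrightarrow> - G 0) at_top"
      by (intro tendsto_minus ground_limits cont_G)+
    show "integrable lebesgue (\<lambda>x. H (u \<bar>x\<bar>))" "(LINT x|lebesgue. H (u \<bar>x\<bar>)) = T"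
      using integral_even_FTC[OF D cont_H H0 _ L] by (simp_all add: T_def G_0)
  qed
  define k where "k = (q + 1) / (m - q)"
  \<comment> \<open>\<open>k\<close> is the coefficient for which the powers \<open>m + 1\<close>
    cancel on the right-hand side.\<close>
  have Q_eq: "s powr (q + 1) = Q_ratio * H s + k * (s powr (m + 1) - s powr (q + 1) - H s)" for s
  proof -
    define a where "a = s powr (q + 1)"
    define b where "b = s powr (m + 1)"
    have "H s = p / (p - 1) * (a / (q + 1) - b / (m + 1))" by (simp add: H_def a_def b_def)
    moreover have "(Q_ratio - k) * (p / (p - 1)) = (q + 1) * (m + 1) / (m - q)"
    proof -
      have "Q_ratio - k = (q + 1) * ((p - 1) * (m + 1)) / (p * (m - q))"
      proof -
        have "k = (q + 1) * p / (p * (m - q))" using params_pos by (simp add: k_def)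
        then have "Q_ratio - k = ((q + 1) * \<eta>1 - (q + 1) * p) / (p * (m - q))"
          by (simp only: Q_ratio_def diff_divide_distrib)
        also have "(q + 1) * \<eta>1 - (q + 1) * p = (q + 1) * ((p - 1) * (m + 1))"
          by (simp add: \<eta>1_def algebra_simps)
        finally show ?thesis .
      qed
      then show ?thesis using params_pos by simp
    qed
    ultimately have "(Q_ratio - k) * H s = (q + 1) * (m + 1) / (m - q) * (a / (q + 1) - b / (m + 1))"
      by (simp only: mult.assoc[symmetric])
    also have "\<dots> = ((m + 1) * a - (q + 1) * b) / (m - q)"
    proof -
      have "(q + 1) * (m + 1) / (m - q) * (a / (q + 1)) = (m + 1) * a / (m - q)"
        "(q + 1) * (m + 1) / (m - q) * (b / (m + 1)) = (q + 1) * b / (m - q)"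
        using params_pos by simp_all
      then show ?thesis by (simp only: right_diff_distrib diff_divide_distrib)
    qed
    also have "\<dots> = a - k * (b - a)"
    proof -
      have "a = (m - q) * a / (m - q)" using params_pos by simp
      then have "a - k * (b - a) = ((m - q) * a - (q + 1) * (b - a)) / (m - q)"
        by (simp add: k_def diff_divide_distrib)
      also have "(m - q) * a - (q + 1) * (b - a) = (m + 1) * a - (q + 1) * b"
        by (simp add: algebra_simps)
      finally show ?thesis by simp
    qed
    finally show ?thesis by (simp add: a_def b_def algebra_simps)
  qed
  define F where "F s = - (Q_ratio * G s) + k * (s * g s)" for s
  have cont_F: "continuous_on {0..A} F"
    unfolding F_def by (intro continuous_intros cont_G cont_g)
  have D_F: "((\<lambda>r. F (u r)) has_real_derivative u r powr (q + 1)) (at r)" if "r > 0" for r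
  proof -
    have "((\<lambda>r. F (u r)) has_real_derivative - (Q_ratio * - H (u r)) +
        k * (u r powr (m + 1) - u r powr (q + 1) - H (u r))) (at r)"
      unfolding F_def by (intro DERIV_add DERIV_minus DERIV_cmult ground_G_deriv ground_flux_deriv that)
    then show ?thesis using Q_eq[of "u r"] by simp
  qed
  show "integrable lebesgue (\<lambda>x. u \<bar>x\<bar> powr (q + 1))" "(LINT x|lebesgue. u \<bar>x\<bar> powr (q + 1)) = Q_ratio * T"
  proof -
    have D: "((\<lambda>r. F (u r)) has_real_derivative u \<bar>r\<bar> powr (q + 1)) (at r)" if "r > 0" for r
      using D_F[OF that] that by simp
    show "integrable lebesgue (\<lambda>x. u \<bar>x\<bar> powr (q + 1))" "(LINT x|lebesgue. u \<bar>x\<bar> powr (q + 1)) = Q_ratio * T"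
      using integral_even_FTC[OF D cont_pow _ _ ground_limits[OF cont_F]] by (simp_all add: T_def F_def G_0 gA)
  qed
  define F' where "F' s = s * g s - G s + F s" for s
  have cont_F': "continuous_on {0..A} F'"
    unfolding F'_def by (intro continuous_intros cont_G cont_g cont_F)
  have D': "((\<lambda>r. F' (u r)) has_real_derivative u \<bar>r\<bar> powr (m + 1)) (at r)" if "r > 0" for r
  proof -
    have "((\<lambda>r. F' (u r)) has_real_derivative
        (u r powr (m + 1) - u r powr (q + 1) - H (u r)) - - H (u r) + u r powr (q + 1)) (at r)"
      unfolding F'_def by (intro DERIV_add DERIV_diff ground_G_deriv ground_flux_deriv D_F that)
    then show ?thesis using that by simp
  qed
  show "integrable lebesgue (\<lambda>x. u \<bar>x\<bar> powr (m + 1))" "(LINT x|lebesgue. u \<bar>x\<bar> powr (m + 1)) = (1 + Q_ratio) * T"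
    using integral_even_FTC[OF D' cont_pow _ _ ground_limits[OF cont_F']]
    by (simp_all add: T_def F'_def F_def G_0 gA algebra_simps)
qed

text \<open>Testing the inequality on the even extension of \<open>u\<close>: the closed constant
  gives equality there, and the positive product of norms is divided out.\<close>

lemma GN_constant_le:
  assumes C: "GN_inequality p q m C"
  shows "GN_constant_closed p q m \<le> C"
proof -
  let ?U = "\<lambda>x. u \<bar>x\<bar>" and ?V = "\<lambda>x. - sgn x * speed (u \<bar>x\<bar>)"
  have U_abs: "\<bar>?U x\<bar> = u \<bar>x\<bar>" for x using ground_range(1)[of x] by simp
  have V_pow: "\<bar>?V x\<bar> powr p = H (u \<bar>x\<bar>)" for x
  proof (cases "x = 0")
    case False
    have "0 \<le> H (u \<bar>x\<bar>)" using H_nonneg less_imp_le[OF ground_range(1)] ground_range(2) by blast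
    then show ?thesis using False params_pos by (simp add: abs_mult speed_def powr_powr)
  qed (simp add: sol_0[OF sol] H_A)
  have measU: "?U \<in> borel_measurable lebesgue"
    by (intro continuous_measurable_lebesgue ground_continuous)
  have measV: "?V \<in> borel_measurable lebesgue"
  proof -
    have "(\<lambda>x. speed (u \<bar>x\<bar>)) \<in> borel_measurable lebesgue"
      by (intro continuous_measurable_lebesgue continuous_on_compose2[OF continuous_on_speed ground_continuous])
         (auto intro: ground_range(2) less_imp_le[OF ground_range(1)])
    moreover have "(\<lambda>x::real. - sgn x) \<in> borel_measurable lebesgue"
      by (intro measurable_completion) (simp add: sgn_if)
    ultimately show ?thesis by (rule borel_measurable_times[rotated])
  qed
  have "Lp (q + 1) ?U" "Lp p ?V"
    unfolding Lp_def U_abs V_pow using measU measV ground_integrals by blast+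
  then have le: "Lp_norm (m + 1) ?U \<le>
      C * Lp_norm (q + 1) ?U powr (1 - GN_exponent p q m) * Lp_norm p ?V powr GN_exponent p q m"
    using C AC_primitive_weak_derivative[OF ground_AC_primitive] unfolding GN_inequality_def by blast
  define P where "P = T"
  define Q where "Q = Q_ratio * T"
  define R where "R = (1 + Q_ratio) * T"
  have pos: "P > 0" "Q > 0" "R > 0"
    using T_pos ratio_pos by (auto simp: P_def Q_def R_def add_pos_pos)
  define e where "e = 1 / (m + 1)"
  have "R powr e \<le> C * Q powr ((1 + \<gamma>) * e) * P powr (\<beta> * e)"
    using le unfolding Lp_norm_powr_exponents U_abs V_pow ground_integrals
    by (simp add: Lp_norm_def U_abs ground_integrals P_def Q_def R_def e_def)
  moreover have "R powr e = GN_constant_closed p q m * (Q powr ((1 + \<gamma>) * e) * P powr (\<beta> * e))"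
  proof -
    have "1 + Q_ratio = (p * (m - q) + (q + 1) * \<eta>1) / (p * (m - q))"
      using params_pos by (simp add: Q_ratio_def add_divide_distrib)
    also have "p * (m - q) + (q + 1) * \<eta>1 = (m + 1) * \<eta>2"
      by (simp add: \<eta>1_def \<eta>2_def algebra_simps)
    finally have "1 + Q_ratio = (m + 1) * \<eta>2 / (p * (m - q))" .
    \<comment> \<open>The equality case of the weighted mean inequality: it says
      \<open>R_ratio * R = Q_ratio * T\<close>, so the two terms averaged in
      \<open>GN_normalized\<close> coincide.\<close>
    then have "(1 + Q_ratio) * R_ratio = Q_ratio"
      using params_pos eta_pos by (simp add: R_ratio_def Q_ratio_def)
    moreover have "R * X powr \<beta> = T * T powr (p * \<beta>) * (((1 + Q_ratio) * R_ratio) * Q_ratio powr \<gamma>)"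
      by (simp add: X_powr_beta R_def mult_ac)
    ultimately have "R * X powr \<beta> = T * T powr (p * \<beta>) * (Q_ratio * Q_ratio powr \<gamma>)" by simp
    also have "T * T powr (p * \<beta>) = T powr (1 + \<gamma>) * T powr \<beta>"
    proof -
      have "T * T powr (p * \<beta>) = T powr (1 + p * \<beta>)" using T_pos by (simp add: powr_add)
      also have "1 + p * \<beta> = (1 + \<gamma>) + \<beta>" by (simp add: \<gamma>_def algebra_simps)
      finally show ?thesis by (simp add: powr_add)
    qed
    also have "Q_ratio * Q_ratio powr \<gamma> = Q_ratio powr (1 + \<gamma>)" using ratio_pos by (simp add: powr_add)
    finally have "R * X powr \<beta> = Q powr (1 + \<gamma>) * P powr \<beta>"
      by (simp add: Q_def P_def powr_mult)
    then have "R = X powr (- \<beta>) * (Q powr (1 + \<gamma>) * P powr \<beta>)"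
      using X_pos by (simp add: powr_minus field_simps)
    then have "R powr e = (X powr (- \<beta>) * (Q powr (1 + \<gamma>) * P powr \<beta>)) powr e" by simp
    also have "\<dots> = X powr (- \<beta> * e) * (Q powr ((1 + \<gamma>) * e) * P powr (\<beta> * e))"
      by (simp only: powr_mult powr_powr)
    finally show ?thesis by (simp add: GN_constant_closed_eq e_def)
  qed
  ultimately have "GN_constant_closed p q m * (Q powr ((1 + \<gamma>) * e) * P powr (\<beta> * e)) \<le>
      C * (Q powr ((1 + \<gamma>) * e) * P powr (\<beta> * e))" by (simp add: mult.assoc)
  moreover have "Q powr ((1 + \<gamma>) * e) * P powr (\<beta> * e) > 0" using pos by simp
  ultimately show ?thesis by (rule mult_right_le_imp_le)
qed

end

lemma is_GN_best_constant_closed: "is_GN_best_constant p q m (GN_constant_closed p q m)"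
  unfolding is_GN_best_constant_def
  using GN_inequality_closed GN_constant_le[OF u_closed_solution] by blast

end

section \<open>Decay uniform in \<open>m\<close>\<close>

text \<open>For \<open>t \<le> 1/2\<close> and \<open>b \<ge> -1\<close> the factor
  \<open>(1 - t) powr (b - 1)\<close> is at most \<open>2^2 = 4\<close>; the other factor integrates
  to at most \<open>1 / a\<close>. The bound is independent of \<open>b\<close>, and so of
  \<open>m\<close>.\<close>

lemma inc_Beta_le:
  assumes a: "a > 0" and b: "b \<le> 1" "-1 \<le> b" and x: "0 \<le> x" "x \<le> 1/2"
  shows "inc_Beta x a b \<le> 4 / a"
proof -
  have "((\<lambda>t. t powr (a - 1)) has_integral x powr a / a) {0..x}"
    using has_integral_powr_from_0[of "a - 1" x] a x by simp
  then have int: "((\<lambda>t. t powr (a - 1) * 4) has_integral x powr a / a * 4) {0..x}"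
    by (rule has_integral_mult_left)
  have "inc_Beta x a b \<le> integral {0..x} (\<lambda>t. t powr (a - 1) * 4)"
    unfolding inc_Beta_def
  proof (rule integral_le)
    show "(\<lambda>t. t powr (a - 1) * (1 - t) powr (b - 1)) integrable_on {0..x}"
      by (rule inc_Beta_integrable[OF a]) (use x in auto)
    show "(\<lambda>t. t powr (a - 1) * 4) integrable_on {0..x}" using int by blast
    fix t assume t: "t \<in> {0..x}"
    have "(1 - t) powr (b - 1) \<le> (1/2) powr (b - 1)"
      using t x b by (intro powr_mono2') auto
    also have "\<dots> \<le> (1/2) powr (- 2)" using b by (intro powr_mono') auto
    also have "(1/2) powr (- 2) = (4::real)" by (simp add: powr_minus powr_numeral power2_eq_square)
    finally show "t powr (a - 1) * (1 - t) powr (b - 1) \<le> t powr (a - 1) * 4"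
      by (intro mult_left_mono) auto
  qed
  also have "\<dots> = 4 * x powr a / a" using integral_unique[OF int] by simp
  also have "\<dots> \<le> 4 / a"
    using a x powr_le1[of a x] by (simp add: divide_right_mono)
  finally show ?thesis .
qed

text \<open>The coefficient of \<open>s powr ((q + 1) / p)\<close> in \<open>speed s\<close>;
  \<open>tail_rate\<close> is its reduced value when the last factor of \<open>H\<close> is 1/2.
  Neither contains \<open>m\<close>.\<close>

definition speed_coeff :: "real \<Rightarrow> real \<Rightarrow> real" where
  "speed_coeff p q = (p / ((p - 1) * (q + 1))) powr (1 / p)"

definition tail_rate :: "real \<Rightarrow> real \<Rightarrow> real" where
  "tail_rate p q = speed_coeff p q * (1/2) powr (1 / p)"

text \<open>The first summand bounds the time at which \<open>x\<close> reaches 1/2, the 1 makes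
  this bound strict, and the last summand absorbs \<open>ln A\<close> in the exponential
  case.\<close>

definition tail_start :: "real \<Rightarrow> real \<Rightarrow> real" where
  "tail_start p q = 4 * p / ((p - 1) * (q + 1) * speed_coeff p q) + 1 + 2 / (tail_rate p q * (q + 1))"

context GN_params
begin

lemma speed_coeff_pos: "speed_coeff p q > 0" "tail_rate p q > 0"
  using params_pos by (auto simp: speed_coeff_def tail_rate_def)

lemma tail_start_bounds:
  "4 * p / ((p - 1) * (q + 1) * speed_coeff p q) < tail_start p q"
  "2 / (tail_rate p q * (q + 1)) \<le> tail_start p q" "1 \<le> tail_start p q"
proof -
  have "0 < 4 * p / ((p - 1) * (q + 1) * speed_coeff p q)" "0 < 2 / (tail_rate p q * (q + 1))"
    using params_pos speed_coeff_pos by simp_all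
  then show "4 * p / ((p - 1) * (q + 1) * speed_coeff p q) < tail_start p q"
    "2 / (tail_rate p q * (q + 1)) \<le> tail_start p q" "1 \<le> tail_start p q"
    unfolding tail_start_def by linarith+
qed

lemma A_ge_1: "1 \<le> A"
  using params_pos qm unfolding A_def by (intro ge_one_powr_ge_zero) auto

lemma ln_A_le: "ln A \<le> 1 / (q + 1)"
proof -
  have "(m + 1) / (q + 1) = 1 + (m - q) / (q + 1)" using params_pos by (simp add: divide_simps)
  then have "ln ((m + 1) / (q + 1)) \<le> (m - q) / (q + 1)"
    using params_pos ln_add_one_self_le_self[of "(m - q) / (q + 1)"] by simp
  then have "ln ((m + 1) / (q + 1)) / (m - q) \<le> (m - q) / (q + 1) / (m - q)"
    using params_pos by (intro divide_right_mono) auto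
  then show ?thesis using params_pos by (simp add: A_def ln_powr)
qed

text \<open>In this form \<open>m\<close> enters only through \<open>m - q\<close> and a nonnegative
  power of \<open>A \<ge> 1\<close>, so a lower bound uniform in \<open>m\<close> is
  visible.\<close>

lemma C_bar_eq: "Cbar = (m - q) * speed_coeff p q * A powr ((q + 1 - p) / p)"
proof -
  define e where "e = (q + 1 - p) / (p * (m - q))"
  have "1 / p = (m - q) / (p * (m - q))" using params_pos by simp
  then have e: "(p - m - 1) / (p * (m - q)) = - (1 / p) + - e"
    by (simp only: e_def minus_divide_left add_divide_distrib[symmetric]) (simp add: algebra_simps)
  have A: "A powr ((q + 1 - p) / p) = (m + 1) powr e * (q + 1) powr (- e)"
  proof -
    have "A powr ((q + 1 - p) / p) = ((m + 1) / (q + 1)) powr e"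
      by (simp add: A_def powr_powr e_def mult.commute)
    then show ?thesis using params_pos by (simp add: powr_divide powr_minus_divide)
  qed
  have "p / ((p - 1) * (q + 1)) = p / (p - 1) * (1 / (q + 1))" by simp
  then have "speed_coeff p q = (p / (p - 1)) powr (1 / p) * (q + 1) powr (- (1 / p))"
    using params_pos unfolding speed_coeff_def
    by (simp only: powr_mult) (simp add: powr_divide powr_minus_divide)
  then show ?thesis
    unfolding A Cbar_def C_bar_def e powr_add by (simp add: e_def add.commute)
qed

lemma C_bar_ge:
  assumes "m > 2 * q + 1" shows "(q + 1) * speed_coeff p q \<le> Cbar"
proof -
  have "1 \<le> A powr ((q + 1 - p) / p)"
    using A_ge_1 pq params_pos by (intro ge_one_powr_ge_zero) auto
  then have "(q + 1) * speed_coeff p q * 1 \<le> (m - q) * speed_coeff p q * A powr ((q + 1 - p) / p)"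
    using assms speed_coeff_pos params_pos by (intro mult_mono) auto
  then show ?thesis by (simp add: C_bar_eq)
qed

lemma speed_eq:
  assumes "0 < s" "s \<le> A"
  shows "speed s = speed_coeff p q * s powr ((q + 1) / p) * (1 - (s / A) powr (m - q)) powr (1 / p)"
proof -
  define c where "c = p / ((p - 1) * (q + 1))"
  have "H s = c * s powr (q + 1) * (1 - (s / A) powr (m - q))"
    using assms by (simp add: H_eq c_def)
  then show ?thesis
    unfolding speed_def speed_coeff_def c_def[symmetric] by (simp add: powr_mult powr_powr)
qed

section \<open>Tail estimates for one solution\<close>

context
  fixes u :: "real \<Rightarrow> real"
  assumes sol: "pos_decr_solution p q m u" and large: "m > 2 * q + 1"
begin

text \<open>While \<open>x < 1/2\<close>, \<open>inc_Beta_le\<close> bounds \<open>Cbar * r\<close>,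
  and the lower bound for \<open>Cbar\<close> then bounds \<open>r\<close>.\<close>

lemma tail_half: assumes "r \<ge> tail_start p q" shows "1/2 \<le> 1 - (u r / A) powr (m - q)"
proof (rule ccontr)
  define x where "x = 1 - (u r / A) powr (m - q)"
  assume "\<not> 1/2 \<le> 1 - (u r / A) powr (m - q)"
  then have "x < 1/2" by (simp add: x_def)
  have r: "r > 0" using assms tail_start_bounds(3) by simp
  have "x \<ge> 0"
    using powr_ratio_le_1[of "u r"] sol_pos[OF sol, of r] sol_le_A[OF sol, of r] r by (simp add: x_def)
  have "- bb \<le> 1"
  proof -
    have "q + 1 - p \<le> 1 * (m - q)" using params_pos large by simp
    also have "\<dots> \<le> p * (m - q)" using params_pos p by (intro mult_right_mono) auto
    finally have "(q + 1 - p) / (p * (m - q)) \<le> 1" using params_pos by simp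
    moreover have "(q + 1 - p) / (p * (m - q)) = - bb" unfolding bb_def minus_divide_left by simp
    ultimately show ?thesis by simp
  qed
  then have "inc_Beta x ba bb \<le> 4 / ba"
    using ba_bb \<open>x \<ge> 0\<close> \<open>x < 1/2\<close> by (intro inc_Beta_le) auto
  then have "Cbar * r \<le> 4 * p / (p - 1)"
    using inc_Beta_sol[OF sol, of r] r params_pos by (simp add: x_def ba_def field_simps)
  moreover have "(q + 1) * speed_coeff p q * r \<le> Cbar * r"
    using C_bar_ge[OF large] r by (intro mult_right_mono) auto
  ultimately have "(q + 1) * speed_coeff p q * r \<le> 4 * p / (p - 1)" by linarith
  then have "r \<le> 4 * p / (p - 1) / ((q + 1) * speed_coeff p q)"
    using params_pos speed_coeff_pos by (subst pos_le_divide_eq) (auto simp: mult.commute)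
  also have "\<dots> = 4 * p / ((p - 1) * (q + 1) * speed_coeff p q)" by (simp add: mult_ac)
  finally show False using assms tail_start_bounds(1) by simp
qed

lemma tail_speed:
  assumes "r \<ge> tail_start p q"
  shows "tail_rate p q * u r powr ((q + 1) / p) \<le> speed (u r)"
    and "speed (u r) \<le> speed_coeff p q * u r powr ((q + 1) / p)"
proof -
  define x where "x = 1 - (u r / A) powr (m - q)"
  have r: "r > 0" using assms tail_start_bounds(3) by simp
  have u: "0 < u r" "u r \<le> A" using sol_pos[OF sol, of r] sol_le_A[OF sol, of r] r by auto
  have x: "1/2 \<le> x" "x \<le> 1" using tail_half[OF assms] by (auto simp: x_def)
  have eq: "speed (u r) = speed_coeff p q * u r powr ((q + 1) / p) * x powr (1 / p)"
    unfolding x_def by (rule speed_eq[OF u])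
  have "(1/2) powr (1 / p) \<le> x powr (1 / p)" using x params_pos by (intro powr_mono2) auto
  then have "speed_coeff p q * u r powr ((q + 1) / p) * (1/2) powr (1 / p) \<le> speed (u r)"
    unfolding eq using speed_coeff_pos by (intro mult_left_mono) auto
  then show "tail_rate p q * u r powr ((q + 1) / p) \<le> speed (u r)" by (simp add: tail_rate_def mult_ac)
  have "x powr (1 / p) \<le> 1" using x params_pos by (intro powr_le1) auto
  then have "speed_coeff p q * u r powr ((q + 1) / p) * x powr (1 / p) \<le> speed_coeff p q * u r powr ((q + 1) / p) * 1"
    using speed_coeff_pos by (intro mult_left_mono) auto
  then show "speed (u r) \<le> speed_coeff p q * u r powr ((q + 1) / p)" by (simp add: eq)
qed

lemma tail_polynomial:
  assumes \<sigma>: "\<sigma> = (q + 1 - p) / p" "q > p - 1" and c: "c = \<sigma> * tail_rate p q / 2" and r: "r \<ge> 2 * tail_start p q"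
  shows "u r + r * \<bar>deriv u r\<bar> \<le> (1 + speed_coeff p q / c) * c powr (- (1 / \<sigma>)) * r powr (- (p / (q + 1 - p)))"
proof -
  define r1 where "r1 = tail_start p q"
  have r1: "1 \<le> r1" "2 * r1 \<le> r" using tail_start_bounds(3) r by (auto simp: r1_def)
  have \<sigma>0: "\<sigma> > 0" using \<sigma> params_pos by simp
  have c0: "c > 0" using \<sigma>0 speed_coeff_pos by (simp add: c)
  have exp_eq: "(q + 1) / p = \<sigma> + 1" using params_pos by (simp add: \<sigma>(1) divide_simps)
  \<comment> \<open>Since \<open>u' \<le> - tail_rate * u^(\<sigma>+1)\<close> on the tail,
    \<open>u^(-\<sigma>)\<close> grows at least linearly. Doubling the starting radius gives
    \<open>r - r1 \<ge> r / 2\<close>, hence the 2 in \<open>c\<close>.\<close>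
  define y where "y t = u t powr (- \<sigma>) - \<sigma> * tail_rate p q * t" for t
  have "y r1 \<le> y r"
  proof (rule DERIV_nonneg_imp_nondecreasing[where f = y])
    fix t assume t: "r1 \<le> t" "t \<le> r"
    have t0: "t > 0" using t r1 by simp
    have u: "u t > 0" using sol_pos[OF sol, of t] t0 by simp
    have "(u has_real_derivative - speed (u t)) (at t)"
      using sol_deriv[OF sol t0] by (simp add: deriv_sol[OF sol t0])
    then have "((\<lambda>t. u t powr (- \<sigma>)) has_real_derivative - \<sigma> * u t powr (- \<sigma> - 1) * - speed (u t)) (at t)"
      using u by (intro DERIV_chain2[where f = "\<lambda>x. x powr (- \<sigma>)"] has_real_derivative_powr)
    then have "(y has_real_derivative - \<sigma> * u t powr (- \<sigma> - 1) * - speed (u t) - \<sigma> * tail_rate p q) (at t)"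
      unfolding y_def[abs_def] by (rule DERIV_diff[OF _ DERIV_cmult_Id])
    moreover have "0 \<le> - \<sigma> * u t powr (- \<sigma> - 1) * - speed (u t) - \<sigma> * tail_rate p q"
    proof -
      have "\<sigma> * u t powr (- \<sigma> - 1) * (tail_rate p q * u t powr (\<sigma> + 1)) \<le> \<sigma> * u t powr (- \<sigma> - 1) * speed (u t)"
        using tail_speed(1)[of t] t \<sigma>0 unfolding exp_eq r1_def by (intro mult_left_mono) auto
      moreover have "u t powr (- \<sigma> - 1) * u t powr (\<sigma> + 1) = 1" using u by (simp flip: powr_add)
      then have "\<sigma> * u t powr (- \<sigma> - 1) * (tail_rate p q * u t powr (\<sigma> + 1)) = \<sigma> * tail_rate p q"
        by (simp add: mult_ac)
      ultimately show ?thesis by simp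
    qed
    ultimately show "\<exists>d. (y has_real_derivative d) (at t) \<and> 0 \<le> d" by blast
  qed (use r1 in auto)
  moreover have "0 \<le> u r1 powr (- \<sigma>)" by simp
  ultimately have "\<sigma> * tail_rate p q * (r - r1) \<le> u r powr (- \<sigma>)"
    unfolding y_def right_diff_distrib by linarith
  moreover have "c * r \<le> \<sigma> * tail_rate p q * (r - r1)"
  proof -
    have "\<sigma> * tail_rate p q * (r / 2) \<le> \<sigma> * tail_rate p q * (r - r1)"
      using r1 \<sigma>0 speed_coeff_pos by (intro mult_left_mono) auto
    then show ?thesis by (simp add: c)
  qed
  ultimately have cr: "c * r \<le> u r powr (- \<sigma>)" by simp
  have r0: "r > 0" using r1 by simp
  have u: "u r > 0" using sol_pos[OF sol, of r] r0 by simp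
  have cr0: "c * r > 0" using c0 r0 by simp
  have "u r = (u r powr (- \<sigma>)) powr (- (1 / \<sigma>))" using u \<sigma>0 by (simp add: powr_powr)
  also have "\<dots> \<le> (c * r) powr (- (1 / \<sigma>))" using cr cr0 \<sigma>0 by (intro powr_mono2') auto
  also have "\<dots> = c powr (- (1 / \<sigma>)) * r powr (- (p / (q + 1 - p)))"
    using c0 r0 by (simp add: powr_mult \<sigma>(1))
  finally have u_le: "u r \<le> c powr (- (1 / \<sigma>)) * r powr (- (p / (q + 1 - p)))" .
  have "r * \<bar>deriv u r\<bar> = r * speed (u r)"
    by (simp add: deriv_sol[OF sol r0] speed_def)
  also have "\<dots> \<le> r * (speed_coeff p q * u r powr (\<sigma> + 1))"
    using tail_speed(2)[of r] r1 r0 unfolding exp_eq r1_def by (intro mult_left_mono) auto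
  \<comment> \<open>One factor \<open>u\<close> is split off, because the growth of
    \<open>u^(-\<sigma>)\<close> bounds \<open>r * u^\<sigma>\<close> by
    \<open>1 / c\<close>.\<close>
  also have "\<dots> = speed_coeff p q * u r * (r * u r powr \<sigma>)" using u by (simp add: powr_add mult_ac)
  also have "\<dots> \<le> speed_coeff p q * u r * (1 / c)"
  proof (rule mult_left_mono)
    have "c * r * u r powr \<sigma> \<le> u r powr (- \<sigma>) * u r powr \<sigma>" using cr by (intro mult_right_mono) auto
    also have "\<dots> = 1" using u by (simp flip: powr_add)
    finally show "r * u r powr \<sigma> \<le> 1 / c" using c0 by (simp add: field_simps)
  qed (use speed_coeff_pos u in auto)
  finally have "u r + r * \<bar>deriv u r\<bar> \<le> (1 + speed_coeff p q / c) * u r" by (simp add: algebra_simps)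
  also have "\<dots> \<le> (1 + speed_coeff p q / c) * (c powr (- (1 / \<sigma>)) * r powr (- (p / (q + 1 - p))))"
    using u_le speed_coeff_pos c0 by (intro mult_left_mono) auto
  finally show ?thesis by (simp add: mult.assoc)
qed

lemma tail_exponential:
  assumes "q = p - 1" and r: "r \<ge> 2 * tail_start p q"
  shows "u r \<le> exp (- (tail_rate p q / 4 * r))"
proof -
  define r1 where "r1 = tail_start p q"
  have r1: "1 \<le> r1" "2 * r1 \<le> r" using tail_start_bounds(3) r by (auto simp: r1_def)
  define k where "k = tail_rate p q"
  have k: "k > 0" using speed_coeff_pos by (simp add: k_def)
  have u_pos: "u t > 0" if "t \<ge> 0" for t using sol_pos[OF sol that] .
  define y where "y t = ln (u t) - - k * t" for t
  have "y r \<le> y r1"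
  proof (rule DERIV_nonpos_imp_nonincreasing[where f = y])
    fix t assume t: "r1 \<le> t" "t \<le> r"
    have t0: "t > 0" using t r1 by simp
    have u: "u t > 0" using u_pos[of t] t0 by simp
    have "(u has_real_derivative - speed (u t)) (at t)"
      using sol_deriv[OF sol t0] by (simp add: deriv_sol[OF sol t0])
    then have "((\<lambda>t. ln (u t)) has_real_derivative 1 / u t * - speed (u t)) (at t)"
      using u by (intro DERIV_chain2[where f = ln] DERIV_ln_divide)
    then have "(y has_real_derivative 1 / u t * - speed (u t) - - k) (at t)"
      unfolding y_def[abs_def] by (rule DERIV_diff[OF _ DERIV_cmult_Id])
    moreover have "k * u t \<le> speed (u t)"
      using tail_speed(1)[of t] t u params_pos assms(1) by (simp add: k_def r1_def)
    then have "1 / u t * - speed (u t) - - k \<le> 0" using u by (simp add: field_simps)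
    ultimately show "\<exists>d. (y has_real_derivative d) (at t) \<and> d \<le> 0" by blast
  qed (use r1 in auto)
  then have "ln (u r) \<le> ln (u r1) - k * (r - r1)" by (simp add: y_def algebra_simps)
  also have "ln (u r1) \<le> ln A" using sol_le_A[OF sol, of r1] u_pos[of r1] r1 A_pos by simp
  also have "\<dots> \<le> 1 / (q + 1)" by (rule ln_A_le)
  also have "\<dots> \<le> k * r1 / 2"
  proof -
    have "2 / (k * (q + 1)) \<le> r1" using tail_start_bounds(2) by (simp add: k_def r1_def)
    then have "2 \<le> r1 * (k * (q + 1))"
      using k params_pos by (subst (asm) pos_divide_le_eq) auto
    then show ?thesis using params_pos by (simp add: pos_divide_le_eq algebra_simps)
  qed
  \<comment> \<open>The claim has no prefactor, so \<open>ln A\<close> costs part of the rate: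
    \<open>k * r1 / 2 + k * r1 \<le> 3/4 * k * r\<close> leaves \<open>k / 4\<close>.\<close>
  also have "k * r1 / 2 - k * (r - r1) \<le> - (k / 4 * r)"
  proof -
    have "k * (r1 * 2) \<le> k * r" using r1 k by (intro mult_left_mono) auto
    then show ?thesis by (simp add: algebra_simps)
  qed
  finally have "exp (ln (u r)) \<le> exp (- (k / 4 * r))" by simp
  then show ?thesis using u_pos[of r] r1 by (simp add: k_def)
qed

end

end

theorem theorem7p1:
  fixes p q :: real
  assumes "p > 1" and "p - 1 \<le> q"
  shows "(\<forall>m>q.
            (\<exists>u. pos_decr_solution p q m u) \<and>
            (\<forall>u. pos_decr_solution p q m u \<longrightarrow> (\<forall>r\<ge>0. u r = u_closed p q m r)) \<and>
            is_GN_best_constant p q m (GN_constant_closed p q m))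
       \<and> (\<exists>r_star>0. \<exists>C>0. \<forall>m>2 * q + 1. \<forall>u. pos_decr_solution p q m u \<longrightarrow>
            (q > p - 1 \<longrightarrow>
               (\<forall>r\<ge>2 * r_star. u r + r * \<bar>deriv u r\<bar> \<le> C * r powr (- (p / (q + 1 - p))))) \<and>
            (q = p - 1 \<longrightarrow> (\<forall>r\<ge>2 * r_star. u r \<le> exp (- (C * r)))))"
proof (intro conjI)
  have params: "GN_params p q m" if "m > q" for m
    using assms that by unfold_locales
  show "\<forall>m>q. (\<exists>u. pos_decr_solution p q m u) \<and>
      (\<forall>u. pos_decr_solution p q m u \<longrightarrow> (\<forall>r\<ge>0. u r = u_closed p q m r)) \<and>
      is_GN_best_constant p q m (GN_constant_closed p q m)"
    using GN_params.u_closed_solution[OF params] GN_params.sol_eq_u_closed[OF params]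
      GN_params.is_GN_best_constant_closed[OF params] by blast
  define \<sigma> where "\<sigma> = (q + 1 - p) / p"
  define c where "c = \<sigma> * tail_rate p q / 2"
  define C where "C = (if q = p - 1 then tail_rate p q / 4
      else (1 + speed_coeff p q / c) * c powr (- (1 / \<sigma>)))"
  \<comment> \<open>These constants contain no \<open>m\<close>; their positivity is read off at the
    admissible value \<open>q + 1\<close>.\<close>
  have rate: "speed_coeff p q > 0" "tail_rate p q > 0" "tail_start p q > 0"
    using GN_params.speed_coeff_pos[OF params[of "q + 1"]] GN_params.tail_start_bounds(3)[OF params[of "q + 1"]]
    by auto
  have "C > 0"
  proof (cases "q = p - 1")
    case False
    then have "c > 0" using assms rate by (auto simp: c_def \<sigma>_def)
    then show ?thesis using False rate by (simp add: C_def add_pos_pos)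
  qed (use rate in \<open>simp add: C_def\<close>)
  have tail: "(q > p - 1 \<longrightarrow> (\<forall>r\<ge>2 * tail_start p q. u r + r * \<bar>deriv u r\<bar> \<le> C * r powr (- (p / (q + 1 - p))))) \<and>
      (q = p - 1 \<longrightarrow> (\<forall>r\<ge>2 * tail_start p q. u r \<le> exp (- (C * r))))"
    if m: "m > 2 * q + 1" and u: "pos_decr_solution p q m u" for m u
  proof -
    have "m > q" using m assms by simp
    note tail = GN_params.tail_polynomial[OF params[OF this] u m \<sigma>_def _ c_def]
      GN_params.tail_exponential[OF params[OF this] u m]
    show ?thesis using tail by (auto simp: C_def)
  qed
  show "\<exists>r_star>0. \<exists>C>0. \<forall>m>2 * q + 1. \<forall>u. pos_decr_solution p q m u \<longrightarrow>
      (q > p - 1 \<longrightarrow>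
         (\<forall>r\<ge>2 * r_star. u r + r * \<bar>deriv u r\<bar> \<le> C * r powr (- (p / (q + 1 - p))))) \<and>
      (q = p - 1 \<longrightarrow> (\<forall>r\<ge>2 * r_star. u r \<le> exp (- (C * r))))"
    using rate(3) \<open>C > 0\<close> tail by blast
qed

end
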